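(* Let $F$ be a field, let $D$ be a subring of $F$, let $Z$ be a subspace of the Zariski-Riemann space of $F/D$ with $F \in Z$, regarded as a locally ringed space over $\mathrm{Spec}(D)$, and let $A = \bigcap_{V \in Z} V$. Suppose that $D$ is local and integrally closed in $F$, and that only finitely many valuation rings in $Z$ do not dominate $D$. If no $D$-morphism $Z \rightarrow \mathbb{P}^1_D$ has every closed point of $\mathbb{P}^1_D$ in its image, then $A$ is a Prüfer domain with torsion Picard group and quotient field $F$.
   Context: A subring $V$ of $F$ is a valuation ring of $F$ if for each nonzero $x \in F$, $x \in V$ or $x^{-1} \in V$ (so $F$ itself is one). $D$ need not have quotient field $F$. A local ring is a ring with a unique maximal ideal (not necessarily Noetherian). A valuation ring $V \supseteq D$ dominates $D$ if the maximal ideal of $D$ is contained in the maximal ideal of $V$. The Zariski-Riemann space $\mathfrak{X}$ of $F/D$ is the set of all valuation rings of $F$ containing $D$, with the topology whose basic open sets are $\{V \in \mathfrak{X} : t_1,\ldots,t_n \in V\}$, $t_1,\ldots,t_n \in F$; $Z$ is any subset of $\mathfrak{X}$ containing $F$, with the subspace topology. $Z$ is a locally ringed space with structure sheaf $\mathcal{O}_Z(U) = \bigcap_{V \in U} V$ for nonempty open $U \subseteq Z$ and $\mathcal{O}_Z(\emptyset) = 0$; restriction maps off the empty set are inclusions, and the stalk at $V \in Z$ is $V$. The structure morphism $Z \to \mathrm{Spec}(D)$ sends $V$ to its center in $D$ (the contraction to $D$ of the maximal ideal of $V$), and is given on sections by inclusions inside $F$. All morphisms are morphisms of locally ringed spaces.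 A $D$-morphism is a morphism commuting with the given morphisms to $\mathrm{Spec}(D)$. $\mathbb{P}^1_D = \mathrm{Proj}(D[T_0,T_1])$. $A$ is a Prüfer domain with quotient field $F$ if for every prime ideal $P$ of $A$ the localization $A_P$ is a valuation ring of $F$. *)

theory Defs
  imports
    "HOL-Algebra.Subrings"
    "HOL-Analysis.Function_Topology"
    "HOL-Computational_Algebra.Polynomial"
    "HOL-Computational_Algebra.Fraction_Field"
begin

section \<open>Subrings of a commutative ring given by a type\<close>

text \<open>The field \<open>F\<close> is a type of class \<open>field\<close>. A subset of a commutative ring type is turned
  into a ring record of HOL-Algebra; it satisfies \<open>cring\<close> when the subset is a subring.\<close>

definition ring_on :: "'a::comm_ring_1 set \<Rightarrow> 'a ring" where
  "ring_on A = \<lparr>carrier = A, monoid.mult = (*), one = 1, zero = 0, add = (+)\<rparr>"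

definition is_subring :: "'a::comm_ring_1 set \<Rightarrow> bool" where
  "is_subring A \<longleftrightarrow> subring A (ring_on UNIV)"

definition local_ring :: "('a, 'b) ring_scheme \<Rightarrow> bool" where
  "local_ring R \<longleftrightarrow> cring R \<and> (\<exists>!M. maximalideal M R)"

text \<open>Only used for local rings.\<close>
definition max_ideal :: "('a, 'b) ring_scheme \<Rightarrow> 'a set" where
  "max_ideal R = (THE M. maximalideal M R)"

definition integrally_closed_in_field :: "'a::field set \<Rightarrow> bool" where
  "integrally_closed_in_field D \<longleftrightarrow>
     (\<forall>x. (\<exists>p :: 'a poly. lead_coeff p = 1 \<and> (\<forall>i. Polynomial.coeff p i \<in> D) \<and> poly p x = 0)
          \<longrightarrow> x \<in> D)"


section \<open>Valuation rings and the Zariski-Riemann space\<close>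

definition valuation_ring :: "'a::field set \<Rightarrow> bool" where
  "valuation_ring V \<longleftrightarrow> is_subring V \<and> (\<forall>x. x \<noteq> 0 \<longrightarrow> x \<in> V \<or> inverse x \<in> V)"

definition dominates :: "'a::field set \<Rightarrow> 'a set \<Rightarrow> bool" where
  "dominates V D \<longleftrightarrow> max_ideal (ring_on D) \<subseteq> max_ideal (ring_on V)"

definition zariski_riemann :: "'a::field set \<Rightarrow> 'a set set" where
  "zariski_riemann D = {V. valuation_ring V \<and> D \<subseteq> V}"

definition zr_topology :: "'a::field set \<Rightarrow> 'a set topology" where
  "zr_topology D =
     topology_generated_by {{V \<in> zariski_riemann D. T \<subseteq> V} | T. finite T}"


section \<open>Ringed spaces and morphisms of locally ringed spaces\<close>

text \<open>A space with a presheaf of rings: the topology, the ring of sections on each open set, and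
  the restriction maps \<open>res X U W\<close> from \<open>U\<close> to \<open>W \<subseteq> U\<close>. Values at sets that are not open (or for
  \<open>W\<close> not contained in \<open>U\<close>) are irrelevant.\<close>

record ('p, 's) ringed_space =
  space_top :: "'p topology"
  sec :: "'p set \<Rightarrow> 's ring"
  res :: "'p set \<Rightarrow> 'p set \<Rightarrow> 's \<Rightarrow> 's"

definition germ ::
  "('p, 's) ringed_space \<Rightarrow> 'p \<Rightarrow> 'p set \<Rightarrow> 's \<Rightarrow> ('p set \<times> 's) set" where
  "germ X x U s =
     {(W, t). openin (space_top X) W \<and> x \<in> W \<and> t \<in> carrier (sec X W) \<and>
        (\<exists>N. openin (space_top X) N \<and> x \<in> N \<and> N \<subseteq> U \<inter> W \<and> res X U N s = res X W N t)}"

definition stalk :: "('p, 's) ringed_space \<Rightarrow> 'p \<Rightarrow> ('p set \<times> 's) set ring" where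
  "stalk X x =
     \<lparr>carrier = {germ X x U s | U s. openin (space_top X) U \<and> x \<in> U \<and> s \<in> carrier (sec X U)},
      monoid.mult = (\<lambda>a b. \<Union>(U, s)\<in>a. \<Union>(W, t)\<in>b.
        germ X x (U \<inter> W) (res X U (U \<inter> W) s \<otimes>\<^bsub>sec X (U \<inter> W)\<^esub> res X W (U \<inter> W) t)),
      one = germ X x (topspace (space_top X)) \<one>\<^bsub>sec X (topspace (space_top X))\<^esub>,
      zero = germ X x (topspace (space_top X)) \<zero>\<^bsub>sec X (topspace (space_top X))\<^esub>,
      add = (\<lambda>a b. \<Union>(U, s)\<in>a. \<Union>(W, t)\<in>b.
        germ X x (U \<inter> W) (res X U (U \<inter> W) s \<oplus>\<^bsub>sec X (U \<inter> W)\<^esub> res X W (U \<inter> W) t))\<rparr>"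

text \<open>A morphism from \<open>X\<close> to \<open>Y\<close> is a pair: the map on points and, for each open set \<open>U\<close> of \<open>Y\<close>,
  the map from the sections of \<open>Y\<close> on \<open>U\<close> to the sections of \<open>X\<close> on the preimage of \<open>U\<close>.\<close>

type_synonym ('p, 's, 'q, 't) morph = "('p \<Rightarrow> 'q) \<times> ('q set \<Rightarrow> 't \<Rightarrow> 's)"

definition preim :: "('p, 's) ringed_space \<Rightarrow> ('p, 's, 'q, 't) morph \<Rightarrow> 'q set \<Rightarrow> 'p set" where
  "preim X f U = {x \<in> topspace (space_top X). fst f x \<in> U}"

definition stalk_map ::
  "('p, 's) ringed_space \<Rightarrow> ('p, 's, 'q, 't) morph \<Rightarrow> 'p \<Rightarrow> ('q set \<times> 't) set \<Rightarrow> ('p set \<times> 's) set"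
  where "stalk_map X f x a = (\<Union>(U, s)\<in>a. germ X x (preim X f U) (snd f U s))"

text \<open>\<open>X\<close> and \<open>Y\<close> are meant to be locally ringed spaces, so that both maximal ideals in the last
  condition are unique; the induced maps of stalks are automatically ring homomorphisms.\<close>

definition lrs_morphism ::
  "('p, 's) ringed_space \<Rightarrow> ('q, 't) ringed_space \<Rightarrow> ('p, 's, 'q, 't) morph \<Rightarrow> bool" where
  "lrs_morphism X Y f \<longleftrightarrow>
     continuous_map (space_top X) (space_top Y) (fst f) \<and>
     (\<forall>U. openin (space_top Y) U \<longrightarrow> snd f U \<in> ring_hom (sec Y U) (sec X (preim X f U))) \<and>
     (\<forall>U W s. openin (space_top Y) U \<and> openin (space_top Y) W \<and> W \<subseteq> U \<and> s \<in> carrier (sec Y U) \<longrightarrow>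
        snd f W (res Y U W s) = res X (preim X f U) (preim X f W) (snd f U s)) \<and>
     (\<forall>x \<in> topspace (space_top X). \<forall>M N.
        maximalideal M (stalk Y (fst f x)) \<and> maximalideal N (stalk X x) \<longrightarrow>
        stalk_map X f x ` M \<subseteq> N)"

text \<open>For \<open>p\<close> from \<open>X\<close> to \<open>B\<close> and \<open>q\<close> from \<open>Y\<close> to \<open>B\<close>: a morphism \<open>f\<close> from \<open>X\<close> to \<open>Y\<close> with
  \<open>q \<circ> f = p\<close>, as maps on points and on sections.\<close>

definition lrs_morphism_over ::
  "('b, 'r) ringed_space \<Rightarrow> ('p, 's) ringed_space \<Rightarrow> ('p, 's, 'b, 'r) morph \<Rightarrow>
   ('q, 't) ringed_space \<Rightarrow> ('q, 't, 'b, 'r) morph \<Rightarrow> ('p, 's, 'q, 't) morph \<Rightarrow> bool" where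
  "lrs_morphism_over B X p Y q f \<longleftrightarrow>
     lrs_morphism X Y f \<and>
     (\<forall>x \<in> topspace (space_top X). fst q (fst f x) = fst p x) \<and>
     (\<forall>U s. openin (space_top B) U \<and> s \<in> carrier (sec B U) \<longrightarrow>
        snd f (preim Y q U) (snd q U s) = snd p U s)"

definition closed_points :: "('p, 's) ringed_space \<Rightarrow> 'p set" where
  "closed_points X = {x \<in> topspace (space_top X). closedin (space_top X) {x}}"


section \<open>Spec and Proj\<close>

text \<open>The rings involved are domains, so their localizations are realized inside a field: those of
  a subring of a field type inside that field, those of a graded subring of a domain type inside
  its type of fractions.
  As usual, sections on \<open>U\<close> are the functions on \<open>U\<close> with values in the localizations that are
  locally given by fractions.\<close>

definition function_ring :: "'p set \<Rightarrow> ('p \<Rightarrow> 'k::field) set \<Rightarrow> ('p \<Rightarrow> 'k) ring" where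
  "function_ring U S =
     \<lparr>carrier = S, monoid.mult = (\<lambda>s t. \<lambda>x\<in>U. s x * t x), one = (\<lambda>x\<in>U. 1), zero = (\<lambda>x\<in>U. 0),
      add = (\<lambda>s t. \<lambda>x\<in>U. s x + t x)\<rparr>"

definition primes :: "'a::comm_ring_1 set \<Rightarrow> 'a set set" where
  "primes A = {P. primeideal P (ring_on A)}"

definition spec_topology :: "'a::comm_ring_1 set \<Rightarrow> 'a set topology" where
  "spec_topology A = topology_generated_by {{P \<in> primes A. f \<notin> P} | f. f \<in> A}"

definition localization :: "'a::field set \<Rightarrow> 'a set \<Rightarrow> 'a set" where
  "localization A P = {a / b | a b. a \<in> A \<and> b \<in> A - P}"

definition spec_sections :: "'a::field set \<Rightarrow> 'a set set \<Rightarrow> ('a set \<Rightarrow> 'a) set" where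
  "spec_sections A U =
     {s \<in> (\<Pi>\<^sub>E P\<in>U. localization A P).
        \<forall>P\<in>U. \<exists>W a b. openin (spec_topology A) W \<and> P \<in> W \<and> W \<subseteq> U \<and> a \<in> A \<and> b \<in> A \<and>
          (\<forall>Q\<in>W. b \<notin> Q \<and> s Q = a / b)}"

definition Spec :: "'a::field set \<Rightarrow> ('a set, 'a set \<Rightarrow> 'a) ringed_space" where
  "Spec A =
     \<lparr>space_top = spec_topology A,
      sec = (\<lambda>U. function_ring U (spec_sections A U)),
      res = (\<lambda>U W s. restrict s W)\<rparr>"

text \<open>A graded ring is given by its homogeneous pieces \<open>G n\<close> inside a domain type.\<close>

definition graded_sum :: "(nat \<Rightarrow> 'r::comm_ring_1 set) \<Rightarrow> 'r set" where
  "graded_sum G = {\<Sum>n\<le>N. g n | g N. \<forall>n. g n \<in> G n}"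

definition proj_points :: "(nat \<Rightarrow> 'r::idom set) \<Rightarrow> 'r set set" where
  "proj_points G =
     {P \<in> primes (graded_sum G). P = graded_sum (\<lambda>n. G n \<inter> P) \<and> \<not> (\<Union>n\<in>{1..}. G n) \<subseteq> P}"

definition proj_topology :: "(nat \<Rightarrow> 'r::idom set) \<Rightarrow> 'r set topology" where
  "proj_topology G = subtopology (spec_topology (graded_sum G)) (proj_points G)"

definition homogeneous_localization ::
  "(nat \<Rightarrow> 'r::idom set) \<Rightarrow> 'r set \<Rightarrow> 'r fract set" where
  "homogeneous_localization G P = {Fract a b | a b n. a \<in> G n \<and> b \<in> G n - P}"

definition proj_sections :: "(nat \<Rightarrow> 'r::idom set) \<Rightarrow> 'r set set \<Rightarrow> ('r set \<Rightarrow> 'r fract) set" where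
  "proj_sections G U =
     {s \<in> (\<Pi>\<^sub>E P\<in>U. homogeneous_localization G P).
        \<forall>P\<in>U. \<exists>W a b n. openin (proj_topology G) W \<and> P \<in> W \<and> W \<subseteq> U \<and> a \<in> G n \<and> b \<in> G n \<and>
          (\<forall>Q\<in>W. b \<notin> Q \<and> s Q = Fract a b)}"

definition Proj :: "(nat \<Rightarrow> 'r::idom set) \<Rightarrow> ('r set, 'r set \<Rightarrow> 'r fract) ringed_space" where
  "Proj G =
     \<lparr>space_top = proj_topology G,
      sec = (\<lambda>U. function_ring U (proj_sections G U)),
      res = (\<lambda>U W s. restrict s W)\<rparr>"


section \<open>The projective line over \<open>D\<close>\<close>

text \<open>The polynomial ring in \<open>T\<^sub>0\<close> and \<open>T\<^sub>1\<close> over \<open>D\<close> is the subring of \<open>'a poly poly\<close> of polynomials with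
  coefficients in \<open>D\<close>; the inner variable is \<open>T\<^sub>0\<close>, the outer one \<open>T\<^sub>1\<close>. The degree \<open>n\<close> piece:\<close>

definition binary_forms :: "'a::field set \<Rightarrow> nat \<Rightarrow> 'a poly poly set" where
  "binary_forms D n =
     {f. \<forall>i j. Polynomial.coeff (Polynomial.coeff f j) i \<in> D \<and>
               (Polynomial.coeff (Polynomial.coeff f j) i \<noteq> 0 \<longrightarrow> i + j = n)}"

definition proj_line ::
  "'a::field set \<Rightarrow> ('a poly poly set, 'a poly poly set \<Rightarrow> 'a poly poly fract) ringed_space" where
  "proj_line D = Proj (binary_forms D)"

text \<open>The structure morphism to \<open>Spec D\<close>: contraction of primes, and on sections the embedding of
  \<open>'a\<close> as constants into the field of rational functions.\<close>

definition proj_line_structure ::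
  "'a::field set \<Rightarrow>
    ('a poly poly set, 'a poly poly set \<Rightarrow> 'a poly poly fract, 'a set, 'a set \<Rightarrow> 'a) morph" where
  "proj_line_structure D =
     (let \<pi> = (\<lambda>P. {a \<in> D. [:[:a:]:] \<in> P})
      in (\<pi>, \<lambda>U s. \<lambda>P\<in>{P \<in> proj_points (binary_forms D). \<pi> P \<in> U}. Fract [:[:s (\<pi> P):]:] 1))"


section \<open>\<open>Z\<close> as a locally ringed space over \<open>Spec D\<close>\<close>

definition zero_ring :: "'a::comm_ring_1 ring" where
  "zero_ring = ring_on {0}\<lparr>one := 0\<rparr>"

definition zr_space :: "'a::field set \<Rightarrow> 'a set set \<Rightarrow> ('a set, 'a) ringed_space" where
  "zr_space D Z =
     \<lparr>space_top = subtopology (zr_topology D) Z,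
      sec = (\<lambda>U. if U = {} then zero_ring else ring_on (\<Inter>U)),
      res = (\<lambda>U W s. if W = {} then 0 else s)\<rparr>"

text \<open>The ideal \<open>{0}\<close> is the generic point of \<open>Spec D\<close> and lies in every nonempty open \<open>U\<close>. Sections of
  \<open>Spec D\<close> on \<open>U\<close> are constant functions with values in the field, so evaluation at \<open>{0}\<close> is the
  inclusion of the sections on \<open>U\<close> into the field. As \<open>UNIV\<close> (the field itself) belongs to \<open>Z\<close> and has
  center \<open>{0}\<close>, the preimage of \<open>U\<close> is empty only if \<open>U\<close> is.\<close>

definition zr_structure ::
  "'a::field set \<Rightarrow> ('a set, 'a, 'a set, 'a set \<Rightarrow> 'a) morph" where
  "zr_structure D =
     (\<lambda>V. max_ideal (ring_on V) \<inter> D, \<lambda>U s. if U = {} then 0 else s {0})"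

definition D_morphism_to_proj_line ::
  "'a::field set \<Rightarrow> 'a set set \<Rightarrow>
   ('a set, 'a, 'a poly poly set, 'a poly poly set \<Rightarrow> 'a poly poly fract) morph \<Rightarrow> bool" where
  "D_morphism_to_proj_line D Z f \<longleftrightarrow>
     lrs_morphism_over (Spec D) (zr_space D Z) (zr_structure D)
       (proj_line D) (proj_line_structure D) f"


section \<open>Pruefer domains and the Picard group\<close>

definition quotient_field_UNIV :: "'a::field set \<Rightarrow> bool" where
  "quotient_field_UNIV A \<longleftrightarrow> (\<forall>x. \<exists>a\<in>A. \<exists>b\<in>A. b \<noteq> 0 \<and> x = a / b)"

text \<open>Localizing at a prime to a valuation ring of the field forces the quotient field of \<open>A\<close> to be
  the whole field.\<close>

definition prufer_domain :: "'a::field set \<Rightarrow> bool" where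
  "prufer_domain A \<longleftrightarrow>
     is_subring A \<and> (\<forall>P\<in>primes A. valuation_ring (localization A P))"

definition fractional_ideal :: "'a::field set \<Rightarrow> 'a set \<Rightarrow> bool" where
  "fractional_ideal A I \<longleftrightarrow>
     0 \<in> I \<and> (\<forall>x\<in>I. \<forall>y\<in>I. x + y \<in> I) \<and> (\<forall>a\<in>A. \<forall>x\<in>I. a * x \<in> I) \<and>
     (\<exists>d\<in>A. d \<noteq> 0 \<and> (\<forall>x\<in>I. d * x \<in> A))"

definition ideal_mult :: "'a::field set \<Rightarrow> 'a set \<Rightarrow> 'a set" where
  "ideal_mult I J = {\<Sum>k<n. x k * y k | (n::nat) x y. \<forall>k<n. x k \<in> I \<and> y k \<in> J}"

definition invertible_ideals :: "'a::field set \<Rightarrow> 'a set monoid" where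
  "invertible_ideals A =
     \<lparr>carrier = {I. fractional_ideal A I \<and> (\<exists>J. fractional_ideal A J \<and> ideal_mult I J = A)},
      monoid.mult = ideal_mult, one = A\<rparr>"

definition principal_ideals :: "'a::field set \<Rightarrow> 'a set set" where
  "principal_ideals A = {(*) x ` A | x. x \<noteq> 0}"

text \<open>For a domain with the whole field as its quotient field: invertible fractional ideals modulo
  principal ones, which is the group of isomorphism classes of invertible modules.\<close>

definition picard_group :: "'a::field set \<Rightarrow> 'a set set monoid" where
  "picard_group A = invertible_ideals A Mod principal_ideals A"

definition torsion_group :: "('g, 'm) monoid_scheme \<Rightarrow> bool" where
  "torsion_group G \<longleftrightarrow>
     (\<forall>g\<in>carrier G. \<exists>n::nat. n > 0 \<and> g [^]\<^bsub>G\<^esub> n = \<one>\<^bsub>G\<^esub>)"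

end

(*
For t in F, the local rings of Z being valuation rings, the homogeneous coordinates (1 : t) define a
D-morphism from Z to the projective line. By hypothesis it misses a closed point Q. Since D is local,
Q lies over the maximal ideal M of D and is cut out modulo M by a single form f. A valuation ring
dominating D is sent to a point over M different from Q, hence to a point where f does not vanish;
adding to a power of f a form with coefficients in M, one also avoids the images of the finitely many
other valuation rings. The resulting form h of degree k vanishes nowhere on the image of Z, so
u = h(1, t) generates the k-th power of (1, t) in every member of Z, and thus in A. Hence (1, t) is
invertible with a principal power for all t, which makes A a Pruefer domain with quotient field F,
and induction on the number of generators gives a principal power of every invertible ideal.
*)
theory Submission
  imports Defs
begin

section \<open>Subrings and valuation rings\<close>

text \<open>A closed point Q is at first only known to be maximal under inclusion among the points,
  because open sets are stable under passing to smaller primes. That it lies over M reflects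
  properness of the projective line; here it comes from Nakayama's lemma applied to the monomials of
  one large degree. The residue field is never formed: congruence modulo \<open>MS\<close>, the
  polynomials with coefficients in M, replaces it, and f is a form whose reduction generates that of
  Q, found by a division algorithm. Corrections of f for the other valuation rings need coefficients
  in M, since otherwise the nonvanishing at points over M would be lost; they can act because those
  points miss some element of M. Principality at each V does not in general pass to A. Here one u
  serves all V: it is a combination of the powers t^i, i <= k, with coefficients in D, and each t^i
  / u lies in every V, hence in A. In the induction on generators a pair w, x^N replaces the ideal,
  where w controls the N-th powers of the earlier generators; powers of generators suffice because
  divisibility in each V is total.\<close>

lemma ring_on_simps [simp]:
  "carrier (ring_on A) = A" "x \<otimes>\<^bsub>ring_on A\<^esub> y = x * y" "x \<oplus>\<^bsub>ring_on A\<^esub> y = x + y"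
  "\<one>\<^bsub>ring_on A\<^esub> = 1" "\<zero>\<^bsub>ring_on A\<^esub> = 0"
  by (simp_all add: ring_on_def)

lemma cring_ring_on_UNIV: "cring (ring_on (UNIV :: 'a::comm_ring_1 set))"
proof (rule cringI)
  show "abelian_group (ring_on (UNIV :: 'a set))"
  proof (rule abelian_groupI)
    fix x assume "x \<in> carrier (ring_on (UNIV :: 'a set))"
    show "\<exists>y\<in>carrier (ring_on UNIV). y \<oplus>\<^bsub>ring_on UNIV\<^esub> x = \<zero>\<^bsub>ring_on UNIV\<^esub>"
      by (intro bexI[of _ "-x"]) auto
  qed (auto simp: algebra_simps)
  show "comm_monoid (ring_on (UNIV :: 'a set))"
    by (rule comm_monoidI) (auto simp: algebra_simps)
qed (auto simp: algebra_simps)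

lemma a_inv_ring_on_UNIV: "\<ominus>\<^bsub>ring_on UNIV\<^esub> x = - (x :: 'a::comm_ring_1)"
proof -
  interpret cring "ring_on (UNIV :: 'a set)" by (rule cring_ring_on_UNIV)
  show ?thesis using minus_equality[of "-x" x] by simp
qed

lemma is_subring_iff:
  "is_subring A \<longleftrightarrow> 1 \<in> A \<and> (\<forall>x\<in>A. - x \<in> A) \<and> (\<forall>x\<in>A. \<forall>y\<in>A. x + y \<in> A) \<and>
     (\<forall>x\<in>A. \<forall>y\<in>A. x * y \<in> (A :: 'a::comm_ring_1 set))"
proof -
  interpret cring "ring_on (UNIV :: 'a set)" by (rule cring_ring_on_UNIV)
  show ?thesis
    unfolding is_subring_def
  proof
    assume "subring A (ring_on UNIV)"
    from subringE(3,5,6,7)[OF this]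
    show "1 \<in> A \<and> (\<forall>x\<in>A. - x \<in> A) \<and> (\<forall>x\<in>A. \<forall>y\<in>A. x + y \<in> A) \<and> (\<forall>x\<in>A. \<forall>y\<in>A. x * y \<in> A)"
      by (simp add: a_inv_ring_on_UNIV)
  qed (rule subringI, simp_all add: a_inv_ring_on_UNIV)
qed

lemma is_subringD:
  assumes "is_subring A"
  shows "1 \<in> A" "0 \<in> A" "x \<in> A \<Longrightarrow> - x \<in> A" "x \<in> A \<Longrightarrow> y \<in> A \<Longrightarrow> x + y \<in> A"
    "x \<in> A \<Longrightarrow> y \<in> A \<Longrightarrow> x - y \<in> A" "x \<in> A \<Longrightarrow> y \<in> A \<Longrightarrow> x * y \<in> A" "x \<in> A \<Longrightarrow> x ^ n \<in> A"
proof -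
  show 1: "1 \<in> A" using assms by (auto simp: is_subring_iff)
  show mi: "x \<in> A \<Longrightarrow> - x \<in> A" for x using assms by (auto simp: is_subring_iff)
  show add: "x \<in> A \<Longrightarrow> y \<in> A \<Longrightarrow> x + y \<in> A" for x y using assms by (auto simp: is_subring_iff)
  show mult: "x \<in> A \<Longrightarrow> y \<in> A \<Longrightarrow> x * y \<in> A" for x y using assms by (auto simp: is_subring_iff)
  show "0 \<in> A" using add[OF 1 mi[OF 1]] by simp
  show "x \<in> A \<Longrightarrow> y \<in> A \<Longrightarrow> x - y \<in> A" using add[of x "-y"] mi[of y] by simp
  show "x \<in> A \<Longrightarrow> x ^ n \<in> A" by (induction n) (simp_all add: 1 mult)
qed

lemma is_subring_sum:
  assumes "is_subring A" "\<And>i. i \<in> I \<Longrightarrow> f i \<in> A"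
  shows "sum f I \<in> A"
  using assms(2) by (induction I rule: infinite_finite_induct) (simp_all add: is_subringD(2,4)[OF assms(1)])

lemma cring_ring_on:
  assumes "is_subring (A :: 'a::comm_ring_1 set)"
  shows "cring (ring_on A)"
proof (rule cringI)
  note A = is_subringD[OF assms]
  show "abelian_group (ring_on A)"
  proof (rule abelian_groupI)
    fix x assume "x \<in> carrier (ring_on A)"
    then show "\<exists>y\<in>carrier (ring_on A). y \<oplus>\<^bsub>ring_on A\<^esub> x = \<zero>\<^bsub>ring_on A\<^esub>"
      by (intro bexI[of _ "-x"]) (auto simp: A(3))
  qed (auto simp: algebra_simps A(1,2,4,6))
  show "comm_monoid (ring_on A)"
    by (rule comm_monoidI) (auto simp: algebra_simps A(1,2,4,6))
qed (auto simp: algebra_simps)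

lemma a_inv_ring_on:
  assumes "is_subring A" "x \<in> A"
  shows "\<ominus>\<^bsub>ring_on A\<^esub> x = - x"
proof -
  interpret cring "ring_on A" by (rule cring_ring_on) fact
  show ?thesis using minus_equality[of "-x" x] is_subringD[OF assms(1)] assms(2) by auto
qed

lemma ideal_ring_on_iff:
  assumes "is_subring A"
  shows "ideal I (ring_on A) \<longleftrightarrow> I \<subseteq> A \<and> 0 \<in> I \<and> (\<forall>x\<in>I. \<forall>y\<in>I. x + y \<in> I) \<and> (\<forall>a\<in>A. \<forall>x\<in>I. a * x \<in> I)"
    (is "_ \<longleftrightarrow> ?R")
proof
  interpret cring "ring_on A" by (rule cring_ring_on) fact
  assume "ideal I (ring_on A)"
  then interpret ideal I "ring_on A" .
  show ?R using a_subset I_l_closed a_closed additive_subgroup.zero_closed[OF is_additive_subgroup]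
    by auto
next
  interpret cring "ring_on A" by (rule cring_ring_on) fact
  assume R: ?R
  have m: "-x \<in> I" if "x \<in> I" for x
  proof -
    have "(- 1) * x \<in> I" using R that is_subringD[OF assms] by blast
    then show ?thesis by simp
  qed
  show "ideal I (ring_on A)"
  proof (rule idealI)
    show "subgroup I (add_monoid (ring_on A))"
      using R m by (intro add.subgroupI) (auto simp: a_inv_ring_on[OF assms] subset_iff)
    show "a \<otimes>\<^bsub>ring_on A\<^esub> x \<in> I" "x \<otimes>\<^bsub>ring_on A\<^esub> a \<in> I"
      if "a \<in> I" "x \<in> carrier (ring_on A)" for a x
      using R that by (auto simp: mult.commute[of a])
  qed unfold_locales
qed

lemma primes_iff:
  assumes "is_subring A"
  shows "P \<in> primes A \<longleftrightarrow> P \<subseteq> A \<and> 0 \<in> P \<and> (\<forall>x\<in>P. \<forall>y\<in>P. x + y \<in> P) \<and> (\<forall>a\<in>A. \<forall>x\<in>P. a * x \<in> P) \<and>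
    1 \<notin> P \<and> (\<forall>a\<in>A. \<forall>b\<in>A. a * b \<in> P \<longrightarrow> a \<in> P \<or> b \<in> P)" (is "_ \<longleftrightarrow> ?R")
proof
  assume "P \<in> primes A"
  then interpret primeideal P "ring_on A" by (simp add: primes_def)
  have "1 \<notin> P" using one_imp_carrier I_notcarr by auto
  then show ?R using I_prime is_ideal[unfolded ideal_ring_on_iff[OF assms]] by auto
next
  assume R: ?R
  then have "primeideal P (ring_on A)"
    using is_subringD(1)[OF assms]
    by (intro primeidealI cring_ring_on assms) (auto simp: ideal_ring_on_iff[OF assms])
  then show "P \<in> primes A" by (simp add: primes_def)
qed

lemma maximalideal_ring_on_iff:
  assumes "is_subring A"
  shows "maximalideal M (ring_on A) \<longleftrightarrow> ideal M (ring_on A) \<and> 1 \<notin> M \<and>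
    (\<forall>J. ideal J (ring_on A) \<longrightarrow> M \<subseteq> J \<longrightarrow> 1 \<notin> J \<longrightarrow> J = M)" (is "_ \<longleftrightarrow> ?R")
proof
  assume "maximalideal M (ring_on A)"
  then interpret maximalideal M "ring_on A" .
  have "1 \<notin> M" using one_imp_carrier I_notcarr by auto
  moreover have "J = M" if "ideal J (ring_on A)" "M \<subseteq> J" "1 \<notin> J" for J
    using I_maximal[of J] that is_subringD(1)[OF assms] by (auto simp: ideal_ring_on_iff[OF assms])
  ultimately show ?R using is_ideal by blast
next
  assume R: ?R
  show "maximalideal M (ring_on A)"
  proof (rule maximalidealI)
    show "carrier (ring_on A) \<noteq> M" using R is_subringD(1)[OF assms] by auto
    show "J = M \<or> J = carrier (ring_on A)" if "ideal J (ring_on A)" "M \<subseteq> J" for J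
      using R that ideal.one_imp_carrier[OF that(1)] by auto
  qed (use R in auto)
qed

text \<open>Zorn's lemma, with properness written as absence of 1 so that it passes to unions of
  chains.\<close>

lemma exists_maximalideal_ring_on:
  assumes "is_subring A" "ideal I (ring_on A)" "1 \<notin> I"
  shows "\<exists>M. maximalideal M (ring_on A) \<and> I \<subseteq> M"
proof -
  define \<J> where "\<J> = {J. ideal J (ring_on A) \<and> I \<subseteq> J \<and> 1 \<notin> J}"
  have "\<exists>M\<in>\<J>. \<forall>X\<in>\<J>. M \<subseteq> X \<longrightarrow> X = M"
  proof (rule subset_Zorn_nonempty)
    show "\<J> \<noteq> {}" using assms by (auto simp: \<J>_def)
    fix \<C> assume ne: "\<C> \<noteq> {}" and ch: "subset.chain \<J> \<C>"
    then have sub: "\<C> \<subseteq> \<J>" and lin: "\<And>X Y. X \<in> \<C> \<Longrightarrow> Y \<in> \<C> \<Longrightarrow> X \<subseteq> Y \<or> Y \<subseteq> X"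
      by (auto simp: subset_chain_def)
    have add: "x + y \<in> \<Union>\<C>" if xy: "x \<in> \<Union>\<C>" "y \<in> \<Union>\<C>" for x y
    proof -
      obtain X Y where "X \<in> \<C>" "Y \<in> \<C>" "x \<in> X" "y \<in> Y" using xy by blast
      then have "\<exists>Z\<in>\<C>. x \<in> Z \<and> y \<in> Z" using lin by blast
      then show ?thesis using sub unfolding \<J>_def ideal_ring_on_iff[OF assms(1)] by blast
    qed
    show "\<Union>\<C> \<in> \<J>"
      using ne sub add unfolding \<J>_def ideal_ring_on_iff[OF assms(1)] by blast
  qed
  then obtain M where "M \<in> \<J>" and M: "\<And>X. X \<in> \<J> \<Longrightarrow> M \<subseteq> X \<Longrightarrow> X = M" by blast
  then show ?thesis
    unfolding maximalideal_ring_on_iff[OF assms(1)] \<J>_def by blast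
qed

lemma max_ideal_local:
  assumes "is_subring D" "local_ring (ring_on (D :: 'a::field set))"
  defines "M \<equiv> max_ideal (ring_on D)"
  shows "ideal M (ring_on D)" "1 \<notin> M" "x \<in> D \<Longrightarrow> x \<notin> M \<Longrightarrow> inverse x \<in> D"
proof -
  have uni: "\<exists>!M. maximalideal M (ring_on D)" using assms(2) by (simp add: local_ring_def)
  have M: "maximalideal M (ring_on D)" unfolding M_def max_ideal_def using uni by (rule theI')
  then show "ideal M (ring_on D)" "1 \<notin> M"
    by (simp_all add: maximalideal_ring_on_iff[OF assms(1)])
  show "inverse x \<in> D" if "x \<in> D" "x \<notin> M"
  proof (rule ccontr)
    assume not_in: "inverse x \<notin> D"
    \<comment> \<open>If x had no inverse in D, the ideal x D would be proper and so lie in the only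
      maximal ideal, which does not contain x.\<close>
    have "ideal ((*) x ` D) (ring_on D)"
      unfolding ideal_ring_on_iff[OF assms(1)]
    proof (intro conjI ballI)
      show "0 \<in> (*) x ` D" using is_subringD[OF assms(1)] by (auto intro: rev_image_eqI)
      show "a + b \<in> (*) x ` D" if "a \<in> (*) x ` D" "b \<in> (*) x ` D" for a b
        using that is_subringD[OF assms(1)] by (auto simp flip: distrib_left)
      show "a * b \<in> (*) x ` D" if "a \<in> D" "b \<in> (*) x ` D" for a b
        using that is_subringD[OF assms(1)] by (auto simp: mult.left_commute)
    qed (use that is_subringD[OF assms(1)] in auto)
    moreover have "1 \<notin> (*) x ` D"
      using not_in by (metis imageE inverse_unique)
    ultimately obtain N where "maximalideal N (ring_on D)" "(*) x ` D \<subseteq> N"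
      using exists_maximalideal_ring_on[OF assms(1)] by blast
    then have "(*) x ` D \<subseteq> M" using uni M by blast
    then have "x * 1 \<in> M" using is_subringD(1)[OF assms(1)] by blast
    then show False using that by simp
  qed
qed

text \<open>The maximal ideal of a valuation ring, written without the description operator. The
  element 0 is listed separately because \<open>inverse 0 = 0\<close> would make it look
  invertible.\<close>

definition nonunits :: "'a::field set \<Rightarrow> 'a set" where
  "nonunits V = {x \<in> V. x = 0 \<or> inverse x \<notin> V}"

lemma valuation_ringD:
  assumes "valuation_ring V"
  shows "is_subring V" "x \<notin> V \<Longrightarrow> inverse x \<in> V"
  using assms is_subringD(2)[of V] by (cases "x = 0"; force simp: valuation_ring_def)+

lemma nonunits_facts:
  assumes "valuation_ring V"
  shows "0 \<in> nonunits V" "1 \<notin> nonunits V"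
    "x \<in> nonunits V \<Longrightarrow> x \<in> V"
    "a \<in> V \<Longrightarrow> x \<in> nonunits V \<Longrightarrow> a * x \<in> nonunits V"
    "x \<in> nonunits V \<Longrightarrow> y \<in> nonunits V \<Longrightarrow> x + y \<in> nonunits V"
    "x \<in> V \<Longrightarrow> y \<in> V \<Longrightarrow> x * y \<in> nonunits V \<Longrightarrow> x \<in> nonunits V \<or> y \<in> nonunits V"
proof -
  note V = is_subringD[OF valuation_ringD(1)[OF assms]]
  show "0 \<in> nonunits V" "1 \<notin> nonunits V" "x \<in> nonunits V \<Longrightarrow> x \<in> V"
    using V(1,2) by (simp_all add: nonunits_def)
  show mult: "a * x \<in> nonunits V" if "a \<in> V" "x \<in> nonunits V" for a x
  proof (cases "a * x = 0")
    case False
    have "inverse (a * x) \<notin> V"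
    proof
      assume "inverse (a * x) \<in> V"
      then have "a * inverse (a * x) \<in> V" by (rule V(6)[OF that(1)])
      moreover have "a * inverse (a * x) = inverse x" using False by (simp add: field_simps)
      ultimately have "inverse x \<in> V" by metis
      then show False using that(2) False by (simp add: nonunits_def)
    qed
    then show ?thesis using that V(6) by (simp add: nonunits_def)
  qed (auto simp: nonunits_def V(2))
  \<comment> \<open>Of two nonzero elements one divides the other in V, so their sum is a V-multiple
    of one of them.\<close>
  have *: "x + y \<in> nonunits V" if "x \<in> nonunits V" "y \<in> nonunits V" "x / y \<in> V" "y \<noteq> 0" for x y
  proof -
    have "(x / y + 1) * y \<in> nonunits V" by (intro mult V(4) that V(1))
    moreover have "(x / y + 1) * y = x + y" using that by (simp add: field_simps)
    ultimately show ?thesis by simp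
  qed
  show "x + y \<in> nonunits V" if "x \<in> nonunits V" "y \<in> nonunits V"
  proof (cases "x = 0 \<or> y = 0")
    case False
    have "x / y \<in> V \<or> y / x \<in> V" using valuation_ringD(2)[OF assms, of "x / y"] by (auto simp: field_simps)
    then show ?thesis using *[of x y] *[of y x] that False by (auto simp: add.commute)
  qed (use that in auto)
  show "x \<in> nonunits V \<or> y \<in> nonunits V" if "x \<in> V" "y \<in> V" "x * y \<in> nonunits V"
    using that V(6)[of "inverse x" "inverse y"] by (simp add: nonunits_def) blast
qed

lemma max_ideal_valuation:
  assumes "valuation_ring V"
  shows "max_ideal (ring_on V) = nonunits V"
proof -
  note sub = valuation_ringD(1)[OF assms] and V = is_subringD[OF valuation_ringD(1)[OF assms]]
  have le: "J \<subseteq> nonunits V" if "ideal J (ring_on V)" "1 \<notin> J" for J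
  proof
    fix x assume "x \<in> J"
    moreover have "inverse x \<notin> V" if "x \<noteq> 0"
      using \<open>x \<in> J\<close> \<open>ideal J (ring_on V)\<close> \<open>1 \<notin> J\<close> that unfolding ideal_ring_on_iff[OF sub]
      by (metis left_inverse)
    ultimately show "x \<in> nonunits V"
      using \<open>ideal J (ring_on V)\<close> unfolding ideal_ring_on_iff[OF sub] nonunits_def by blast
  qed
  have id: "ideal (nonunits V) (ring_on V)"
    using nonunits_facts[OF assms] unfolding ideal_ring_on_iff[OF sub] by blast
  have "maximalideal (nonunits V) (ring_on V)"
    unfolding maximalideal_ring_on_iff[OF sub] using id le nonunits_facts(2)[OF assms] by blast
  moreover have "M = nonunits V" if "maximalideal M (ring_on V)" for M
    using that id le nonunits_facts(2)[OF assms] unfolding maximalideal_ring_on_iff[OF sub] by blast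
  ultimately show ?thesis unfolding max_ideal_def by (rule the_equality)
qed

section \<open>Binary forms\<close>

abbreviation cst :: "'a::comm_ring_1 \<Rightarrow> 'a poly poly" where "cst c \<equiv> [:[:c:]:]"
abbreviation T0 :: "'a::comm_ring_1 poly poly" where "T0 \<equiv> [:[:0, 1:]:]"
abbreviation T1 :: "'a::comm_ring_1 poly poly" where "T1 \<equiv> [:0, 1:]"

text \<open>The coefficient of T0^i T1^j: the indices follow the order of the variables, opposite to
  the nesting of the polynomials.\<close>

definition coeff2 :: "'a::zero poly poly \<Rightarrow> nat \<Rightarrow> nat \<Rightarrow> 'a" where
  "coeff2 f i j = Polynomial.coeff (Polynomial.coeff f j) i"

lemma coeff2_eqI: "(\<And>i j. coeff2 f i j = coeff2 g i j) \<Longrightarrow> f = g"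
  by (simp add: poly_eq_iff coeff2_def)

lemma coeff2_simps [simp]:
  "coeff2 0 i j = 0" "coeff2 (f + g) i j = coeff2 f i j + coeff2 g i j" "coeff2 (f - g) i j = coeff2 f i j - coeff2 g i j"
  "coeff2 (- f) i j = - coeff2 f i j"
  "coeff2 1 i j = (if i = 0 \<and> j = 0 then 1 else 0)"
  "coeff2 (cst c) i j = (if i = 0 \<and> j = 0 then c else 0)"
  "coeff2 T0 i j = (if i = 1 \<and> j = 0 then 1 else 0)"
  "coeff2 T1 i j = (if i = 0 \<and> j = 1 then 1 else 0)"
  by (auto simp: coeff2_def coeff_pCons coeff_1 split: nat.splits)

lemma coeff2_sum: "coeff2 (sum f I) i j = (\<Sum>k\<in>I. coeff2 (f k) i j)"
  by (simp add: coeff2_def coeff_sum)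

lemma coeff2_mult: "coeff2 (f * g) i j = (\<Sum>b\<le>j. \<Sum>a\<le>i. coeff2 f a b * coeff2 g (i - a) (j - b))"
  for f g :: "'a::comm_ring_1 poly poly"
  by (simp add: coeff2_def coeff_mult coeff_sum)

lemma coeff2_cst_T1: "coeff2 (cst c * T1 ^ n) i j = (if i = 0 \<and> j = n then c else 0)"
proof -
  have "cst c * T1 ^ n = monom [:c:] n"
    by (simp add: monom_altdef)
  then show ?thesis by (simp add: coeff2_def coeff_pCons split: nat.splits)
qed

lemma coeff2_T0_mult: "coeff2 (T0 * f) i j = (if i = 0 then 0 else coeff2 f (i - 1) j)"
  by (simp add: coeff2_def coeff_pCons split: nat.splits)

lemma bf_iff: "f \<in> binary_forms D n \<longleftrightarrow> (\<forall>i j. coeff2 f i j \<in> D \<and> (coeff2 f i j \<noteq> 0 \<longrightarrow> i + j = n))"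
  by (simp add: binary_forms_def coeff2_def)

lemma bf_0: "0 \<in> D \<Longrightarrow> 0 \<in> binary_forms D n"
  by (simp add: bf_iff)

lemma bf_mono: "I \<subseteq> D \<Longrightarrow> binary_forms I n \<subseteq> binary_forms D n"
  by (fastforce simp: bf_iff)

lemma bf_add:
  assumes "\<And>x y. x \<in> I \<Longrightarrow> y \<in> I \<Longrightarrow> x + y \<in> I" "f \<in> binary_forms I n" "g \<in> binary_forms I n"
  shows "f + g \<in> binary_forms I n"
proof -
  have "i + j = n" if "coeff2 f i j + coeff2 g i j \<noteq> 0" for i j
    using that assms(2,3) by (cases "coeff2 f i j = 0") (auto simp: bf_iff)
  then show ?thesis using assms by (simp add: bf_iff)
qed

lemma bf_uminus:
  assumes "is_subring D" "f \<in> binary_forms D n"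
  shows "- f \<in> binary_forms D n"
  using assms by (simp add: bf_iff is_subringD)

lemma bf_diff:
  assumes "is_subring D" "f \<in> binary_forms D n" "g \<in> binary_forms D n"
  shows "f - g \<in> binary_forms D n"
  using bf_add[of D f n "- g"] bf_uminus[OF assms(1,3)] assms is_subringD(4)[OF assms(1)] by simp

lemma bf_mult_ideal:
  assumes "0 \<in> I" "\<And>x y. x \<in> I \<Longrightarrow> y \<in> I \<Longrightarrow> x + y \<in> I" "\<And>a x. a \<in> D \<Longrightarrow> x \<in> I \<Longrightarrow> a * x \<in> I"
    and "f \<in> binary_forms D n" "g \<in> binary_forms I k"
  shows "f * g \<in> binary_forms I (n + k)"
  unfolding bf_iff
proof (intro allI conjI impI)
  fix i j
  have sumI: "sum h A \<in> I" if "\<And>x. x \<in> A \<Longrightarrow> h x \<in> I" for h :: "nat \<Rightarrow> 'a" and A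
    using that by (induction A rule: infinite_finite_induct) (auto intro: assms)
  show "coeff2 (f * g) i j \<in> I"
    unfolding coeff2_mult using assms(4,5) by (intro sumI assms(3)) (auto simp: bf_iff)
  assume "coeff2 (f * g) i j \<noteq> 0"
  then obtain b where "b \<le> j" "(\<Sum>a\<le>i. coeff2 f a b * coeff2 g (i - a) (j - b)) \<noteq> 0"
    unfolding coeff2_mult by (metis (no_types, lifting) atMost_iff sum.not_neutral_contains_not_neutral)
  then obtain a where "a \<le> i" and nz: "coeff2 f a b * coeff2 g (i - a) (j - b) \<noteq> 0"
    by (metis (no_types, lifting) atMost_iff sum.not_neutral_contains_not_neutral)
  from nz have "a + b = n" "i - a + (j - b) = k" using assms(4,5) unfolding bf_iff by auto
  then show "i + j = n + k" using \<open>a \<le> i\<close> \<open>b \<le> j\<close> by linarith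
qed

lemma bf_mult:
  assumes "is_subring D" "f \<in> binary_forms D n" "g \<in> binary_forms D k"
  shows "f * g \<in> binary_forms D (n + k)"
  by (rule bf_mult_ideal[OF _ _ _ assms(2,3)]) (simp_all add: is_subringD(2,4,6)[OF assms(1)])

lemma bf_cst: "0 \<in> I \<Longrightarrow> c \<in> I \<Longrightarrow> cst c \<in> binary_forms I 0"
  by (simp add: bf_iff)

lemma bf_T0: "is_subring D \<Longrightarrow> T0 \<in> binary_forms D 1"
  and bf_T1: "is_subring D \<Longrightarrow> T1 \<in> binary_forms D 1"
  and bf_1: "is_subring D \<Longrightarrow> 1 \<in> binary_forms D 0"
  by (simp_all add: bf_iff is_subringD(1,2))

lemma bf_power:
  assumes "is_subring D" "f \<in> binary_forms D n"
  shows "f ^ k \<in> binary_forms D (n * k)"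
proof (induction k)
  case (Suc k)
  then show ?case using bf_mult[OF assms Suc] by simp
qed (simp add: bf_1 assms)

lemma bf_zero_deg:
  assumes "f \<in> binary_forms D 0"
  obtains c where "c \<in> D" "f = cst c"
proof
  show "coeff2 f 0 0 \<in> D" using assms by (simp add: bf_iff)
  show "f = cst (coeff2 f 0 0)" using assms by (intro coeff2_eqI) (auto simp: bf_iff)
qed

text \<open>Splitting off the terms free of \<open>T0\<close> leaves a single monomial in
  \<open>T1\<close> and a multiple of \<open>T0\<close>. Inductions on the degree of a form rest on
  this step.\<close>

lemma bf_split:
  assumes "f \<in> binary_forms D (Suc n)" "0 \<in> D"
  obtains c g where "c \<in> D" "g \<in> binary_forms D n" "f = cst c * T1 ^ Suc n + T0 * g"
proof
  \<comment> \<open>Shifting the inner coefficients down by one divides by \<open>T0\<close> and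
    discards the terms without it.\<close>
  define g where "g = map_poly (poly_shift 1) f"
  have g: "coeff2 g i j = coeff2 f (Suc i) j" for i j
    by (simp add: g_def coeff2_def coeff_map_poly coeff_poly_shift)
  show "coeff2 f 0 (Suc n) \<in> D" using assms by (simp add: bf_iff)
  show "g \<in> binary_forms D n" using assms unfolding bf_iff g by (metis add_Suc nat.inject)
  have f0: "coeff2 f 0 j = 0" if "j \<noteq> Suc n" for j
    using assms(1) that unfolding bf_iff by force
  show "f = cst (coeff2 f 0 (Suc n)) * T1 ^ Suc n + T0 * g"
  proof (rule coeff2_eqI)
    fix i j
    show "coeff2 f i j = coeff2 (cst (coeff2 f 0 (Suc n)) * T1 ^ Suc n + T0 * g) i j"
      unfolding coeff2_simps coeff2_cst_T1 coeff2_T0_mult g by (simp add: f0)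
  qed
qed

text \<open>The component of degree n of any polynomial. Monomials are indexed by the exponent j of
  \<open>T1\<close>, so that \<open>n - j\<close> is never truncated.\<close>

definition hom_part :: "nat \<Rightarrow> 'a::comm_ring_1 poly poly \<Rightarrow> 'a poly poly" where
  "hom_part n f = (\<Sum>j\<le>n. monom (monom (coeff2 f (n - j) j) (n - j)) j)"

lemma coeff2_hom_part: "coeff2 (hom_part n f) i j = (if i + j = n then coeff2 f i j else 0)"
proof -
  have "coeff2 (hom_part n f) i j = (\<Sum>k\<le>n. if k = j then (if i = n - k then coeff2 f (n - k) k else 0) else 0)"
    unfolding hom_part_def coeff2_sum by (intro sum.cong) (auto simp: coeff2_def)
  also have "\<dots> = (if i + j = n then coeff2 f i j else 0)"
    by (auto simp: sum.delta)
  finally show ?thesis .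
qed

lemma hom_part_simps [simp]:
  "hom_part n 0 = 0" "hom_part n (f + g) = hom_part n f + hom_part n g" "hom_part n (f - g) = hom_part n f - hom_part n g"
  "hom_part n (- f) = - hom_part n f"
  by (rule coeff2_eqI; simp add: coeff2_hom_part)+

lemma hom_part_sum: "hom_part n (sum f I) = (\<Sum>k\<in>I. hom_part n (f k))"
  by (rule coeff2_eqI) (simp add: coeff2_hom_part coeff2_sum)

lemma hom_part_bf: "f \<in> binary_forms D k \<Longrightarrow> hom_part n f = (if n = k then f else 0)"
  by (rule coeff2_eqI) (auto simp: coeff2_hom_part bf_iff)

lemma hom_part_in_bf: "(\<And>i j. coeff2 f i j \<in> D) \<Longrightarrow> 0 \<in> D \<Longrightarrow> hom_part n f \<in> binary_forms D n"
  by (simp add: bf_iff coeff2_hom_part)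

lemma hom_part_decomp: "\<exists>N. (\<forall>n>N. hom_part n f = 0) \<and> (\<forall>M\<ge>N. f = (\<Sum>n\<le>M. hom_part n f))"
proof -
  define B where "B = degree f + Max ((\<lambda>j. degree (Polynomial.coeff f j)) ` {..degree f})"
  have B: "i + j \<le> B" if "coeff2 f i j \<noteq> 0" for i j
  proof -
    have "Polynomial.coeff f j \<noteq> 0" using that by (auto simp: coeff2_def)
    then have j: "j \<le> degree f" by (rule le_degree)
    have "i \<le> degree (Polynomial.coeff f j)" using that unfolding coeff2_def by (rule le_degree)
    also have "\<dots> \<le> Max ((\<lambda>j. degree (Polynomial.coeff f j)) ` {..degree f})" using j by (intro Max_ge) auto
    finally show ?thesis using j by (simp add: B_def)
  qed
  have "hom_part n f = 0" if "n > B" for n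
    using B that by (intro coeff2_eqI) (force simp: coeff2_hom_part)
  moreover have "f = (\<Sum>n\<le>M. hom_part n f)" if "M \<ge> B" for M
  proof (rule coeff2_eqI)
    fix i j
    have "(\<Sum>n\<le>M. coeff2 (hom_part n f) i j) = (if i + j \<le> M then coeff2 f i j else 0)"
      by (simp add: coeff2_hom_part sum.delta)
    moreover have "i + j \<le> M" if "coeff2 f i j \<noteq> 0"
      using B[OF that] \<open>M \<ge> B\<close> by simp
    ultimately show "coeff2 f i j = coeff2 (\<Sum>n\<le>M. hom_part n f) i j"
      by (auto simp: coeff2_sum)
  qed
  ultimately show ?thesis by blast
qed

lemma hom_part_mult: "hom_part n (f * g) = (\<Sum>k\<le>n. hom_part k f * hom_part (n - k) g)"
  for f g :: "'a::field poly poly"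
proof -
  obtain M where M: "f = (\<Sum>k\<le>M. hom_part k f)" "g = (\<Sum>k\<le>M. hom_part k g)"
    "\<forall>k>M. hom_part k f = 0" "\<forall>k>M. hom_part k g = 0"
  proof -
    obtain A B where "\<forall>n>A. hom_part n f = 0" "\<forall>M\<ge>A. f = (\<Sum>n\<le>M. hom_part n f)"
      "\<forall>n>B. hom_part n g = 0" "\<forall>M\<ge>B. g = (\<Sum>n\<le>M. hom_part n g)"
      using hom_part_decomp[of f] hom_part_decomp[of g] by blast
    then show ?thesis by (intro that[of "max A B"]) auto
  qed
  have U: "hom_part k f \<in> binary_forms UNIV k" for k and f :: "'a poly poly" by (simp add: hom_part_in_bf)
  have UU: "hom_part k f * hom_part l g \<in> binary_forms UNIV (k + l)" for k l
    by (intro bf_mult U) (simp add: is_subring_iff)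
  have "hom_part n (f * g) = (\<Sum>k\<le>M. \<Sum>l\<le>M. hom_part n (hom_part k f * hom_part l g))"
    by (subst M(1), subst M(2)) (simp only: sum_product hom_part_sum)
  \<comment> \<open>The condition k + l = n is split in two: subtraction is truncated, so
    \<open>l = n - k\<close> alone would also admit l = 0 with k > n.\<close>
  also have "\<dots> = (\<Sum>k\<le>M. \<Sum>l\<le>M. if l = n - k then (if k \<le> n then hom_part k f * hom_part l g else 0) else 0)"
    by (intro sum.cong refl) (auto simp: hom_part_bf[OF UU])
  also have "\<dots> = (\<Sum>k\<le>M. if k \<le> n then hom_part k f * hom_part (n - k) g else 0)"
    using M(4) by (intro sum.cong refl) (simp add: sum.delta)
  \<comment> \<open>Neither of M and n bounds the other; extending the range to M + n by zero terms
    allows cutting it back to n.\<close>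
  also have "\<dots> = (\<Sum>k\<le>M+n. if k \<le> n then hom_part k f * hom_part (n - k) g else 0)"
    using M(3) by (intro sum.mono_neutral_left) auto
  also have "\<dots> = (\<Sum>k\<le>n. hom_part k f * hom_part (n - k) g)"
    by (intro sum.mono_neutral_cong_right) auto
  finally show ?thesis .
qed

text \<open>Homogeneous components are unique, so the existence of a decomposition with terms in the
  given sets is a condition on each component. It serves both for the forms over D and for the forms
  in a prime, which makes the definition of \<open>proj_points\<close> workable.\<close>

lemma graded_sum_iff:
  assumes "\<And>n. p n \<subseteq> binary_forms UNIV n" "\<And>n. 0 \<in> p n"
  shows "f \<in> graded_sum p \<longleftrightarrow> (\<forall>n. hom_part n f \<in> p n)"
proof
  assume "f \<in> graded_sum p"
  then obtain g N where f: "f = (\<Sum>n\<le>N. g n)" and g: "\<forall>n. g n \<in> p n"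
    unfolding graded_sum_def by blast
  have "hom_part k (g n) = (if k = n then g n else 0)" for k n
    using g assms(1) by (intro hom_part_bf[of _ UNIV]) blast
  then have "hom_part k f = (if k \<le> N then g k else 0)" for k
    unfolding f hom_part_sum by (simp add: sum.delta)
  then show "\<forall>n. hom_part n f \<in> p n" using g assms(2) by simp
next
  assume "\<forall>n. hom_part n f \<in> p n"
  moreover obtain N where "f = (\<Sum>n\<le>N. hom_part n f)" using hom_part_decomp[of f] by blast
  ultimately show "f \<in> graded_sum p" unfolding graded_sum_def by blast
qed

abbreviation "forms_ring D \<equiv> graded_sum (binary_forms D)"

lemma bf_UNIV: "binary_forms D n \<subseteq> binary_forms UNIV n"
  by (rule bf_mono) simp

lemma S_iff:
  assumes "0 \<in> D"
  shows "f \<in> forms_ring D \<longleftrightarrow> (\<forall>i j. coeff2 f i j \<in> D)"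
proof -
  have "(\<forall>n. hom_part n f \<in> binary_forms D n) \<longleftrightarrow> (\<forall>i j. coeff2 f i j \<in> D)"
    unfolding bf_iff coeff2_hom_part using assms by auto
  then show ?thesis by (subst graded_sum_iff) (simp_all add: bf_UNIV bf_0 assms)
qed

lemma bf_S: "is_subring D \<Longrightarrow> f \<in> binary_forms D n \<Longrightarrow> f \<in> forms_ring D"
  by (simp add: S_iff is_subringD bf_iff)

lemma hom_part_S: "is_subring D \<Longrightarrow> f \<in> forms_ring D \<Longrightarrow> hom_part n f \<in> binary_forms D n"
  by (simp add: S_iff is_subringD hom_part_in_bf)

lemma subring_S:
  assumes "is_subring D" shows "is_subring (forms_ring D)"
proof -
  note D = is_subringD[OF assms] and S = S_iff[OF is_subringD(2)[OF assms]]
  show ?thesis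
    unfolding is_subring_iff S coeff2_mult coeff2_simps
    by (intro conjI ballI allI is_subring_sum assms D(6)) (auto simp: D(1-4) S)
qed

section \<open>Homogeneous ideals and points of the projective line\<close>

text \<open>Homogeneous ideals of the polynomial ring over D. Homogeneity is closure under
  components, which passes to unions of chains.\<close>

definition hideal :: "'a::field set \<Rightarrow> 'a poly poly set \<Rightarrow> bool" where
  "hideal D I \<longleftrightarrow> I \<subseteq> forms_ring D \<and> 0 \<in> I \<and> (\<forall>x\<in>I. \<forall>y\<in>I. x + y \<in> I) \<and>
     (\<forall>a\<in>forms_ring D. \<forall>x\<in>I. a * x \<in> I) \<and> (\<forall>x\<in>I. \<forall>n. hom_part n x \<in> I)"

lemma hidealD:
  assumes "hideal D I"
  shows "x \<in> I \<Longrightarrow> x \<in> forms_ring D" "0 \<in> I" "x \<in> I \<Longrightarrow> y \<in> I \<Longrightarrow> x + y \<in> I"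
    "a \<in> forms_ring D \<Longrightarrow> x \<in> I \<Longrightarrow> a * x \<in> I" "x \<in> I \<Longrightarrow> hom_part n x \<in> I"
  using assms by (auto simp: hideal_def)

lemma hideal_sum:
  assumes "hideal D I" "\<And>k. k \<in> A \<Longrightarrow> f k \<in> I"
  shows "sum f A \<in> I"
  using assms(2)
  by (induction A rule: infinite_finite_induct) (simp_all add: hidealD(2,3)[OF assms(1)])

lemma hideal_diff:
  assumes "is_subring D" "hideal D I" "x \<in> I" "y \<in> I"
  shows "x - y \<in> I"
proof -
  note S = is_subringD[OF subring_S[OF assms(1)]]
  have "x + (- 1) * y \<in> I" by (intro hidealD(3,4)[OF assms(2)] assms S(3) S(1))
  then show ?thesis by simp
qed

lemma hideal_hom_part:
  assumes "hideal D I" "\<And>n. hom_part n f \<in> I"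
  shows "f \<in> I"
proof -
  obtain N where "f = (\<Sum>n\<le>N. hom_part n f)" using hom_part_decomp[of f] by blast
  then show ?thesis using hideal_sum[OF assms(1), of "{..N}" "\<lambda>n. hom_part n f"] assms(2) by simp
qed

text \<open>For a homogeneous ideal primality need only be tested on forms: if f and g are outside
  M, the product of their components of least degree outside M is, modulo M, a component of f g. The
  variable outside M makes M proper and relevant.\<close>

lemma proj_pointI:
  assumes D: "is_subring D" and M: "hideal D M"
    and prime: "\<And>n k a b. a \<in> binary_forms D n \<Longrightarrow> b \<in> binary_forms D k \<Longrightarrow> a * b \<in> M \<Longrightarrow> a \<in> M \<or> b \<in> M"
    and X: "X \<in> {T0, T1}" "X \<notin> M"
  shows "M \<in> proj_points (binary_forms D)"
proof -
  have X1: "X \<in> binary_forms D 1" using X(1) bf_T0[OF D] bf_T1[OF D] by auto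
  have "1 \<notin> M"
  proof
    assume "1 \<in> M"
    then have "X * 1 \<in> M" using hidealD(4)[OF M bf_S[OF D X1]] by blast
    then show False using X(2) by simp
  qed
  moreover have "f \<in> M \<or> g \<in> M" if fg: "f \<in> forms_ring D" "g \<in> forms_ring D" "f * g \<in> M" for f g
  proof (rule ccontr)
    assume "\<not> (f \<in> M \<or> g \<in> M)"
    then have "\<exists>n. hom_part n f \<notin> M" "\<exists>n. hom_part n g \<notin> M" using hideal_hom_part[OF M] by blast+
    then have ex: "hom_part (LEAST n. hom_part n f \<notin> M) f \<notin> M" "hom_part (LEAST n. hom_part n g \<notin> M) g \<notin> M"
      using LeastI_ex[of "\<lambda>n. hom_part n f \<notin> M"] LeastI_ex[of "\<lambda>n. hom_part n g \<notin> M"] by auto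
    define n k where "n = (LEAST n. hom_part n f \<notin> M)" and "k = (LEAST n. hom_part n g \<notin> M)"
    have n: "hom_part n f \<notin> M" "\<And>i. i < n \<Longrightarrow> hom_part i f \<in> M"
      and k: "hom_part k g \<notin> M" "\<And>i. i < k \<Longrightarrow> hom_part i g \<in> M"
      using ex not_less_Least[of _ "\<lambda>n. hom_part n f \<notin> M"] not_less_Least[of _ "\<lambda>n. hom_part n g \<notin> M"]
      unfolding n_def k_def by blast+
    have "(\<Sum>i\<le>n+k. hom_part i f * hom_part (n + k - i) g) \<in> M"
      using hidealD(5)[OF M fg(3), of "n + k"] by (simp add: hom_part_mult)
    moreover have "(\<Sum>i\<in>{..n+k}-{n}. hom_part i f * hom_part (n + k - i) g) \<in> M"
    proof (rule hideal_sum[OF M])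
      fix i assume "i \<in> {..n + k} - {n}"
      then consider "i < n" | "n + k - i < k" by fastforce
      then show "hom_part i f * hom_part (n + k - i) g \<in> M"
      proof cases
        case 1
        then have "hom_part (n + k - i) g * hom_part i f \<in> M"
          by (intro hidealD(4)[OF M bf_S[OF D hom_part_S[OF D fg(2)]]] n(2))
        then show ?thesis by (simp add: mult.commute)
      next
        case 2
        then show ?thesis by (intro hidealD(4)[OF M bf_S[OF D hom_part_S[OF D fg(1)]]] k(2))
      qed
    qed
    ultimately have "(\<Sum>i\<le>n+k. hom_part i f * hom_part (n + k - i) g)
        - (\<Sum>i\<in>{..n+k}-{n}. hom_part i f * hom_part (n + k - i) g) \<in> M"
      by (rule hideal_diff[OF D M])
    then have "hom_part n f * hom_part k g \<in> M" by (simp add: sum_diff1)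
    then show False using prime[OF hom_part_S[OF D fg(1)] hom_part_S[OF D fg(2)]] n k by blast
  qed
  ultimately have "M \<in> primes (forms_ring D)"
    using M unfolding primes_iff[OF subring_S[OF D]] hideal_def by blast
  moreover have "M = graded_sum (\<lambda>n. binary_forms D n \<inter> M)"
  proof (rule Set.set_eqI)
    fix f
    have "f \<in> M \<longleftrightarrow> (\<forall>n. hom_part n f \<in> binary_forms D n \<inter> M)"
    proof
      assume "f \<in> M"
      then show "\<forall>n. hom_part n f \<in> binary_forms D n \<inter> M"
        using hidealD(5)[OF M] hom_part_S[OF D hidealD(1)[OF M]] by simp
    qed (use hideal_hom_part[OF M] in simp)
    moreover have "f \<in> graded_sum (\<lambda>n. binary_forms D n \<inter> M) \<longleftrightarrow> (\<forall>n. hom_part n f \<in> binary_forms D n \<inter> M)"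
      by (rule graded_sum_iff)
        (use bf_UNIV[of D] hidealD(2)[OF M] bf_0[OF is_subringD(2)[OF D]] in auto)
    ultimately show "f \<in> M \<longleftrightarrow> f \<in> graded_sum (\<lambda>n. binary_forms D n \<inter> M)" by simp
  qed
  moreover have "\<not> (\<Union>n\<in>{1..}. binary_forms D n) \<subseteq> M" using X1 X(2) by auto
  ultimately show ?thesis unfolding proj_points_def by blast
qed

text \<open>The last claim turns relevance, a condition on all forms of positive degree, into one on
  the two variables: by \<open>bf_split\<close> such forms lie in the ideal generated by
  \<open>T0\<close> and \<open>T1\<close>.\<close>

lemma proj_pointD:
  assumes D: "is_subring D" and P: "P \<in> proj_points (binary_forms D)"
  shows "hideal D P" "a \<in> forms_ring D \<Longrightarrow> b \<in> forms_ring D \<Longrightarrow> a * b \<in> P \<Longrightarrow> a \<in> P \<or> b \<in> P"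
    "1 \<notin> P" "T0 \<notin> P \<or> T1 \<notin> P"
proof -
  have P1: "P \<in> primes (forms_ring D)" and P2: "P = graded_sum (\<lambda>n. binary_forms D n \<inter> P)"
    and P3: "\<not> (\<Union>n\<in>{1..}. binary_forms D n) \<subseteq> P"
    using P unfolding proj_points_def by blast+
  note P1 = P1[unfolded primes_iff[OF subring_S[OF D]]]
  have "hom_part n f \<in> P" if "f \<in> P" for f n
  proof -
    have "f \<in> graded_sum (\<lambda>n. binary_forms D n \<inter> P)" using that P2 by simp
    then show ?thesis
      using bf_UNIV[of D] P1 bf_0[OF is_subringD(2)[OF D]] by (subst (asm) graded_sum_iff) auto
  qed
  then show h: "hideal D P" using P1 unfolding hideal_def by blast
  show "a \<in> forms_ring D \<Longrightarrow> b \<in> forms_ring D \<Longrightarrow> a * b \<in> P \<Longrightarrow> a \<in> P \<or> b \<in> P" "1 \<notin> P"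
    using P1 by blast+
  show "T0 \<notin> P \<or> T1 \<notin> P"
  proof (rule ccontr)
    assume "\<not> ?thesis"
    then have T: "T0 \<in> P" "T1 \<in> P" by auto
    have "f \<in> P" if fn: "f \<in> binary_forms D n" "n \<ge> 1" for f n
    proof -
      obtain k where n: "n = Suc k" using fn(2) by (cases n) auto
      obtain c g where f: "c \<in> D" "g \<in> binary_forms D k" "f = cst c * T1 ^ Suc k + T0 * g"
        using bf_split[OF fn(1)[unfolded n] is_subringD(2)[OF D]] by blast
      have "(cst c * T1 ^ k) * T1 \<in> P"
        using is_subringD(6,7)[OF subring_S[OF D]] bf_S[OF D bf_T1[OF D]] bf_S[OF D bf_cst] f(1)
          is_subringD(2)[OF D] T(2)
        by (intro hidealD(4)[OF h]) blast+
      moreover have "g * T0 \<in> P" using T(1) bf_S[OF D f(2)] by (intro hidealD(4)[OF h])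
      ultimately have "(cst c * T1 ^ k) * T1 + g * T0 \<in> P" by (rule hidealD(3)[OF h])
      moreover have "(cst c * T1 ^ k) * T1 + g * T0 = f" unfolding f(3) power_Suc by (simp only: mult_ac)
      ultimately show ?thesis by simp
    qed
    then show False using P3 by auto
  qed
qed

lemma proj_point_power:
  assumes D: "is_subring D" and P: "P \<in> proj_points (binary_forms D)" and f: "f \<in> forms_ring D" "f ^ n \<in> P"
  shows "f \<in> P"
  using f(2)
proof (induction n)
  case (Suc n)
  then show ?case
    using proj_pointD(2)[OF D P f(1), of "f ^ n"] is_subringD(7)[OF subring_S[OF D] f(1)] by auto
qed (use proj_pointD(3)[OF D P] in simp)

lemma proj_point_subsetI:
  assumes D: "is_subring D" and P: "hideal D P" and Q: "hideal D Q"
    and "\<And>n f. f \<in> binary_forms D n \<Longrightarrow> f \<in> Q \<Longrightarrow> f \<in> P"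
  shows "Q \<subseteq> P"
proof
  fix f assume "f \<in> Q"
  then have "hom_part n f \<in> P" for n
    using assms(4)[OF hom_part_S[OF D hidealD(1)[OF Q]]] hidealD(5)[OF Q] by blast
  then show "f \<in> P" by (rule hideal_hom_part[OF P])
qed

text \<open>A homogeneous ideal maximal among those without powers of X is prime: for forms a and b
  outside it, some powers of X are congruent to multiples of a and of b, and the product of these
  powers would lie in the ideal if a b did. Avoiding X also keeps it relevant.\<close>

lemma exists_proj_point:
  assumes D: "is_subring D" and H: "hideal D H" and X: "X \<in> {T0, T1}" "\<And>n. X ^ n \<notin> H"
  obtains P where "P \<in> proj_points (binary_forms D)" "H \<subseteq> P"
proof -
  define \<J> where "\<J> = {J. hideal D J \<and> H \<subseteq> J \<and> (\<forall>n. X ^ n \<notin> J)}"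
  note S = is_subringD[OF subring_S[OF D]]
  have "\<exists>M\<in>\<J>. \<forall>Y\<in>\<J>. M \<subseteq> Y \<longrightarrow> Y = M"
  proof (rule subset_Zorn_nonempty)
    show "\<J> \<noteq> {}" using H X(2) by (auto simp: \<J>_def)
    fix \<C> assume ne: "\<C> \<noteq> {}" and ch: "subset.chain \<J> \<C>"
    then have sub: "\<C> \<subseteq> \<J>" and lin: "\<And>X Y. X \<in> \<C> \<Longrightarrow> Y \<in> \<C> \<Longrightarrow> X \<subseteq> Y \<or> Y \<subseteq> X"
      by (auto simp: subset_chain_def)
    have add: "x + y \<in> \<Union>\<C>" if xy: "x \<in> \<Union>\<C>" "y \<in> \<Union>\<C>" for x y
    proof -
      obtain X Y where "X \<in> \<C>" "Y \<in> \<C>" "x \<in> X" "y \<in> Y" using xy by blast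
      then have "\<exists>Z\<in>\<C>. x \<in> Z \<and> y \<in> Z" using lin by blast
      then show ?thesis using sub unfolding \<J>_def hideal_def by blast
    qed
    have C: "hideal D Z" if "Z \<in> \<C>" for Z using that sub by (auto simp: \<J>_def)
    have "hideal D (\<Union>\<C>)" unfolding hideal_def
    proof (intro conjI ballI allI)
      show "\<Union>\<C> \<subseteq> forms_ring D" using hidealD(1)[OF C] by blast
      show "0 \<in> \<Union>\<C>" using ne hidealD(2)[OF C] by blast
      show "x + y \<in> \<Union>\<C>" if "x \<in> \<Union>\<C>" "y \<in> \<Union>\<C>" for x y by (rule add[OF that])
      show "a * x \<in> \<Union>\<C>" if "a \<in> forms_ring D" "x \<in> \<Union>\<C>" for a x
        using that hidealD(4)[OF C] by blast
      show "hom_part n x \<in> \<Union>\<C>" if "x \<in> \<Union>\<C>" for x n using that hidealD(5)[OF C] by blast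
    qed
    then show "\<Union>\<C> \<in> \<J>" using ne sub unfolding \<J>_def by blast
  qed
  then obtain M where "M \<in> \<J>" and max: "\<And>Y. Y \<in> \<J> \<Longrightarrow> M \<subseteq> Y \<Longrightarrow> Y = M" by blast
  then have M: "hideal D M" and HM: "H \<subseteq> M" and XM: "\<And>n. X ^ n \<notin> M" by (auto simp: \<J>_def)
  have pow: "\<exists>n. \<exists>x\<in>M. \<exists>r\<in>forms_ring D. X ^ n = x + r * a" if a: "a \<in> binary_forms D k" "a \<notin> M" for a k
  proof (rule ccontr)
    assume no: "\<not> ?thesis"
    define Y where "Y = {x + r * a | x r. x \<in> M \<and> r \<in> forms_ring D}"
    have aS: "a \<in> forms_ring D" using a bf_S[OF D] by blast
    have YI: "x + r * a \<in> Y" if "x \<in> M" "r \<in> forms_ring D" for x r using that by (auto simp: Y_def)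
    have "hideal D Y" unfolding hideal_def
    proof (intro conjI ballI allI)
      show "Y \<subseteq> forms_ring D" using S(4,6) aS hidealD(1)[OF M] by (auto simp: Y_def)
      show "0 \<in> Y" using YI[of 0 0] hidealD(2)[OF M] S(2) by simp
    next
      fix y z assume "y \<in> Y" "z \<in> Y"
      then obtain x r x' r' where "x \<in> M" "r \<in> forms_ring D" "x' \<in> M" "r' \<in> forms_ring D"
        "y = x + r * a" "z = x' + r' * a" by (auto simp: Y_def)
      then show "y + z \<in> Y" using YI[of "x + x'" "r + r'"] hidealD(3)[OF M] S(4) by (simp add: algebra_simps)
    next
      fix b y assume "y \<in> Y" "b \<in> forms_ring D"
      then obtain x r where "x \<in> M" "r \<in> forms_ring D" "y = x + r * a" by (auto simp: Y_def)
      then show "b * y \<in> Y" using YI[of "b * x" "b * r"] hidealD(4)[OF M] S(6) \<open>b \<in> forms_ring D\<close>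
        by (simp add: algebra_simps)
    next
      fix y n assume "y \<in> Y"
      then obtain x r where xr: "x \<in> M" "r \<in> forms_ring D" "y = x + r * a" by (auto simp: Y_def)
      \<comment> \<open>Multiplication by a shifts degrees by k. The cofactor is a sum with at most
        one nonzero term, because it has to vanish for n < k, where truncation would turn
        \<open>hom_part (n - k) r\<close> into \<open>hom_part 0 r\<close>.\<close>
      have "hom_part n (r * a) = (\<Sum>i\<le>n. if n - i = k then hom_part i r * a else 0)"
        unfolding hom_part_mult by (intro sum.cong refl) (simp add: hom_part_bf[OF a(1)])
      also have "\<dots> = (\<Sum>i\<le>n. if n - i = k then hom_part i r else 0) * a"
        unfolding sum_distrib_right by (intro sum.cong) auto
      finally have "hom_part n y = hom_part n x + (\<Sum>i\<le>n. if n - i = k then hom_part i r else 0) * a"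
        by (simp add: xr)
      moreover have "(\<Sum>i\<le>n. if n - i = k then hom_part i r else 0) \<in> forms_ring D"
        using xr(2) hom_part_S[OF D] bf_S[OF D] S(2) by (intro is_subring_sum[OF subring_S[OF D]]) auto
      ultimately show "hom_part n y \<in> Y" using YI hidealD(5)[OF M xr(1)] by simp
    qed
    moreover have "M \<subseteq> Y" using YI[of _ 0] S(2) by auto
    moreover have "X ^ n \<notin> Y" for n using no by (auto simp: Y_def)
    ultimately have "Y = M" using max[of Y] HM by (auto simp: \<J>_def)
    moreover have "a \<in> Y" using YI[of 0 1] hidealD(2)[OF M] S(1) by simp
    ultimately show False using a by simp
  qed
  have "M \<in> proj_points (binary_forms D)"
  proof (rule proj_pointI[OF D M _ X(1)])
    show "X \<notin> M" using XM[of 1] by simp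
    fix n k a b assume ab: "a \<in> binary_forms D n" "b \<in> binary_forms D k" "a * b \<in> M"
    show "a \<in> M \<or> b \<in> M"
    proof (rule ccontr)
      assume "\<not> ?thesis"
      then obtain i j x y r s where 1: "x \<in> M" "y \<in> M" "r \<in> forms_ring D" "s \<in> forms_ring D"
        "X ^ i = x + r * a" "X ^ j = y + s * b"
        using pow[OF ab(1)] pow[OF ab(2)] by blast
      have "X ^ (i + j) = y * x + ((s * b) * x + ((r * a) * y + (r * s) * (a * b)))"
        unfolding power_add 1 by (simp only: algebra_simps)
      also have "\<dots> \<in> M"
      proof -
        have aS: "a \<in> forms_ring D" "b \<in> forms_ring D" using ab bf_S[OF D] by auto
        have "y * x \<in> M" by (rule hidealD(4)[OF M hidealD(1)[OF M 1(2)] 1(1)])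
        moreover have "(s * b) * x \<in> M" by (rule hidealD(4)[OF M S(6)[OF 1(4) aS(2)] 1(1)])
        moreover have "(r * a) * y \<in> M" by (rule hidealD(4)[OF M S(6)[OF 1(3) aS(1)] 1(2)])
        moreover have "(r * s) * (a * b) \<in> M" by (rule hidealD(4)[OF M S(6)[OF 1(3,4)] ab(3)])
        ultimately show ?thesis by (simp only: hidealD(3)[OF M])
      qed
      finally show False using XM by blast
    qed
  qed
  then show thesis using HM that by blast
qed

text \<open>Elimination instead of determinants: in the relation for the last generator its own
  coefficient is 1 minus an element of M, a unit, so this generator can be expressed by the others
  with coefficients in M and substituted in their relations.\<close>

lemma nakayama:
  fixes v :: "nat \<Rightarrow> 'a::field poly poly"
  assumes D: "is_subring D" and M: "\<And>x y. x \<in> M \<Longrightarrow> y \<in> M \<Longrightarrow> x + y \<in> M" "\<And>a x. a \<in> D \<Longrightarrow> x \<in> M \<Longrightarrow> a * x \<in> M"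
    "M \<subseteq> D" "\<And>x. x \<in> M \<Longrightarrow> inverse (1 - x) \<in> D" "1 \<notin> M"
    and Q: "0 \<in> Q" "\<And>x y. x \<in> Q \<Longrightarrow> y \<in> Q \<Longrightarrow> x + y \<in> Q" "\<And>d x. d \<in> D \<Longrightarrow> x \<in> Q \<Longrightarrow> cst d * x \<in> Q"
    and v: "\<And>i. i < N \<Longrightarrow> \<exists>c. (\<forall>j<N. c j \<in> M) \<and> v i - (\<Sum>j<N. cst (c j) * v j) \<in> Q"
  shows "i < N \<Longrightarrow> v i \<in> Q"
  using v
proof (induction N arbitrary: i)
  case (Suc N)
  obtain c where c: "\<And>j. j < Suc N \<Longrightarrow> c j \<in> M" "v N - (\<Sum>j<Suc N. cst (c j) * v j) \<in> Q"
    using Suc.prems(2)[of N] by auto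
  define u where "u = inverse (1 - c N)"
  have "1 - c N \<noteq> 0" using c(1)[of N] M(5) by auto
  then have u: "u * (1 - c N) = 1" and uD: "u \<in> D" using M(4) c(1) by (auto simp: u_def)
  have "cst u * (v N - (\<Sum>j<Suc N. cst (c j) * v j)) \<in> Q" by (rule Q(3)[OF uD c(2)])
  also have "cst u * (v N - (\<Sum>j<Suc N. cst (c j) * v j)) =
      (cst u * (1 - cst (c N))) * v N - (\<Sum>j<N. cst u * (cst (c j) * v j))"
    unfolding sum.lessThan_Suc sum_distrib_left[symmetric] by (simp only: algebra_simps mult_1_left)
  also have "cst u * (1 - cst (c N)) = cst (u * (1 - c N))" by (simp add: one_pCons)
  also have "(\<Sum>j<N. cst u * (cst (c j) * v j)) = (\<Sum>j<N. cst (u * c j) * v j)"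
    by (intro sum.cong refl) (simp add: mult.commute)
  finally have vN: "v N - (\<Sum>j<N. cst (u * c j) * v j) \<in> Q" by (simp add: u flip: one_pCons)
  have IH: "v i \<in> Q" if "i < N" for i
  proof (rule Suc.IH[OF that])
    fix i assume "i < N"
    then obtain d where d: "\<And>j. j < Suc N \<Longrightarrow> d j \<in> M" "v i - (\<Sum>j<Suc N. cst (d j) * v j) \<in> Q"
      using Suc.prems(2)[of i] by auto
    \<comment> \<open>Substituting the expression for \<open>v N\<close> changes coefficient j to
      \<open>d j + d N * (u * c j)\<close>, which is again in M.\<close>
    have "v i - (\<Sum>j<Suc N. cst (d j) * v j) + cst (d N) * (v N - (\<Sum>j<N. cst (u * c j) * v j)) \<in> Q"
      using d M(3) by (intro Q(2) Q(3) d(2) vN) auto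
    also have "v i - (\<Sum>j<Suc N. cst (d j) * v j) + cst (d N) * (v N - (\<Sum>j<N. cst (u * c j) * v j)) =
       v i - (\<Sum>j<N. cst (d j) * v j + cst (d N) * (cst (u * c j) * v j))"
      unfolding sum.lessThan_Suc sum.distrib sum_distrib_left[symmetric] by (simp only: algebra_simps mult_1_left)
    also have "\<dots> = v i - (\<Sum>j<N. cst (d j + d N * (u * c j)) * v j)"
      by (intro arg_cong2[where f = minus] sum.cong refl) (simp add: mult_ac flip: smult_add_left)
    finally have "v i - (\<Sum>j<N. cst (d j + d N * (u * c j)) * v j) \<in> Q" .
    moreover have "d j + d N * (u * c j) \<in> M" if "j < N" for j
      using that c(1) d(1) M(3) uD by (intro M(1) M(2)) auto
    ultimately show "\<exists>c. (\<forall>j<N. c j \<in> M) \<and> v i - (\<Sum>j<N. cst (c j) * v j) \<in> Q"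
      by (intro exI[of _ "\<lambda>j. d j + d N * (u * c j)"]) simp
  qed
  have "(\<Sum>j\<in>{..<k}. cst (u * c j) * v j) \<in> Q" if "k \<le> N" for k
    using that
  proof (induction k)
    case (Suc k)
    have "u * c k \<in> D" using Suc.prems c(1)[of k] M(3) is_subringD(6)[OF D uD] by auto
    then show ?case unfolding sum.lessThan_Suc using Suc IH[of k] by (intro Q(2) Q(3)) auto
  qed (simp add: Q)
  from Q(2)[OF vN this[of N]] have "v N \<in> Q" by simp
  then show ?case using Suc.prems(1) IH by (cases "i = N") auto
qed simp

section \<open>Points of the projective line over a local ring\<close>

lemma bf_expand:
  assumes "f \<in> binary_forms I n"
  shows "f = (\<Sum>j\<le>n. cst (coeff2 f (n - j) j) * (T0 ^ (n - j) * T1 ^ j))"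
proof -
  have 1: "monom (monom c k) j = cst c * (T0 ^ k * T1 ^ j)" for c :: 'a and k j
  proof -
    have "T0 ^ k = [:[:0, 1:] ^ k :: 'a poly:]" by (induction k) (simp_all add: one_pCons)
    then show ?thesis by (simp add: monom_altdef smult_monom)
  qed
  have "f = hom_part n f" using hom_part_bf[OF assms, of n] by simp
  also have "\<dots> = (\<Sum>j\<le>n. cst (coeff2 f (n - j) j) * (T0 ^ (n - j) * T1 ^ j))"
    unfolding hom_part_def 1 ..
  finally show ?thesis .
qed

text \<open>A local ring D with maximal ideal M, described elementwise: a proper ideal such that all
  elements of D outside it are units.\<close>

locale local_subring =
  fixes D M :: "'a::field set"
  assumes D: "is_subring D"
    and M: "M \<subseteq> D" "0 \<in> M" "1 \<notin> M" "\<And>x y. x \<in> M \<Longrightarrow> y \<in> M \<Longrightarrow> x + y \<in> M"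
      "\<And>a x. a \<in> D \<Longrightarrow> x \<in> M \<Longrightarrow> a * x \<in> M" "\<And>x. x \<in> D \<Longrightarrow> x \<notin> M \<Longrightarrow> inverse x \<in> D"
begin

abbreviation "points \<equiv> proj_points (binary_forms D)"

lemmas DD = is_subringD[OF D]
lemmas SS = is_subringD[OF subring_S[OF D]]

lemma S_T0: "T0 \<in> forms_ring D" and S_T1: "T1 \<in> forms_ring D"
  and S_cst: "c \<in> D \<Longrightarrow> cst c \<in> forms_ring D"
  using bf_S[OF D] bf_T0[OF D] bf_T1[OF D] bf_cst[OF DD(2)] by blast+

lemma M_sum: "(\<And>i. i \<in> A \<Longrightarrow> h i \<in> M) \<Longrightarrow> sum h A \<in> M"
  by (induction A rule: infinite_finite_induct) (simp_all add: M)

lemma inverse_one_minus: "x \<in> M \<Longrightarrow> inverse (1 - x) \<in> D"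
proof -
  assume x: "x \<in> M"
  have "1 - x \<notin> M" using M(3) M(4)[OF _ x, of "1 - x"] by auto
  then show ?thesis using M(1) x by (intro M(6) DD) auto
qed

text \<open>The extension of M to the polynomial ring, which is the kernel of the reduction of
  coefficients to the residue field. The points containing it form the closed fibre.\<close>

definition MS :: "'a poly poly set" where
  "MS = {f. \<forall>i j. coeff2 f i j \<in> M}"

lemma hideal_MS: "hideal D MS"
  unfolding hideal_def
proof (intro conjI ballI allI)
  show "MS \<subseteq> forms_ring D" by (rule subsetI) (simp add: MS_def S_iff[OF DD(2)] subsetD[OF M(1)])
  show "a * x \<in> MS" if "a \<in> forms_ring D" "x \<in> MS" for a x
  proof -
    have "coeff2 (a * x) i j \<in> M" for i j
      using that unfolding coeff2_mult by (intro M_sum M(5)) (simp_all add: MS_def S_iff[OF DD(2)])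
    then show ?thesis by (simp add: MS_def)
  qed
qed (simp_all add: MS_def M(2,4) coeff2_hom_part)

lemma MS_form: "f \<in> binary_forms D n \<Longrightarrow> f \<in> MS \<longleftrightarrow> f \<in> binary_forms M n"
  by (auto simp: MS_def bf_iff)

lemma MS_subset:
  assumes P: "hideal D P" "\<And>a. a \<in> M \<Longrightarrow> cst a \<in> P"
  shows "MS \<subseteq> P"
proof (rule proj_point_subsetI[OF D P(1) hideal_MS])
  fix n f assume "f \<in> binary_forms D n" "f \<in> MS"
  then have "f \<in> binary_forms M n" by (simp add: MS_form)
  then show "f \<in> P"
  proof (induction n arbitrary: f)
    case 0
    then show ?case using bf_zero_deg P(2) by metis
  next
    case (Suc n)
    obtain c g where f: "c \<in> M" "g \<in> binary_forms M n" "f = cst c * T1 ^ Suc n + T0 * g"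
      using bf_split[OF Suc.prems M(2)] by blast
    have "T1 ^ Suc n * cst c \<in> P" by (rule hidealD(4)[OF P(1) SS(7)[OF S_T1] P(2)[OF f(1)]])
    moreover have "T0 * g \<in> P" by (rule hidealD(4)[OF P(1) S_T0 Suc.IH[OF f(2)]])
    ultimately have "T1 ^ Suc n * cst c + T0 * g \<in> P" by (rule hidealD(3)[OF P(1)])
    then show ?case unfolding f(3) by (simp only: mult.commute)
  qed
qed

lemma point_const:
  assumes P: "P \<in> points" and c: "c \<in> D" "cst c \<in> P"
  shows "c \<in> M"
proof (rule ccontr)
  assume "c \<notin> M"
  moreover from this have "c \<noteq> 0" using M(2) by auto
  ultimately have "cst (inverse c) * cst c \<in> P"
    by (intro hidealD(4)[OF proj_pointD(1)[OF D P]] S_cst M(6) c)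
  moreover have "cst (inverse c) * cst c = 1" using \<open>c \<noteq> 0\<close> by (simp add: one_pCons)
  ultimately show False using proj_pointD(3)[OF D P] by simp
qed

text \<open>If \<open>Q + MS\<close> contained all forms of some degree, then so would \<open>Q\<close> by Nakayama's lemma; otherwise
  it lies in a point.\<close>

lemma maximal_point_contains_M:
  assumes Q: "Q \<in> points" and max: "\<And>P. P \<in> points \<Longrightarrow> Q \<subseteq> P \<Longrightarrow> P = Q" and a: "a \<in> M"
  shows "cst a \<in> Q"
proof (rule ccontr)
  assume na: "cst a \<notin> Q"
  note hQ = proj_pointD(1)[OF D Q]
  define J where "J = {x + y | x y. x \<in> Q \<and> y \<in> MS}"
  have JI: "x + y \<in> J" if "x \<in> Q" "y \<in> MS" for x y using that by (auto simp: J_def)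
  have J: "hideal D J" unfolding hideal_def
  proof (intro conjI ballI allI)
    show "J \<subseteq> forms_ring D" using hidealD(1)[OF hQ] hidealD(1)[OF hideal_MS] SS(4) by (auto simp: J_def)
    show "0 \<in> J" using JI[of 0 0] hidealD(2)[OF hQ] hidealD(2)[OF hideal_MS] by simp
  next
    fix u v assume "u \<in> J" "v \<in> J"
    then obtain x y x' y' where "x \<in> Q" "y \<in> MS" "x' \<in> Q" "y' \<in> MS" "u = x + y" "v = x' + y'"
      by (auto simp: J_def)
    then show "u + v \<in> J" using JI[of "x + x'" "y + y'"] hidealD(3)[OF hQ] hidealD(3)[OF hideal_MS]
      by (simp add: algebra_simps)
  next
    fix b u assume "u \<in> J" "b \<in> forms_ring D"
    then obtain x y where "x \<in> Q" "y \<in> MS" "u = x + y" by (auto simp: J_def)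
    then show "b * u \<in> J" using JI[of "b * x" "b * y"] hidealD(4)[OF hQ] hidealD(4)[OF hideal_MS]
        \<open>b \<in> forms_ring D\<close> by (simp add: distrib_left)
  next
    fix u n assume "u \<in> J"
    then obtain x y where "x \<in> Q" "y \<in> MS" "u = x + y" by (auto simp: J_def)
    then show "hom_part n u \<in> J" using JI hidealD(5)[OF hQ] hidealD(5)[OF hideal_MS] by simp
  qed
  \<comment> \<open>Otherwise a point above J contains Q and so equals Q by maximality, although
    \<open>cst a\<close> lies in J and not in Q.\<close>
  have "\<exists>n. X ^ n \<in> J" if X: "X \<in> {T0, T1}" for X
  proof (rule ccontr)
    assume "\<not> ?thesis"
    then obtain P where P: "P \<in> points" "J \<subseteq> P" using exists_proj_point[OF D J X] by blast
    have "Q \<subseteq> J" using JI[of _ 0] hidealD(2)[OF hideal_MS] by auto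
    then have "P = Q" using max P by blast
    moreover have "cst a \<in> J" using JI[of 0 "cst a"] hidealD(2)[OF hQ] a M(2) by (simp add: MS_def)
    ultimately show False using P(2) na by blast
  qed
  then obtain p q where pq: "T0 ^ p \<in> J" "T1 ^ q \<in> J" by blast
  \<comment> \<open>In degree p + q every monomial is divisible by T0^p or by T1^q, so all of them
    lie in J.\<close>
  define N where "N = p + q"
  define v :: "nat \<Rightarrow> 'a poly poly" where "v j = T0 ^ (N - j) * T1 ^ j" for j
  have vD: "v j \<in> binary_forms D N" if "j \<le> N" for j
    unfolding v_def using bf_mult[OF D bf_power[OF D bf_T0[OF D], of "N - j"] bf_power[OF D bf_T1[OF D], of j]] that
    by simp
  have vJ: "v j \<in> J" if "j \<le> N" for j
  proof (cases "q \<le> j")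
    case True
    have "(T0 ^ (N - j) * T1 ^ (j - q)) * T1 ^ q \<in> J"
      by (intro hidealD(4)[OF J _ pq(2)] SS(6) SS(7) S_T0 S_T1)
    moreover have "(T0 ^ (N - j) * T1 ^ (j - q)) * T1 ^ q = v j"
      unfolding v_def mult.assoc power_add[symmetric] using True by simp
    ultimately show ?thesis by simp
  next
    case False
    have "(T0 ^ (N - j - p) * T1 ^ j) * T0 ^ p \<in> J"
      by (intro hidealD(4)[OF J _ pq(1)] SS(6) SS(7) S_T0 S_T1)
    moreover have "(T0 ^ (N - j - p) * T1 ^ j) * T0 ^ p = T0 ^ (N - j - p + p) * T1 ^ j"
      unfolding power_add by (simp only: mult_ac)
    moreover have "N - j - p + p = N - j" using False that by (simp add: N_def)
    ultimately show ?thesis by (metis v_def)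
  qed
  have "v i \<in> Q" if i: "i < Suc N" for i
  proof (rule nakayama[OF D M(4) M(5) M(1) inverse_one_minus M(3)])
    show "0 \<in> Q" by (rule hidealD(2)[OF hQ])
    show "x + y \<in> Q" if "x \<in> Q" "y \<in> Q" for x y using that by (rule hidealD(3)[OF hQ])
    show "cst d * x \<in> Q" if "d \<in> D" "x \<in> Q" for d x using that by (intro hidealD(4)[OF hQ] S_cst)
    show "i < Suc N" by (rule i)
    fix i assume "i < Suc N"
    then have i: "i \<le> N" by simp
    obtain x y where xy: "x \<in> Q" "y \<in> MS" "v i = x + y" using vJ[OF i] by (auto simp: J_def)
    have "v i = hom_part N (v i)" using hom_part_bf[OF vD[OF i], of N] by simp
    then have eq: "v i = hom_part N x + hom_part N y" by (simp add: xy(3))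
    have yM: "hom_part N y \<in> binary_forms M N" using xy(2) M(2) by (intro hom_part_in_bf) (auto simp: MS_def)
    define c where "c j = coeff2 (hom_part N y) (N - j) j" for j
    have "c j \<in> M" for j using yM by (simp add: bf_iff c_def)
    moreover have "hom_part N y = (\<Sum>j<Suc N. cst (c j) * v j)"
      unfolding c_def v_def lessThan_Suc_atMost by (rule bf_expand[OF yM])
    then have "v i - (\<Sum>j<Suc N. cst (c j) * v j) = hom_part N x" using eq by (metis add_diff_cancel_right')
    ultimately show "\<exists>c. (\<forall>j<Suc N. c j \<in> M) \<and> v i - (\<Sum>j<Suc N. cst (c j) * v j) \<in> Q"
      using hidealD(5)[OF hQ xy(1)] by (intro exI[of _ c]) auto
  qed
  from this[of 0] this[of N] have "T0 ^ N \<in> Q" "T1 ^ N \<in> Q" by (auto simp: v_def)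
  then show False using proj_point_power[OF D Q] S_T0 S_T1 proj_pointD(4)[OF D Q] by blast
qed

text \<open>Over the residue field the ideal of a closed point is generated by one form, and f lifts
  such a generator. Division by f needs a unit as coefficient of a pure power of \<open>T1\<close>;
  this excludes f = \<open>T0\<close>, hence the separate case.\<close>

lemma maximal_point_generator:
  assumes Q: "Q \<in> points" and max: "\<And>P. P \<in> points \<Longrightarrow> Q \<subseteq> P \<Longrightarrow> P = Q"
  obtains d f where "d \<ge> 1" "f \<in> binary_forms D d" "f \<in> Q"
    "\<And>P. P \<in> points \<Longrightarrow> (\<And>a. a \<in> M \<Longrightarrow> cst a \<in> P) \<Longrightarrow> f \<in> P \<Longrightarrow> Q \<subseteq> P"
proof (cases "T0 \<in> Q")
  case True
  note hQ = proj_pointD(1)[OF D Q]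
  have "Q \<subseteq> P" if P: "P \<in> points" "\<And>a. a \<in> M \<Longrightarrow> cst a \<in> P" "T0 \<in> P" for P
  proof -
    note hP = proj_pointD(1)[OF D P(1)]
    show ?thesis
    proof (rule proj_point_subsetI[OF D hP hQ])
      fix n g assume g: "g \<in> binary_forms D n" "g \<in> Q"
      show "g \<in> P"
      proof (cases n)
        case 0
        then show ?thesis using g bf_zero_deg[of g D] point_const[OF Q] P(2) by metis
      next
        case (Suc k)
        obtain c h where h: "c \<in> D" "h \<in> binary_forms D k" "g = cst c * T1 ^ Suc k + T0 * h"
          using bf_split[OF g(1)[unfolded Suc] DD(2)] by blast
        have "h * T0 \<in> Q" by (rule hidealD(4)[OF hQ bf_S[OF D h(2)] True])
        then have "g - h * T0 \<in> Q" by (rule hideal_diff[OF D hQ g(2)])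
        also have "g - h * T0 = cst c * T1 ^ Suc k" unfolding h(3) by (simp only: algebra_simps)
        finally have "cst c \<in> Q \<or> T1 ^ Suc k \<in> Q"
          by (rule proj_pointD(2)[OF D Q S_cst[OF h(1)] SS(7)[OF S_T1]])
        \<comment> \<open>A point does not contain both variables, so it is the constant c that lies
          in Q.\<close>
        moreover have "T1 ^ Suc k \<notin> Q"
          using proj_point_power[OF D Q S_T1] True proj_pointD(4)[OF D Q] by blast
        ultimately have "c \<in> M" using point_const[OF Q h(1)] by blast
        then have "T1 ^ Suc k * cst c \<in> P" by (intro hidealD(4)[OF hP SS(7)[OF S_T1]] P(2))
        moreover have "h * T0 \<in> P" by (rule hidealD(4)[OF hP bf_S[OF D h(2)] P(3)])
        ultimately have "T1 ^ Suc k * cst c + h * T0 \<in> P" by (rule hidealD(3)[OF hP])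
        then show ?thesis unfolding h(3) by (simp only: mult.commute)
      qed
    qed
  qed
  then show thesis using that[of 1 T0] bf_T0[OF D] True by auto
next
  case False
  note hQ = proj_pointD(1)[OF D Q]
  have cQ: "cst a \<in> Q" if "a \<in> M" for a using maximal_point_contains_M[OF Q max that] by blast
  have MSQ: "MS \<subseteq> Q" by (rule MS_subset[OF hQ cQ])
  have "\<not> Q \<subseteq> MS"
  proof
    assume QMS: "Q \<subseteq> MS"
    \<comment> \<open>The ideal generated by M and \<open>T0\<close>. If Q were inside
      \<open>MS\<close>, some point would contain J and hence properly contain Q, as
      \<open>T0\<close> is in J but not in Q.\<close>
    define J where "J = {f \<in> forms_ring D. \<forall>j. coeff2 f 0 j \<in> M}"
    have J: "hideal D J" unfolding hideal_def
    proof (intro conjI ballI allI)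
      show "a * x \<in> J" if "a \<in> forms_ring D" "x \<in> J" for a x
      proof -
        have "coeff2 (a * x) 0 j \<in> M" for j
          using that unfolding coeff2_mult by (intro M_sum M(5)) (simp_all add: J_def S_iff[OF DD(2)])
        then show ?thesis using that SS(6) by (simp add: J_def)
      qed
      show "hom_part n x \<in> J" if "x \<in> J" for x n
        using that bf_S[OF D hom_part_S[OF D]] by (auto simp: J_def coeff2_hom_part M(2))
    qed (auto simp: J_def SS(2,4) M(2,4))
    have "T1 ^ n \<notin> J" for n
    proof
      assume "T1 ^ n \<in> J"
      then have "coeff2 (cst 1 * T1 ^ n) 0 n \<in> M" by (simp add: J_def flip: one_pCons)
      then show False using M(3) by (simp only: coeff2_cst_T1) simp
    qed
    then obtain P where P: "P \<in> points" "J \<subseteq> P" using exists_proj_point[OF D J, of T1] by blast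
    have "Q \<subseteq> J" using QMS hidealD(1)[OF hideal_MS] by (auto simp: J_def MS_def)
    then have "P = Q" using max P by blast
    moreover have "T0 \<in> J" using S_T0 M(2) by (simp add: J_def)
    ultimately show False using P(2) False by blast
  qed
  then have "\<exists>n. \<exists>f. f \<in> binary_forms D n \<and> f \<in> Q \<and> f \<notin> MS"
    using proj_point_subsetI[OF D hideal_MS hQ] by blast
  then obtain d where "\<exists>f. f \<in> binary_forms D d \<and> f \<in> Q \<and> f \<notin> MS"
    and least: "\<And>n. n < d \<Longrightarrow> \<not> (\<exists>f. f \<in> binary_forms D n \<and> f \<in> Q \<and> f \<notin> MS)"
    using exists_least_iff[of "\<lambda>n. \<exists>f. f \<in> binary_forms D n \<and> f \<in> Q \<and> f \<notin> MS"] by auto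
  then obtain f where f: "f \<in> binary_forms D d" "f \<in> Q" "f \<notin> MS" by blast
  have "d \<noteq> 0"
  proof
    assume "d = 0"
    then obtain c where "c \<in> D" "f = cst c" using f(1) bf_zero_deg by metis
    then show False using f point_const[OF Q] M(2) by (auto simp: MS_def split: if_splits)
  qed
  then obtain e where d: "d = Suc e" by (cases d) auto
  obtain c f' where c: "c \<in> D" "f' \<in> binary_forms D e" "f = cst c * T1 ^ d + T0 * f'"
    using bf_split[OF f(1)[unfolded d] DD(2)] d by blast
  \<comment> \<open>Otherwise \<open>f'\<close>, of smaller degree, would lie in Q after cancelling
    \<open>T0\<close>, hence in \<open>MS\<close> by minimality of d, and f with it.\<close>
  have "c \<notin> M"
  proof
    assume cM: "c \<in> M"
    have T1c: "T1 ^ d * cst c \<in> I" if "hideal D I" "cst c \<in> I" for I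
      by (rule hidealD(4)[OF that(1) SS(7)[OF S_T1] that(2)])
    have "f - T1 ^ d * cst c \<in> Q" by (rule hideal_diff[OF D hQ f(2) T1c[OF hQ cQ[OF cM]]])
    also have "f - T1 ^ d * cst c = T0 * f'" unfolding c(3) by (simp only: algebra_simps)
    finally have "f' \<in> Q" using proj_pointD(2)[OF D Q S_T0 bf_S[OF D c(2)]] False by blast
    then have "f' \<in> MS" using least[of e] c(2) d by auto
    have "cst c \<in> MS" using cM M(2) by (simp add: MS_def)
    have "T1 ^ d * cst c + T0 * f' \<in> MS"
      by (intro hidealD(3)[OF hideal_MS] hidealD(4)[OF hideal_MS S_T0] T1c hideal_MS) fact+
    then show False using f(3) unfolding c(3) by (simp only: mult.commute) simp
  qed
  then have ic: "inverse c \<in> D" "c \<noteq> 0" using M(6) c(1) M(2) by auto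
  have "Q \<subseteq> P" if P: "P \<in> points" "\<And>a. a \<in> M \<Longrightarrow> cst a \<in> P" "f \<in> P" for P
  proof -
    note hP = proj_pointD(1)[OF D P(1)]
    have MSP: "MS \<subseteq> P" by (rule MS_subset[OF hP P(2)])
    show ?thesis
    proof (rule proj_point_subsetI[OF D hP hQ])
      fix n g assume "g \<in> binary_forms D n" "g \<in> Q"
      then show "g \<in> P"
      proof (induction n arbitrary: g)
        case 0
        then show ?case using least[of 0] d MSP by auto
      next
        case (Suc n)
        show ?case
        proof (cases "Suc n < d")
          case True
          then show ?thesis using least[of "Suc n"] Suc.prems MSP by auto
        next
          case False
          define k where "k = Suc n - d"
          have k: "Suc n = k + d" and n: "n = k + e" using False d by (auto simp: k_def)
          obtain b g' where g: "b \<in> D" "g' \<in> binary_forms D n" "g = cst b * T1 ^ Suc n + T0 * g'"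
            using bf_split[OF Suc.prems(1) DD(2)] by blast
          \<comment> \<open>Division step: r f has the same pure power of \<open>T1\<close> as g, so
            the difference is divisible by \<open>T0\<close>. As Q is prime and does not contain
            \<open>T0\<close>, the quotient is again in Q, and its degree is lower.\<close>
          define r where "r = cst (b * inverse c) * T1 ^ k"
          have r: "r \<in> binary_forms D k"
            using bf_mult[OF D bf_cst[OF DD(2) DD(6)[OF g(1) ic(1)]] bf_power[OF D bf_T1[OF D], of k]]
            unfolding r_def by simp
          have "cst (b * inverse c) * cst c = cst b" using ic(2) by simp
          then have "r * f = cst b * T1 ^ Suc n + T0 * (r * f')"
            unfolding c(3) r_def k power_add by (simp only: algebra_simps flip: \<open>cst (b * inverse c) * cst c = cst b\<close>)
          then have eq: "g - r * f = T0 * (g' - r * f')" unfolding g(3) by (simp only: algebra_simps)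
          have rf': "r * f' \<in> binary_forms D n" unfolding n by (rule bf_mult[OF D r c(2)])
          have "g - r * f \<in> Q"
            by (intro hideal_diff[OF D hQ Suc.prems(2)] hidealD(4)[OF hQ bf_S[OF D r]] f(2))
          then have "g' - r * f' \<in> Q"
            unfolding eq using proj_pointD(2)[OF D Q S_T0 bf_S[OF D bf_diff[OF D g(2) rf']]]
              \<open>T0 \<notin> Q\<close> by blast
          then have "g' - r * f' \<in> P" by (rule Suc.IH[OF bf_diff[OF D g(2) rf']])
          then have "T0 * (g' - r * f') \<in> P" by (rule hidealD(4)[OF hP S_T0])
          then have "r * f + (g - r * f) \<in> P"
            unfolding eq by (intro hidealD(3)[OF hP] hidealD(4)[OF hP bf_S[OF D r]] P(3))
          then show ?thesis by simp
        qed
      qed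
    qed
  qed
  then show thesis using that[of d f] \<open>d \<noteq> 0\<close> f by auto
qed

end

section \<open>Closed points and prime avoidance\<close>

context local_subring
begin

lemma linear_form_avoiding:
  assumes P: "P \<in> points"
  obtains X where "X \<in> binary_forms D 1" "X \<notin> P"
  using proj_pointD(4)[OF D P] bf_T0[OF D] bf_T1[OF D] by blast

text \<open>Each Q contributes a factor from Q outside P; the product stays outside the prime
  P.\<close>

lemma product_avoiding:
  assumes P: "P \<in> points" and fin: "finite \<Q>" and pts: "\<Q> \<subseteq> points"
    and nsub: "\<And>Q. Q \<in> \<Q> \<Longrightarrow> \<not> Q \<subseteq> P"
  shows "\<exists>n. \<exists>g\<in>binary_forms D n. g \<notin> P \<and> (\<forall>Q\<in>\<Q>. g \<in> Q)"
  using fin pts nsub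
proof (induction \<Q>)
  case empty
  show ?case using bf_1[OF D] proj_pointD(3)[OF D P] by blast
next
  case (insert Q \<Q>)
  note hP = proj_pointD(1)[OF D P]
  have "\<exists>n. \<exists>g\<in>binary_forms D n. g \<notin> P \<and> (\<forall>Q\<in>\<Q>. g \<in> Q)"
    using insert.prems by (intro insert.IH) auto
  then obtain n g where g: "g \<in> binary_forms D n" "g \<notin> P" "\<And>R. R \<in> \<Q> \<Longrightarrow> g \<in> R" by blast
  have Q: "Q \<in> points" "\<not> Q \<subseteq> P" using insert.prems by auto
  then obtain k h where h: "h \<in> binary_forms D k" "h \<in> Q" "h \<notin> P"
    using proj_point_subsetI[OF D hP proj_pointD(1)[OF D Q(1)]] by blast
  have "g * h \<in> binary_forms D (n + k)" by (rule bf_mult[OF D g(1) h(1)])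
  moreover have "g * h \<notin> P" using proj_pointD(2)[OF D P bf_S[OF D g(1)] bf_S[OF D h(1)]] g h by blast
  moreover have "g * h \<in> Q" by (rule hidealD(4)[OF proj_pointD(1)[OF D Q(1)] bf_S[OF D g(1)] h(2)])
  moreover have "g * h \<in> R" if "R \<in> \<Q>" for R
  proof -
    have "R \<in> points" using insert.prems that by auto
    then have "h * g \<in> R" by (rule hidealD(4)[OF proj_pointD(1)[OF D] bf_S[OF D h(1)] g(3)[OF that]])
    then show ?thesis by (simp add: mult.commute)
  qed
  ultimately show ?case by (intro exI[of _ "n + k"] bexI[of _ "g * h"]) auto
qed

lemma MS_power_diff:
  assumes "x \<in> forms_ring D" "y \<in> forms_ring D" "x - y \<in> MS"
  shows "x ^ n - y ^ n \<in> MS"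
proof (induction n)
  case (Suc n)
  have "x * (x ^ n - y ^ n) + y ^ n * (x - y) \<in> MS"
    by (intro hidealD(3)[OF hideal_MS] hidealD(4)[OF hideal_MS] assms SS(7) Suc)
  then show ?case by (simp add: algebra_simps)
qed (simp add: hidealD(2)[OF hideal_MS])

text \<open>Homogeneous prime avoidance inside a class modulo \<open>MS\<close>. If the form found
  for the other points lies in P, it is corrected by an element of M outside P times a form that
  lies in all the other points but not in P.\<close>

lemma avoidance:
  assumes f: "f \<in> binary_forms D d" "d \<ge> 1"
    and "finite \<P>" "\<P> \<subseteq> points" "\<And>P. P \<in> \<P> \<Longrightarrow> \<exists>a\<in>M. cst a \<notin> P"
  shows "\<exists>k\<ge>1. \<exists>e. \<exists>h\<in>binary_forms D k. h - f ^ e \<in> MS \<and> (\<forall>P\<in>\<P>. h \<notin> P)"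
  using assms(3-5)
proof (induction "card \<P>" arbitrary: \<P>)
  case 0
  then show ?case using f by (intro exI[of _ d] conjI exI[of _ 1] bexI[of _ f])
      (auto simp: hidealD(2)[OF hideal_MS])
next
  case (Suc n)
  then have "\<P> \<noteq> {}" by auto
  \<comment> \<open>Minimality of P ensures that no other point of the set is contained in P, as
    \<open>product_avoiding\<close> requires.\<close>
  then obtain P where P: "P \<in> \<P>" "\<And>Q. Q \<in> \<P> \<Longrightarrow> Q \<subseteq> P \<Longrightarrow> P = Q"
    using finite_has_minimal[OF Suc.prems(1)] by blast
  let ?\<Q> = "\<P> - {P}"
  have Pp: "P \<in> points" using P Suc.prems(2) by auto
  note hP = proj_pointD(1)[OF D Pp]
  have "n = card ?\<Q>" using Suc.hyps(2) P(1) Suc.prems(1) by simp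
  then have "\<exists>k\<ge>1. \<exists>e. \<exists>h\<in>binary_forms D k. h - f ^ e \<in> MS \<and> (\<forall>P\<in>?\<Q>. h \<notin> P)"
    using Suc.prems by (intro Suc.hyps(1)) auto
  then obtain k e h where k: "k \<ge> 1"
    and h: "h \<in> binary_forms D k" "h - f ^ e \<in> MS" "\<And>Q. Q \<in> ?\<Q> \<Longrightarrow> h \<notin> Q"
    by blast
  show ?case
  proof (cases "h \<in> P")
    case False
    then show ?thesis using k h by blast
  next
    case True
    obtain \<delta> g where g: "g \<in> binary_forms D \<delta>" "g \<notin> P" "\<And>Q. Q \<in> ?\<Q> \<Longrightarrow> g \<in> Q"
      using product_avoiding[OF Pp, of ?\<Q>] Suc.prems(1,2) P(2) by blast
    obtain a where a: "a \<in> M" "cst a \<notin> P" using Suc.prems(3)[OF P(1)] by blast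
    obtain X where X: "X \<in> binary_forms D 1" "X \<notin> P" by (rule linear_form_avoiding[OF Pp])
    \<comment> \<open>With this exponent \<open>h ^ b\<close> has degree at least that of g, and
      powers of a linear form outside P fill up the difference. Since b >= 1, the power stays in
      P.\<close>
    define b where "b = Suc \<delta>"
    define r where "r = g * X ^ (k * b - \<delta>)"
    have "\<delta> \<le> k * b" using k unfolding b_def by (metis mult_le_mono1 mult_1 Suc_leD)
    then have r: "r \<in> binary_forms D (k * b)"
      using bf_mult[OF D g(1) bf_power[OF D X(1), of "k * b - \<delta>"]] by (simp add: r_def)
    have rP: "r \<notin> P"
      unfolding r_def using proj_pointD(2)[OF D Pp bf_S[OF D g(1)] SS(7)[OF bf_S[OF D X(1)]]] g(2)
        proj_point_power[OF D Pp bf_S[OF D X(1)]] X(2) by blast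
    have aD: "a \<in> D" using a(1) M(1) by blast
    have arD: "cst a * r \<in> binary_forms D (k * b)"
      using bf_mult[OF D bf_cst[OF DD(2) aD] r] by simp
    have arP: "cst a * r \<notin> P" using proj_pointD(2)[OF D Pp S_cst[OF aD] bf_S[OF D r]] a(2) rP by blast
    have "r * cst a \<in> MS"
      by (intro hidealD(4)[OF hideal_MS bf_S[OF D r]]) (simp add: MS_def a M(2))
    then have arM: "cst a * r \<in> MS" by (simp only: mult.commute)
    have hb: "h ^ b \<in> binary_forms D (k * b)" by (rule bf_power[OF D h(1)])
    have "h ^ b - (f ^ e) ^ b \<in> MS"
      by (rule MS_power_diff[OF bf_S[OF D h(1)] SS(7)[OF bf_S[OF D f(1)]] h(2)])
    then have "(h ^ b - (f ^ e) ^ b) + cst a * r \<in> MS" by (rule hidealD(3)[OF hideal_MS _ arM])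
    then have "(h ^ b + cst a * r) - (f ^ e) ^ b \<in> MS" by (simp only: algebra_simps)
    then have "(h ^ b + cst a * r) - f ^ (e * b) \<in> MS" by (simp only: power_mult)
    moreover have "h ^ b + cst a * r \<in> binary_forms D (k * b)"
      by (rule bf_add[OF DD(4) hb arD])
    moreover have "h ^ b + cst a * r \<notin> P"
    proof
      assume in_P: "h ^ b + cst a * r \<in> P"
      have "h ^ \<delta> * h \<in> P" by (rule hidealD(4)[OF hP SS(7)[OF bf_S[OF D h(1)]] True])
      then have "h ^ b \<in> P" by (simp only: b_def power_Suc2)
      from hideal_diff[OF D hP in_P this] arP show False by simp
    qed
    moreover have "h ^ b + cst a * r \<notin> Q" if Q: "Q \<in> ?\<Q>" for Q
    proof
      assume in_Q: "h ^ b + cst a * r \<in> Q"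
      have Qp: "Q \<in> points" using Q Suc.prems(2) by auto
      note hQ = proj_pointD(1)[OF D Qp]
      have "(cst a * X ^ (k * b - \<delta>)) * g \<in> Q"
        by (intro hidealD(4)[OF hQ] SS(6) SS(7) S_cst[OF aD] bf_S[OF D X(1)] g(3)[OF Q])
      moreover have "(cst a * X ^ (k * b - \<delta>)) * g = cst a * r" unfolding r_def by (simp only: mult_ac)
      ultimately have "cst a * r \<in> Q" by (simp only:)
      from hideal_diff[OF D hQ in_Q this] have "h ^ b \<in> Q" by simp
      then show False using proj_point_power[OF D Qp bf_S[OF D h(1)]] h(3)[OF Q] by blast
    qed
    moreover have "k * b \<ge> 1" using k by (simp add: b_def)
    ultimately show ?thesis by (intro exI[of _ "k * b"] conjI exI[of _ "e * b"] bexI[of _ "h ^ b + cst a * r"]) auto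
  qed
qed

text \<open>At a point over M the form h is congruent to a power of f, so if h vanished there, f
  would too, and the point would contain Q and be equal to it. The remaining points are finitely
  many and fall under \<open>avoidance\<close>.\<close>

lemma form_avoiding_points:
  assumes Q: "Q \<in> points" and max: "\<And>P. P \<in> points \<Longrightarrow> Q \<subseteq> P \<Longrightarrow> P = Q"
    and \<P>: "\<P> \<subseteq> points" "Q \<notin> \<P>" "finite {P \<in> \<P>. \<exists>a\<in>M. cst a \<notin> P}"
  shows "\<exists>k\<ge>1. \<exists>h\<in>binary_forms D k. \<forall>P\<in>\<P>. h \<notin> P"
proof -
  obtain d f where f: "d \<ge> 1" "f \<in> binary_forms D d" "f \<in> Q"
    "\<And>P. P \<in> points \<Longrightarrow> (\<And>a. a \<in> M \<Longrightarrow> cst a \<in> P) \<Longrightarrow> f \<in> P \<Longrightarrow> Q \<subseteq> P"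
    using maximal_point_generator[OF Q max] by blast
  have "\<exists>k\<ge>1. \<exists>e. \<exists>h\<in>binary_forms D k. h - f ^ e \<in> MS \<and> (\<forall>P\<in>{P \<in> \<P>. \<exists>a\<in>M. cst a \<notin> P}. h \<notin> P)"
    using \<P> by (intro avoidance[OF f(2,1)]) auto
  then obtain k e h where h: "k \<ge> 1" "h \<in> binary_forms D k" "h - f ^ e \<in> MS"
    "\<forall>P\<in>{P \<in> \<P>. \<exists>a\<in>M. cst a \<notin> P}. h \<notin> P" by (elim exE bexE conjE)
  have "h \<notin> P" if P: "P \<in> \<P>" for P
  proof (cases "\<exists>a\<in>M. cst a \<notin> P")
    case False
    have Pp: "P \<in> points" using P \<P>(1) by blast
    note hP = proj_pointD(1)[OF D Pp]
    have "MS \<subseteq> P" by (rule MS_subset[OF hP]) (use False in blast)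
    then have "h - f ^ e \<in> P" using h(3) by (rule subsetD)
    show ?thesis
    proof
      assume "h \<in> P"
      from hideal_diff[OF D hP this \<open>h - f ^ e \<in> P\<close>] have "f ^ e \<in> P" by simp
      then have "f \<in> P" by (rule proj_point_power[OF D Pp bf_S[OF D f(2)]])
      then have "Q \<subseteq> P" using False by (intro f(4)[OF Pp]) auto
      then have "P = Q" by (rule max[OF Pp])
      then show False using P \<P>(2) by blast
    qed
  qed (use h(4) P in simp)
  then show ?thesis using h(1,2) by blast
qed

end

section \<open>Open sets of Spec and Proj\<close>

lemma topspace_spec:
  assumes "is_subring A"
  shows "topspace (spec_topology A) = primes A"
proof -
  have "1 \<notin> P" if "P \<in> primes A" for P using that by (simp add: primes_iff[OF assms])
  then have "{P \<in> primes A. 1 \<notin> P} = primes A" by blast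
  then have "primes A \<subseteq> \<Union>{{P \<in> primes A. f \<notin> P} |f. f \<in> A}"
    using is_subringD(1)[OF assms] by blast
  then show ?thesis unfolding spec_topology_def topology_generated_by_topspace by blast
qed

lemma topspace_proj_line: "is_subring D \<Longrightarrow> topspace (proj_topology (binary_forms D)) = proj_points (binary_forms D)"
  by (auto simp: proj_topology_def topspace_spec subring_S proj_points_def)

text \<open>A basic open set excludes one element, so along with a prime it contains all smaller
  ones; unions and intersections inherit this. Thus \<open>{0}\<close> is in every nonempty open set
  of \<open>Spec D\<close>, and \<open>pt UNIV\<close> in every open set meeting the image of
  Z.\<close>

lemma spec_open_generalize:
  assumes "openin (spec_topology A) U" "P \<in> U" "Q \<in> primes A" "Q \<subseteq> P"
  shows "Q \<in> U"
proof -
  have "generate_topology_on {{P \<in> primes A. f \<notin> P} |f. f \<in> A} U"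
    using assms(1) unfolding spec_topology_def openin_topology_generated_by_iff .
  then show ?thesis using assms(2)
    by (induction) (use assms(3,4) in auto)
qed

lemma proj_open_generalize:
  assumes "openin (proj_topology G) U" "P \<in> U" "Q \<in> proj_points G" "Q \<subseteq> P"
  shows "Q \<in> U"
proof -
  obtain T where "openin (spec_topology (graded_sum G)) T" "U = T \<inter> proj_points G"
    using assms(1) by (auto simp: proj_topology_def openin_subtopology)
  then show ?thesis using spec_open_generalize[of "graded_sum G" T P Q] assms
    by (auto simp: proj_points_def)
qed

lemma proj_open_basic:
  "f \<in> graded_sum G \<Longrightarrow> openin (proj_topology G) {P \<in> proj_points G. f \<notin> P}"
proof -
  assume f: "f \<in> graded_sum G"
  have "openin (spec_topology (graded_sum G)) {P \<in> primes (graded_sum G). f \<notin> P}"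
    unfolding spec_topology_def by (rule topology_generated_by_Basis) (use f in blast)
  then show ?thesis unfolding proj_topology_def openin_subtopology
    by (intro exI[of _ "{P \<in> primes (graded_sum G). f \<notin> P}"] conjI) (auto simp: proj_points_def)
qed

text \<open>The complement of Q is open, so if it contained a point above Q it would contain Q
  itself.\<close>

lemma closed_point_maximal:
  assumes D: "is_subring D" and Q: "Q \<in> closed_points (proj_line D)"
    and P: "P \<in> proj_points (binary_forms D)" "Q \<subseteq> P"
  shows "P = Q"
proof (rule ccontr)
  assume "P \<noteq> Q"
  have Qp: "Q \<in> proj_points (binary_forms D)"
    and "openin (proj_topology (binary_forms D)) (proj_points (binary_forms D) - {Q})"
    using Q topspace_proj_line[OF D] by (auto simp: closed_points_def proj_line_def Proj_def closedin_def)
  from proj_open_generalize[OF this(2) _ Qp P(2)] show False using P \<open>P \<noteq> Q\<close> by auto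
qed

section \<open>The morphism to the projective line given by a field element\<close>

locale zr_element =
  fixes D :: "'a::field set" and Z :: "'a set set" and t :: 'a
  assumes D: "is_subring D" and Z: "Z \<subseteq> zariski_riemann D" and F: "UNIV \<in> Z"
begin

abbreviation "points \<equiv> proj_points (binary_forms D)"

text \<open>Substitution of 1 for \<open>T0\<close> and t for \<open>T1\<close>: the constant
  polynomial \<open>[:t:]\<close> first replaces the outer variable.\<close>

definition ev :: "'a poly poly \<Rightarrow> 'a" where "ev f = poly (poly f [:t:]) 1"

lemma ev_simps [simp]:
  "ev 0 = 0" "ev 1 = 1" "ev (f + g) = ev f + ev g" "ev (f * g) = ev f * ev g" "ev (f - g) = ev f - ev g"
  "ev (f ^ n) = ev f ^ n" "ev (cst c) = c" "ev T0 = 1" "ev T1 = t"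
  by (simp_all add: ev_def)

lemma ev_sum: "ev (sum f A) = (\<Sum>i\<in>A. ev (f i))"
  by (induction A rule: infinite_finite_induct) auto

lemma ZV: "V \<in> Z \<Longrightarrow> valuation_ring V" and ZD: "V \<in> Z \<Longrightarrow> D \<subseteq> V"
  using Z by (auto simp: zariski_riemann_def)

lemma ZS: "V \<in> Z \<Longrightarrow> is_subring V"
  using ZV valuation_ringD(1) by blast

text \<open>A generator of the module V + V t, that is, whichever of 1 and t has the smaller value.
  Dividing by its n-th power normalizes the values of forms of degree n.\<close>

definition w :: "'a set \<Rightarrow> 'a" where "w V = (if t \<in> V then 1 else t)"

lemma w_nz: "V \<in> Z \<Longrightarrow> w V \<noteq> 0"
  using is_subringD(2)[OF ZS] by (auto simp: w_def)

lemma inverse_w: "V \<in> Z \<Longrightarrow> inverse (w V) \<in> V"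
  using valuation_ringD(2)[OF ZV, of V t] is_subringD(1)[OF ZS, of V] by (auto simp: w_def)

lemma t_over_w: "V \<in> Z \<Longrightarrow> t / w V \<in> V"
  using is_subringD(1,2)[OF ZS, of V] by (auto simp: w_def)

text \<open>By homogeneity the quotient is the value of f at the coordinates 1 / w V and t / w V,
  both in V.\<close>

lemma form_value:
  assumes V: "V \<in> Z" and f: "f \<in> binary_forms D n"
  shows "ev f / w V ^ n \<in> V"
  using f
proof (induction n arbitrary: f)
  case 0
  then obtain c where "c \<in> D" "f = cst c" using bf_zero_deg by metis
  then show ?case using ZD[OF V] by auto
next
  case (Suc n)
  note VV = is_subringD[OF ZS[OF V]]
  obtain c g where f: "c \<in> D" "g \<in> binary_forms D n" "f = cst c * T1 ^ Suc n + T0 * g"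
    using bf_split[OF Suc.prems is_subringD(2)[OF D]] by blast
  have "ev f = c * t ^ Suc n + ev g" unfolding f(3) ev_simps by simp
  then have "ev f / w V ^ Suc n = c * (t / w V) ^ Suc n + (ev g / w V ^ n) * inverse (w V)"
    using w_nz[OF V] by (simp add: power_divide field_simps)
  moreover have "c \<in> V" using f(1) ZD[OF V] by blast
  ultimately show ?case
    using VV(4)[OF VV(6)[OF _ VV(7)[OF t_over_w[OF V]]] VV(6)[OF Suc.IH[OF f(2)] inverse_w[OF V]], of c "Suc n"]
    by simp
qed

text \<open>Both \<open>1 / w V\<close> and \<open>t / w V\<close> lie in \<open>V\<close> and one of them is 1, so they are homogeneous
  coordinates over \<open>V\<close>, and \<open>pt V\<close> is the image of the closed point of \<open>Spec V\<close>.\<close>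

definition pt :: "'a set \<Rightarrow> 'a poly poly set" where
  "pt V = {f \<in> forms_ring D. \<forall>n. ev (hom_part n f) / w V ^ n \<in> nonunits V}"

lemma pt_form:
  assumes V: "V \<in> Z" and f: "f \<in> binary_forms D n"
  shows "f \<in> pt V \<longleftrightarrow> ev f / w V ^ n \<in> nonunits V"
proof -
  have "ev (hom_part k f) / w V ^ k \<in> nonunits V \<longleftrightarrow> k \<noteq> n \<or> ev f / w V ^ n \<in> nonunits V" for k
    using nonunits_facts(1)[OF ZV[OF V]] by (simp add: hom_part_bf[OF f])
  then show ?thesis using bf_S[OF D f] by (auto simp: pt_def)
qed

lemma hideal_pt:
  assumes V: "V \<in> Z"
  shows "hideal D (pt V)"
  unfolding hideal_def
proof (intro conjI ballI allI)
  note N = nonunits_facts[OF ZV[OF V]] and S = is_subringD[OF subring_S[OF D]]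
  have Nsum: "sum h A \<in> nonunits V" if "\<And>i. i \<in> A \<Longrightarrow> h i \<in> nonunits V" for h :: "nat \<Rightarrow> 'a" and A
    using that by (induction A rule: infinite_finite_induct) (simp_all add: N(1,5))
  show "pt V \<subseteq> forms_ring D" by (auto simp: pt_def)
  show "0 \<in> pt V" by (simp add: pt_def S(2) N(1))
  show "x + y \<in> pt V" if "x \<in> pt V" "y \<in> pt V" for x y
    using that by (simp add: pt_def S(4) N(5) add_divide_distrib)
  show "hom_part n x \<in> pt V" if "x \<in> pt V" for x n
  proof -
    have "hom_part n x \<in> binary_forms D n" using that by (intro hom_part_S[OF D]) (simp add: pt_def)
    then show ?thesis using that by (simp add: pt_form[OF V]) (simp add: pt_def)
  qed
  show "a * x \<in> pt V" if a: "a \<in> forms_ring D" and x: "x \<in> pt V" for a x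
  proof -
    have "ev (hom_part n (a * x)) / w V ^ n \<in> nonunits V" for n
    proof -
      have "ev (hom_part n (a * x)) / w V ^ n = (\<Sum>k\<le>n. (ev (hom_part k a) / w V ^ k) * (ev (hom_part (n - k) x) / w V ^ (n - k)))"
        unfolding hom_part_mult ev_sum sum_divide_distrib
        by (intro sum.cong refl) (simp flip: power_add)
      also have "\<dots> \<in> nonunits V"
        using x by (intro Nsum N(4) form_value[OF V hom_part_S[OF D a]]) (simp add: pt_def)
      finally show ?thesis .
    qed
    then show ?thesis using S(6)[OF a] x by (simp add: pt_def)
  qed
qed

lemma pt_point:
  assumes V: "V \<in> Z"
  shows "pt V \<in> points"
proof (rule proj_pointI[OF D hideal_pt[OF V]])
  note N = nonunits_facts(6)[OF ZV[OF V]]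
  fix n k a b assume a: "a \<in> binary_forms D n" and b: "b \<in> binary_forms D k" and ab: "a * b \<in> pt V"
  have "(ev a / w V ^ n) * (ev b / w V ^ k) \<in> nonunits V"
    using ab unfolding pt_form[OF V bf_mult[OF D a b]] by (simp add: power_add)
  then show "a \<in> pt V \<or> b \<in> pt V"
    unfolding pt_form[OF V a] pt_form[OF V b] by (rule N[OF form_value[OF V a] form_value[OF V b]])
next
  note N = nonunits_facts[OF ZV[OF V]]
  show "(if t \<in> V then T0 else T1) \<in> {T0, T1}" by simp
  show "(if t \<in> V then T0 else T1) \<notin> pt V"
    using N(2) is_subringD(2)[OF ZS[OF V]]
    by (auto simp: pt_form[OF V bf_T0[OF D]] pt_form[OF V bf_T1[OF D]] w_def)
qed

lemma nonunits_UNIV [simp]: "nonunits UNIV = {0}"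
  by (auto simp: nonunits_def)

lemma pt_UNIV_form: "f \<in> binary_forms D n \<Longrightarrow> f \<in> pt UNIV \<longleftrightarrow> ev f = 0"
  by (simp add: pt_form[OF F] w_def)

lemma pt_UNIV_subset:
  assumes V: "V \<in> Z"
  shows "pt UNIV \<subseteq> pt V"
proof (rule proj_point_subsetI[OF D hideal_pt[OF V] hideal_pt[OF F]])
  fix n f assume "f \<in> binary_forms D n" "f \<in> pt UNIV"
  then show "f \<in> pt V"
    using nonunits_facts(1)[OF ZV[OF V]] by (simp add: pt_form[OF V] pt_UNIV_form)
qed

lemma pt_cst: "V \<in> Z \<Longrightarrow> a \<in> D \<Longrightarrow> cst a \<in> pt V \<longleftrightarrow> a \<in> nonunits V"
  using pt_form[of V "cst a" 0] bf_cst[OF is_subringD(2)[OF D]] by simp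

text \<open>The element \<open>w V ^ n\<close> is 1 or t^n, and the other of the two is a V-multiple
  of it. The condition on V thus becomes membership of elements not depending on V, which defines a
  basic open set of Z.\<close>

lemma not_in_pt_iff:
  assumes V: "V \<in> Z" and f: "f \<in> binary_forms D n"
  shows "f \<notin> pt V \<longleftrightarrow> ev f \<noteq> 0 \<and> {1 / ev f, t ^ n / ev f} \<subseteq> V"
proof -
  note VV = is_subringD[OF ZS[OF V]]
  have "f \<notin> pt V \<longleftrightarrow> ev f \<noteq> 0 \<and> w V ^ n / ev f \<in> V"
    unfolding pt_form[OF V f] using form_value[OF V f] w_nz[OF V]
    by (auto simp: nonunits_def inverse_eq_divide)
  also have "w V ^ n / ev f \<in> V \<longleftrightarrow> {1 / ev f, t ^ n / ev f} \<subseteq> V"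
  proof (cases "t \<in> V")
    case True
    then show ?thesis using VV(6)[OF VV(7)[OF True, of n], of "1 / ev f"] by (auto simp: w_def)
  next
    case False
    have t: "inverse t \<in> V" "t \<noteq> 0" using False valuation_ringD(2)[OF ZV[OF V]] VV(2) by auto
    have "inverse t ^ n * (t ^ n / ev f) = 1 / ev f" using t(2) by (simp add: field_simps)
    then show ?thesis using VV(6)[OF VV(7)[OF t(1), of n], of "t ^ n / ev f"] False by (auto simp: w_def)
  qed
  finally show ?thesis by blast
qed

section \<open>Continuity and the maps on sections\<close>

abbreviation "X \<equiv> zr_space D Z"
abbreviation "Y \<equiv> proj_line D"

lemma X_simps:
  "space_top X = subtopology (zr_topology D) Z" "sec X = (\<lambda>U. if U = {} then zero_ring else ring_on (\<Inter>U))"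
  "res X = (\<lambda>U W s. if W = {} then 0 else s)"
  by (simp_all add: zr_space_def)

lemma Y_simps:
  "space_top Y = proj_topology (binary_forms D)"
  "sec Y = (\<lambda>U. function_ring U (proj_sections (binary_forms D) U))"
  "res Y = (\<lambda>U W s. restrict s W)"
  by (simp_all add: proj_line_def Proj_def)

lemma topspace_X: "topspace (space_top X) = Z"
proof -
  have "zariski_riemann D \<subseteq> \<Union>{{V \<in> zariski_riemann D. T \<subseteq> V} |T. finite T}"
    by (intro Union_upper CollectI exI[of _ "{}"]) auto
  then have "topspace (zr_topology D) = zariski_riemann D"
    unfolding zr_topology_def topology_generated_by_topspace by blast
  then show ?thesis using Z by (auto simp: X_simps)
qed

lemma open_X_basic:
  assumes "finite T"
  shows "openin (space_top X) {V \<in> Z. T \<subseteq> V}"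
proof -
  have "openin (zr_topology D) {V \<in> zariski_riemann D. T \<subseteq> V}"
    unfolding zr_topology_def by (rule topology_generated_by_Basis) (use assms in blast)
  then show ?thesis unfolding X_simps openin_subtopology using Z
    by (intro exI[of _ "{V \<in> zariski_riemann D. T \<subseteq> V}"] conjI) auto
qed

lemma open_X_form:
  assumes f: "f \<in> binary_forms D n"
  shows "openin (space_top X) {V \<in> Z. f \<notin> pt V}"
proof (cases "ev f = 0")
  case True
  then have "{V \<in> Z. f \<notin> pt V} = {}" using not_in_pt_iff[OF _ f] by auto
  then show ?thesis by (simp only: openin_empty)
next
  case False
  then have "{V \<in> Z. f \<notin> pt V} = {V \<in> Z. {1 / ev f, t ^ n / ev f} \<subseteq> V}" using not_in_pt_iff[OF _ f] by auto
  then show ?thesis using open_X_basic[of "{1 / ev f, t ^ n / ev f}"] by simp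
qed

lemma continuous_pt: "continuous_map (space_top X) (space_top Y) pt"
  unfolding Y_simps proj_topology_def continuous_map_in_subtopology
proof
  show "pt \<in> topspace (space_top X) \<rightarrow> points" using pt_point by (simp add: topspace_X)
  have P: "pt V \<in> primes (forms_ring D)" if "V \<in> Z" for V
    using pt_point[OF that] by (simp add: proj_points_def)
  show "continuous_map (space_top X) (spec_topology (forms_ring D)) pt"
    unfolding spec_topology_def
  proof (rule continuous_on_generated_topo)
    have "pt ` Z \<subseteq> primes (forms_ring D)" using P by blast
    also have "\<dots> = \<Union>{{P \<in> primes (forms_ring D). f \<notin> P} |f. f \<in> forms_ring D}"
      using topspace_spec[OF subring_S[OF D]]
      unfolding spec_topology_def topology_generated_by_topspace by simp
    finally show "pt ` topspace (space_top X) \<subseteq> \<dots>" by (simp only: topspace_X)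
    fix U assume "U \<in> {{P \<in> primes (forms_ring D). f \<notin> P} |f. f \<in> forms_ring D}"
    then obtain f where f: "f \<in> forms_ring D" "U = {P \<in> primes (forms_ring D). f \<notin> P}" by blast
    \<comment> \<open>Here f need not be homogeneous: its locus is the union of those of its
      components, which are open by \<open>open_X_form\<close>.\<close>
    have "f \<notin> pt V \<longleftrightarrow> (\<exists>n. hom_part n f \<notin> pt V)" if "V \<in> Z" for V
      using hideal_hom_part[OF hideal_pt[OF that]] hidealD(5)[OF hideal_pt[OF that]] by blast
    then have "pt -` U \<inter> topspace (space_top X) = (\<Union>n. {V \<in> Z. hom_part n f \<notin> pt V})"
      using P unfolding topspace_X f(2) by auto
    also have "openin (space_top X) \<dots>"
      by (intro openin_Union ballI) (use open_X_form[OF hom_part_S[OF D f(1)]] in auto)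
    finally show "openin (space_top X) (pt -` U \<inter> topspace (space_top X))" .
  qed
qed

text \<open>The value of a fraction at (1, t). By cross multiplication all representations with
  denominator nonzero at (1, t) give the same value.\<close>

definition val :: "'a poly poly fract \<Rightarrow> 'a" where
  "val y = (THE v. \<exists>a b. y = Fract a b \<and> ev b \<noteq> 0 \<and> v = ev a / ev b)"

lemma val_Fract:
  assumes b: "ev b \<noteq> 0"
  shows "val (Fract a b) = ev a / ev b"
  unfolding val_def
proof (rule the_equality)
  fix v assume "\<exists>c d. Fract a b = Fract c d \<and> ev d \<noteq> 0 \<and> v = ev c / ev d"
  then obtain c d where cd: "Fract a b = Fract c d" "ev d \<noteq> 0" "v = ev c / ev d" by blast
  have "b \<noteq> 0" "d \<noteq> 0" using b cd by auto
  then have "a * d = c * b" using cd(1) by (simp add: eq_fract)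
  then have "ev (a * d) = ev (c * b)" by (rule arg_cong)
  then show "v = ev a / ev b" using b cd(2) by (simp add: cd(3) frac_eq_eq)
qed (use b in blast)

text \<open>Every nonempty preimage contains the field itself, so a section is determined by its value at
  the point \<open>pt UNIV\<close>.\<close>

definition sec_map :: "'a poly poly set set \<Rightarrow> ('a poly poly set \<Rightarrow> 'a poly poly fract) \<Rightarrow> 'a" where
  "sec_map U s = (if {V \<in> Z. pt V \<in> U} = {} then 0 else val (s (pt UNIV)))"

lemma preim_eq: "preim X (pt, h) U = {V \<in> Z. pt V \<in> U}"
  by (simp add: preim_def topspace_X)

text \<open>Since \<open>pt UNIV\<close> is contained in every \<open>pt V\<close>, it is the
  generic point of the closure of the image.\<close>

lemma generic_in:
  assumes "openin (space_top Y) U" "V \<in> Z" "pt V \<in> U"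
  shows "pt UNIV \<in> U"
  using proj_open_generalize[OF assms(1)[unfolded Y_simps] assms(3) pt_point[OF F] pt_UNIV_subset[OF assms(2)]] .

text \<open>A fraction representing s near \<open>pt V\<close> also represents it at
  \<open>pt UNIV\<close>, which lies in the same open set. Dividing by \<open>w V ^ n\<close> makes
  its numerator an element of V and its denominator a unit of V.\<close>

lemma section_local:
  assumes s: "s \<in> proj_sections (binary_forms D) U" and V: "V \<in> Z" "pt V \<in> U"
  obtains W a b n where "openin (space_top Y) W" "pt V \<in> W" "W \<subseteq> U"
    "a \<in> binary_forms D n" "b \<in> binary_forms D n" "\<And>Q. Q \<in> W \<Longrightarrow> b \<notin> Q \<and> s Q = Fract a b"
    "ev b \<noteq> 0" "s (pt UNIV) = Fract a b" "val (s (pt UNIV)) = ev a / ev b"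
    "val (s (pt UNIV)) = (ev a / w V ^ n) * inverse (ev b / w V ^ n)" "inverse (ev b / w V ^ n) \<in> V"
proof -
  have "\<forall>P\<in>U. \<exists>W a b n. openin (proj_topology (binary_forms D)) W \<and> P \<in> W \<and> W \<subseteq> U \<and>
      a \<in> binary_forms D n \<and> b \<in> binary_forms D n \<and> (\<forall>Q\<in>W. b \<notin> Q \<and> s Q = Fract a b)"
    using s unfolding proj_sections_def by blast
  from bspec[OF this V(2)] obtain W a b n where W: "openin (proj_topology (binary_forms D)) W" "pt V \<in> W" "W \<subseteq> U"
      "a \<in> binary_forms D n" "b \<in> binary_forms D n" "\<forall>Q\<in>W. b \<notin> Q \<and> s Q = Fract a b"
    by (elim exE conjE)
  have W': "openin (space_top Y) W" using W(1) by (simp add: Y_simps)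
  have g: "pt UNIV \<in> W" by (rule generic_in[OF W' V(1) W(2)])
  have sF: "s (pt UNIV) = Fract a b" and b: "ev b \<noteq> 0" using W(6) g pt_UNIV_form[OF W(5)] by auto
  have "b \<notin> pt V" using W(2,6) by blast
  then have "inverse (ev b / w V ^ n) \<in> V"
    using form_value[OF V(1) W(5)] unfolding pt_form[OF V(1) W(5)] nonunits_def by blast
  moreover have "val (s (pt UNIV)) = ev a / ev b" using sF val_Fract[OF b] by simp
  moreover have "ev a / ev b = (ev a / w V ^ n) * inverse (ev b / w V ^ n)"
    using w_nz[OF V(1)] by simp
  ultimately show thesis
    using that[OF W' W(2-5) _ b sF] W(6) by metis
qed

lemma val_section_in:
  assumes "s \<in> proj_sections (binary_forms D) U" and V: "V \<in> Z" "pt V \<in> U"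
  shows "val (s (pt UNIV)) \<in> V"
proof (rule section_local[OF assms])
  fix a n b assume "a \<in> binary_forms D n" "inverse (ev b / w V ^ n) \<in> V"
    "val (s (pt UNIV)) = (ev a / w V ^ n) * inverse (ev b / w V ^ n)"
  then show ?thesis using is_subringD(6)[OF ZS[OF V(1)] form_value[OF V(1)]] by (simp only:)
qed

lemma sec_map_eq:
  assumes "V \<in> Z" "pt V \<in> U"
  shows "sec_map U s = val (s (pt UNIV))"
  using assms by (auto simp: sec_map_def)

lemma sec_map_hom:
  assumes U: "openin (space_top Y) U"
  shows "sec_map U \<in> ring_hom (sec Y U) (sec X (preim X (pt, sec_map) U))"
proof (cases "{V \<in> Z. pt V \<in> U} = {}")
  \<comment> \<open>If no \<open>pt V\<close> lies in U, the target is the zero ring, whose only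
    element is 0; the default value of \<open>sec_map\<close> is chosen accordingly.\<close>
  case True
  then show ?thesis unfolding preim_eq
    by (auto simp: ring_hom_def X_simps sec_map_def zero_ring_def ring_on_def)
next
  case False
  then obtain V where V: "V \<in> Z" "pt V \<in> U" by blast
  have g: "pt UNIV \<in> U" by (rule generic_in[OF U V])
  have F': "\<exists>a b. s (pt UNIV) = Fract a b \<and> ev b \<noteq> 0" if "s \<in> proj_sections (binary_forms D) U" for s
    using section_local[OF that V] by metis
  have add: "val (x + y) = val x + val y" and mult: "val (x * y) = val x * val y"
    if xy: "x = Fract a b" "y = Fract c d" "ev b \<noteq> 0" "ev d \<noteq> 0" for x y a b c d
  proof -
    have "b \<noteq> 0" "d \<noteq> 0" using xy by auto
    then show "val (x + y) = val x + val y" "val (x * y) = val x * val y"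
      using xy by (simp_all add: val_Fract add_frac_eq)
  qed
  have one: "val 1 = 1" using val_Fract[of 1 1] by (simp add: One_fract_def)
  show ?thesis
  proof (rule ring_hom_memI)
    show "sec_map U x \<in> carrier (sec X (preim X (pt, sec_map) U))" if "x \<in> carrier (sec Y U)" for x
      using that False val_section_in by (auto simp: preim_eq X_simps Y_simps function_ring_def sec_map_def)
    fix x y assume "x \<in> carrier (sec Y U)" "y \<in> carrier (sec Y U)"
    then obtain a b c d where "x (pt UNIV) = Fract a b" "y (pt UNIV) = Fract c d" "ev b \<noteq> 0" "ev d \<noteq> 0"
      using F'[of x] F'[of y] by (auto simp: Y_simps function_ring_def)
    note add[OF this] mult[OF this]
    then show "sec_map U (x \<otimes>\<^bsub>sec Y U\<^esub> y) = sec_map U x \<otimes>\<^bsub>sec X (preim X (pt, sec_map) U)\<^esub> sec_map U y"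
      and "sec_map U (x \<oplus>\<^bsub>sec Y U\<^esub> y) = sec_map U x \<oplus>\<^bsub>sec X (preim X (pt, sec_map) U)\<^esub> sec_map U y"
      using False g unfolding preim_eq sec_map_eq[OF V] by (auto simp: X_simps Y_simps function_ring_def)
  next
    show "sec_map U \<one>\<^bsub>sec Y U\<^esub> = \<one>\<^bsub>sec X (preim X (pt, sec_map) U)\<^esub>"
      using False g one unfolding preim_eq sec_map_eq[OF V] by (auto simp: X_simps Y_simps function_ring_def)
  qed
qed

end

section \<open>Stalks, and locality of the maps between them\<close>

context zr_element
begin

text \<open>The germ of z at V. Restriction maps off the empty set are inclusions, so germs depend
  on z alone, and sending z to \<open>\<gamma> V z\<close> identifies V with the stalk.\<close>

definition \<gamma> :: "'a set \<Rightarrow> 'a \<Rightarrow> ('a set set \<times> 'a) set" where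
  "\<gamma> V z = {(W, z) | W. openin (space_top X) W \<and> V \<in> W \<and> z \<in> \<Inter>W}"

lemma germ_X:
  assumes U: "openin (space_top X) U" "V \<in> U"
  shows "germ X V U z = \<gamma> V z"
proof -
  have eq: "(\<exists>N. openin (space_top X) N \<and> V \<in> N \<and> N \<subseteq> U \<inter> W \<and> res X U N z = res X W N y) \<longleftrightarrow> y = z"
    if W: "openin (space_top X) W" "V \<in> W" for W y
  proof
    assume "y = z"
    then show "\<exists>N. openin (space_top X) N \<and> V \<in> N \<and> N \<subseteq> U \<inter> W \<and> res X U N z = res X W N y"
      using U W by (intro exI[of _ "U \<inter> W"]) (auto simp: X_simps)
  qed (auto simp: X_simps split: if_splits)
  have c: "carrier (sec X W) = \<Inter>W" if "V \<in> W" for W using that by (auto simp: X_simps)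
  show ?thesis
  proof (rule Set.set_eqI)
    fix x :: "'a set set \<times> 'a"
    obtain W y where x: "x = (W, y)" by (cases x)
    have "x \<in> germ X V U z \<longleftrightarrow> openin (space_top X) W \<and> V \<in> W \<and> y \<in> carrier (sec X W) \<and>
        (\<exists>N. openin (space_top X) N \<and> V \<in> N \<and> N \<subseteq> U \<inter> W \<and> res X U N z = res X W N y)"
      by (simp only: germ_def x mem_Collect_eq case_prod_conv)
    also have "\<dots> \<longleftrightarrow> openin (space_top X) W \<and> V \<in> W \<and> y \<in> \<Inter>W \<and> y = z"
      using eq[of W y] c[of W] by blast
    also have "\<dots> \<longleftrightarrow> x \<in> \<gamma> V z" by (auto simp: \<gamma>_def x)
    finally show "x \<in> germ X V U z \<longleftrightarrow> x \<in> \<gamma> V z" .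
  qed
qed

lemma open_mem: "openin (space_top X) {V \<in> Z. z \<in> V}"
  using open_X_basic[of "{z}"] by simp

lemma open_Z: "openin (space_top X) Z"
  using openin_topspace[of "space_top X"] by (simp only: topspace_X)

lemma \<gamma>_nonempty: "V \<in> Z \<Longrightarrow> z \<in> V \<Longrightarrow> ({V \<in> Z. z \<in> V}, z) \<in> \<gamma> V z"
  unfolding \<gamma>_def using open_mem[of z] by blast

lemma \<gamma>_inj: "V \<in> Z \<Longrightarrow> z \<in> V \<Longrightarrow> \<gamma> V z = \<gamma> V y \<Longrightarrow> z = y"
  using \<gamma>_nonempty[of V z] by (auto simp: \<gamma>_def)

lemma stalk_X_carrier:
  assumes V: "V \<in> Z"
  shows "carrier (stalk X V) = \<gamma> V ` V"
proof
  show "carrier (stalk X V) \<subseteq> \<gamma> V ` V"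
    by (auto simp: stalk_def germ_X X_simps)
  show "\<gamma> V ` V \<subseteq> carrier (stalk X V)"
  proof
    fix y assume "y \<in> \<gamma> V ` V"
    then obtain z where z: "z \<in> V" "y = \<gamma> V z" by blast
    have "y = germ X V {V \<in> Z. z \<in> V} z" using V z germ_X[OF open_mem[of z]] by simp
    moreover have "z \<in> carrier (sec X {V \<in> Z. z \<in> V})" using V z by (auto simp: X_simps)
    ultimately show "y \<in> carrier (stalk X V)"
      using V z open_mem[of z] by (auto simp: stalk_def)
  qed
qed

text \<open>The operations of the stalk are unions over all pairs of representatives. All pairs give
  the same germ and there is at least one pair; the function f stands for either sum or
  product.\<close>

lemma stalk_X_op:
  assumes V: "V \<in> Z" and zy: "z \<in> V" "y \<in> V"
    and op: "\<And>W. V \<in> W \<Longrightarrow> f W z y = g"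
  shows "(\<Union>(U, s)\<in>\<gamma> V z. \<Union>(W, r)\<in>\<gamma> V y. germ X V (U \<inter> W) (f (U \<inter> W) (res X U (U \<inter> W) s) (res X W (U \<inter> W) r)))
    = \<gamma> V g" (is "?L = _")
proof -
  have "germ X V (U \<inter> W) (f (U \<inter> W) (res X U (U \<inter> W) s) (res X W (U \<inter> W) r)) = \<gamma> V g"
    if "(U, s) \<in> \<gamma> V z" "(W, r) \<in> \<gamma> V y" for U s W r
  proof -
    have UW: "openin (space_top X) (U \<inter> W)" "V \<in> U \<inter> W" "s = z" "r = y" using that by (auto simp: \<gamma>_def)
    then have ne: "U \<inter> W \<noteq> {}" by blast
    then have "res X U (U \<inter> W) s = z" "res X W (U \<inter> W) r = y" using UW by (auto simp: X_simps)
    then show ?thesis using germ_X[OF UW(1,2)] op[OF UW(2)] by simp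
  qed
  then show ?thesis using \<gamma>_nonempty[OF V zy(1)] \<gamma>_nonempty[OF V zy(2)] by fast
qed

lemma stalk_X_ops:
  assumes V: "V \<in> Z"
  shows "z \<in> V \<Longrightarrow> y \<in> V \<Longrightarrow> \<gamma> V z \<otimes>\<^bsub>stalk X V\<^esub> \<gamma> V y = \<gamma> V (z * y)"
    "z \<in> V \<Longrightarrow> y \<in> V \<Longrightarrow> \<gamma> V z \<oplus>\<^bsub>stalk X V\<^esub> \<gamma> V y = \<gamma> V (z + y)"
    "\<one>\<^bsub>stalk X V\<^esub> = \<gamma> V 1" "\<zero>\<^bsub>stalk X V\<^esub> = \<gamma> V 0"
proof -
  have ne: "Z \<noteq> {}" using V by blast
  show "\<one>\<^bsub>stalk X V\<^esub> = \<gamma> V 1" "\<zero>\<^bsub>stalk X V\<^esub> = \<gamma> V 0"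
    using V ne by (simp_all add: stalk_def topspace_X germ_X[OF open_Z V]) (simp_all add: X_simps)
  show "\<gamma> V z \<otimes>\<^bsub>stalk X V\<^esub> \<gamma> V y = \<gamma> V (z * y)" if "z \<in> V" "y \<in> V"
  proof -
    have "z \<otimes>\<^bsub>sec X W\<^esub> y = z * y" if "V \<in> W" for W using that by (auto simp: X_simps)
    from stalk_X_op[OF V that, of "\<lambda>W s r. s \<otimes>\<^bsub>sec X W\<^esub> r", OF this]
    show ?thesis by (simp add: stalk_def)
  qed
  show "\<gamma> V z \<oplus>\<^bsub>stalk X V\<^esub> \<gamma> V y = \<gamma> V (z + y)" if "z \<in> V" "y \<in> V"
  proof -
    have "z \<oplus>\<^bsub>sec X W\<^esub> y = z + y" if "V \<in> W" for W using that by (auto simp: X_simps)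
    from stalk_X_op[OF V that, of "\<lambda>W s r. s \<oplus>\<^bsub>sec X W\<^esub> r", OF this]
    show ?thesis by (simp add: stalk_def)
  qed
qed

text \<open>Germs outside the image of \<open>nonunits V\<close> are invertible, so N lies in that
  image. The image is a proper ideal, and maximality of N gives equality.\<close>

lemma stalk_X_maximal:
  assumes V: "V \<in> Z" and N: "maximalideal N (stalk X V)" and z: "z \<in> nonunits V"
  shows "\<gamma> V z \<in> N"
proof -
  interpret maximalideal N "stalk X V" by (rule N)
  note ops = stalk_X_ops[OF V] and VV = is_subringD[OF ZS[OF V]] and nu = nonunits_facts[OF ZV[OF V]]
  have one_in: "\<gamma> V y \<notin> N" if y: "y \<in> V" "y \<notin> nonunits V" for y
  proof
    assume "\<gamma> V y \<in> N"
    have yi: "inverse y \<in> V" "y \<noteq> 0" using y by (auto simp: nonunits_def)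
    then have "\<gamma> V (inverse y) \<otimes>\<^bsub>stalk X V\<^esub> \<gamma> V y \<in> N"
      using \<open>\<gamma> V y \<in> N\<close> by (intro I_l_closed) (auto simp: stalk_X_carrier[OF V])
    then have "\<one>\<^bsub>stalk X V\<^esub> \<in> N" using y yi by (simp add: ops)
    then show False using one_imp_carrier I_notcarr by blast
  qed
  have "ideal (\<gamma> V ` nonunits V) (stalk X V)"
  proof (rule idealI)
    show "ring (stalk X V)" by (rule ring_axioms)
    show "subgroup (\<gamma> V ` nonunits V) (add_monoid (stalk X V))"
    proof (rule add.subgroupI)
      show "\<gamma> V ` nonunits V \<subseteq> carrier (stalk X V)" using nu(3) by (auto simp: stalk_X_carrier[OF V])
      show "\<gamma> V ` nonunits V \<noteq> {}" using nu(1) by blast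
    next
      fix a assume "a \<in> \<gamma> V ` nonunits V"
      then obtain y where y: "y \<in> nonunits V" "a = \<gamma> V y" by blast
      have my: "- y \<in> nonunits V" using nu(4)[OF VV(3)[OF VV(1)] y(1)] by simp
      have "\<gamma> V (- y) \<oplus>\<^bsub>stalk X V\<^esub> \<gamma> V y = \<zero>\<^bsub>stalk X V\<^esub>"
        using nu(3)[OF my] nu(3)[OF y(1)] by (simp add: ops)
      then have "\<ominus>\<^bsub>stalk X V\<^esub> a = \<gamma> V (- y)"
        unfolding y(2) using nu(3)[OF my] nu(3)[OF y(1)]
        by (intro minus_equality) (auto simp: stalk_X_carrier[OF V])
      then show "\<ominus>\<^bsub>stalk X V\<^esub> a \<in> \<gamma> V ` nonunits V" using my by simp
    next
      fix a b assume "a \<in> \<gamma> V ` nonunits V" "b \<in> \<gamma> V ` nonunits V"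
      then show "a \<oplus>\<^bsub>stalk X V\<^esub> b \<in> \<gamma> V ` nonunits V" using nu(3,5) by (auto simp: ops)
    qed
    fix a x assume "a \<in> \<gamma> V ` nonunits V" "x \<in> carrier (stalk X V)"
    then obtain y r where yr: "y \<in> nonunits V" "a = \<gamma> V y" "r \<in> V" "x = \<gamma> V r"
      unfolding stalk_X_carrier[OF V] by blast
    have "r * y \<in> nonunits V" by (rule nu(4)[OF yr(3,1)])
    then show "x \<otimes>\<^bsub>stalk X V\<^esub> a \<in> \<gamma> V ` nonunits V" "a \<otimes>\<^bsub>stalk X V\<^esub> x \<in> \<gamma> V ` nonunits V"
      using yr nu(3) by (auto simp: ops mult.commute[of y r])
  qed
  moreover have "N \<subseteq> \<gamma> V ` nonunits V"
  proof
    fix a assume a: "a \<in> N"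
    then have "a \<in> carrier (stalk X V)" using a_subset by blast
    then obtain y where "y \<in> V" "a = \<gamma> V y" unfolding stalk_X_carrier[OF V] by blast
    then show "a \<in> \<gamma> V ` nonunits V" using one_in a by blast
  qed
  moreover have "\<gamma> V ` nonunits V \<subseteq> carrier (stalk X V)" using nu(3) by (auto simp: stalk_X_carrier[OF V])
  moreover have "\<gamma> V ` nonunits V \<noteq> carrier (stalk X V)"
  proof
    assume "\<gamma> V ` nonunits V = carrier (stalk X V)"
    then have "\<gamma> V 1 \<in> \<gamma> V ` nonunits V" using VV(1) by (auto simp: stalk_X_carrier[OF V])
    then show False using \<gamma>_inj[OF V VV(1)] nu(2) by blast
  qed
  ultimately have "\<gamma> V ` nonunits V = N" using I_maximal by blast
  then show ?thesis using z by blast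
qed

lemma germ_Y:
  "germ Y P U s = {(W, r). openin (space_top Y) W \<and> P \<in> W \<and> r \<in> proj_sections (binary_forms D) W \<and>
     (\<exists>N. openin (space_top Y) N \<and> P \<in> N \<and> N \<subseteq> U \<inter> W \<and> (\<forall>Q\<in>N. s Q = r Q))}"
proof -
  have "restrict s N = restrict r N \<longleftrightarrow> (\<forall>Q\<in>N. s Q = r Q)"
    for s r :: "'a poly poly set \<Rightarrow> 'a poly poly fract" and N
    by (metis restrict_apply' restrict_ext)
  then show ?thesis unfolding germ_def by (simp add: Y_simps function_ring_def)
qed

lemma germ_Y_cong:
  assumes N: "openin (space_top Y) N" "P \<in> N" "N \<subseteq> U \<inter> U'" "\<forall>Q\<in>N. s Q = s' Q"
  shows "germ Y P U s \<subseteq> germ Y P U' s'"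
proof
  fix x assume "x \<in> germ Y P U s"
  then obtain W r N' where x: "x = (W, r)" "openin (space_top Y) W" "P \<in> W" "r \<in> proj_sections (binary_forms D) W"
    "openin (space_top Y) N'" "P \<in> N'" "N' \<subseteq> U \<inter> W" "\<forall>Q\<in>N'. s Q = r Q"
    unfolding germ_Y by blast
  have "openin (space_top Y) (N \<inter> N') \<and> P \<in> N \<inter> N' \<and> N \<inter> N' \<subseteq> U' \<inter> W \<and> (\<forall>Q\<in>N \<inter> N'. s' Q = r Q)"
    using x N by auto
  then show "x \<in> germ Y P U' s'" unfolding germ_Y using x(1-4) by blast
qed

lemma topspace_Y: "topspace (space_top Y) = points"
  by (simp add: Y_simps topspace_proj_line[OF D])

lemma self_germ:
  assumes "openin (space_top Y) U" "P \<in> U" "s \<in> proj_sections (binary_forms D) U"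
  shows "(U, s) \<in> germ Y P U s"
  unfolding germ_Y using assms by blast

text \<open>If a is locally given by the fraction f / g of forms, then f lies in
  \<open>pt V\<close>: otherwise g / f would be a section near \<open>pt V\<close> and its germ an
  inverse of a. Hence the value of the section is in the maximal ideal of V, as locality of the
  morphism demands.\<close>

lemma maximal_stalk_Y:
  assumes V: "V \<in> Z" and M: "maximalideal M (stalk Y (pt V))" and a: "a \<in> M"
  obtains U s where "openin (space_top Y) U" "pt V \<in> U" "s \<in> proj_sections (binary_forms D) U"
    "a = germ Y (pt V) U s" "val (s (pt UNIV)) \<in> nonunits V"
proof -
  interpret maximalideal M "stalk Y (pt V)" by (rule M)
  have "a \<in> carrier (stalk Y (pt V))" using a a_subset by blast
  then obtain U s where U: "openin (space_top Y) U" "pt V \<in> U" "s \<in> proj_sections (binary_forms D) U"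
    "a = germ Y (pt V) U s"
    by (auto simp: stalk_def Y_simps function_ring_def)
  obtain W f g n where W: "openin (space_top Y) W" "pt V \<in> W" "W \<subseteq> U"
    "f \<in> binary_forms D n" "g \<in> binary_forms D n" "\<And>Q. Q \<in> W \<Longrightarrow> g \<notin> Q \<and> s Q = Fract f g"
    "val (s (pt UNIV)) = (ev f / w V ^ n) * inverse (ev g / w V ^ n)" "inverse (ev g / w V ^ n) \<in> V"
    by (rule section_local[OF U(3) V U(2)]) (rule that; assumption)
  have "f \<in> pt V"
  proof (rule ccontr)
    assume f: "f \<notin> pt V"
    define W' where "W' = W \<inter> {P \<in> points. f \<notin> P}"
    have W': "openin (space_top Y) W'"
      unfolding W'_def by (intro openin_Int W(1)) (simp add: Y_simps proj_open_basic bf_S[OF D W(4)])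
    have VW': "pt V \<in> W'" using W(2) f pt_point[OF V] by (simp add: W'_def)
    define s' where "s' = (\<lambda>Q\<in>W'. Fract g f)"
    have s': "s' \<in> proj_sections (binary_forms D) W'"
      unfolding proj_sections_def
    proof (intro CollectI conjI ballI)
      show "s' \<in> (\<Pi>\<^sub>E P\<in>W'. homogeneous_localization (binary_forms D) P)"
        using W(4,5) by (auto simp: s'_def homogeneous_localization_def W'_def)
      fix P assume "P \<in> W'"
      then show "\<exists>W a b n. openin (proj_topology (binary_forms D)) W \<and> P \<in> W \<and> W \<subseteq> W' \<and>
          a \<in> binary_forms D n \<and> b \<in> binary_forms D n \<and> (\<forall>Q\<in>W. b \<notin> Q \<and> s' Q = Fract a b)"
        using W' W(4,5) by (intro exI[of _ W'] exI[of _ g] exI[of _ f] exI[of _ n])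
          (auto simp: s'_def W'_def Y_simps)
    qed
    have one: "s Q * s' Q = 1" if "Q \<in> W'" for Q
    proof -
      have Q: "Q \<in> W" "Q \<in> points" "f \<notin> Q" "g \<notin> Q" using that W(6) by (auto simp: W'_def)
      then have "f \<noteq> 0" "g \<noteq> 0" using hidealD(2)[OF proj_pointD(1)[OF D Q(2)]] by auto
      then show ?thesis using W(6)[OF Q(1)] that by (simp add: s'_def One_fract_def eq_fract)
    qed
    define e where "e = (\<lambda>Q\<in>points. 1 :: 'a poly poly fract)"
    have one_Y: "\<one>\<^bsub>stalk Y (pt V)\<^esub> = germ Y (pt V) points e"
      by (simp add: stalk_def topspace_Y) (simp add: Y_simps function_ring_def e_def)
    have "a \<otimes>\<^bsub>stalk Y (pt V)\<^esub> germ Y (pt V) W' s' = (\<Union>(U1, s1)\<in>a. \<Union>(W1, t1)\<in>germ Y (pt V) W' s'.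
        germ Y (pt V) (U1 \<inter> W1) (\<lambda>Q\<in>U1 \<inter> W1. s1 Q * t1 Q))"
      unfolding stalk_def by (simp add: Y_simps function_ring_def cong: restrict_cong)
    also have "\<dots> = germ Y (pt V) points e"
    proof -
      \<comment> \<open>Any representatives agree with s and \<open>s'\<close> on smaller
        neighbourhoods of \<open>pt V\<close>, where the product is 1.\<close>
      have "germ Y (pt V) (U1 \<inter> W1) (\<lambda>Q\<in>U1 \<inter> W1. s1 Q * t1 Q) = germ Y (pt V) points e"
        if 1: "(U1, s1) \<in> a" and 2: "(W1, t1) \<in> germ Y (pt V) W' s'" for U1 s1 W1 t1
      proof -
        obtain N1 where N1: "openin (space_top Y) N1" "pt V \<in> N1" "N1 \<subseteq> U \<inter> U1" "\<forall>Q\<in>N1. s Q = s1 Q"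
          using 1 unfolding U(4) germ_Y by blast
        obtain N2 where N2: "openin (space_top Y) N2" "pt V \<in> N2" "N2 \<subseteq> W' \<inter> W1" "\<forall>Q\<in>N2. s' Q = t1 Q"
          using 2 unfolding germ_Y by blast
        have N: "openin (space_top Y) (N1 \<inter> N2)" "pt V \<in> N1 \<inter> N2" using N1 N2 by auto
        have eq: "\<forall>Q\<in>N1 \<inter> N2. (\<lambda>Q\<in>U1 \<inter> W1. s1 Q * t1 Q) Q = e Q"
        proof
          fix Q assume Q: "Q \<in> N1 \<inter> N2"
          then have "Q \<in> W'" "Q \<in> U1 \<inter> W1" using N1(3) N2(3) by auto
          moreover have "s1 Q = s Q" "t1 Q = s' Q" using N1(4) N2(4) Q by auto
          moreover have "Q \<in> points" using \<open>Q \<in> W'\<close> by (simp add: W'_def)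
          ultimately show "(\<lambda>Q\<in>U1 \<inter> W1. s1 Q * t1 Q) Q = e Q" using one by (simp add: e_def)
        qed
        have sub: "N1 \<inter> N2 \<subseteq> (U1 \<inter> W1) \<inter> points" using N1(3) N2(3) by (auto simp: W'_def)
        show ?thesis
        proof
          show "germ Y (pt V) (U1 \<inter> W1) (\<lambda>Q\<in>U1 \<inter> W1. s1 Q * t1 Q) \<subseteq> germ Y (pt V) points e"
            by (rule germ_Y_cong[OF N sub eq])
          show "germ Y (pt V) points e \<subseteq> germ Y (pt V) (U1 \<inter> W1) (\<lambda>Q\<in>U1 \<inter> W1. s1 Q * t1 Q)"
            by (rule germ_Y_cong[OF N]) (use sub eq in auto)
        qed
      qed
      then show ?thesis using self_germ[OF U(1-3)] self_germ[OF W' VW' s'] unfolding U(4) by fast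
    qed
    finally have "a \<otimes>\<^bsub>stalk Y (pt V)\<^esub> germ Y (pt V) W' s' = \<one>\<^bsub>stalk Y (pt V)\<^esub>" using one_Y by simp
    moreover have "germ Y (pt V) W' s' \<in> carrier (stalk Y (pt V))"
    proof -
      have "s' \<in> carrier (sec Y W')" using s' by (simp add: Y_simps function_ring_def)
      then show ?thesis using W' VW' by (auto simp: stalk_def)
    qed
    ultimately have "\<one>\<^bsub>stalk Y (pt V)\<^esub> \<in> M" using I_r_closed[OF a] by metis
    then show False using one_imp_carrier I_notcarr by blast
  qed
  then have "inverse (ev g / w V ^ n) * (ev f / w V ^ n) \<in> nonunits V"
    using pt_form[OF V W(4)] by (intro nonunits_facts(4)[OF ZV[OF V] W(8)]) blast
  then have "val (s (pt UNIV)) \<in> nonunits V" using W(7) by (simp only: mult.commute)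
  then show thesis using U that by blast
qed

lemma stalk_map_pt:
  assumes V: "V \<in> Z" and U: "openin (space_top Y) U" "pt V \<in> U" "s \<in> proj_sections (binary_forms D) U"
  shows "stalk_map X (pt, sec_map) V (germ Y (pt V) U s) = \<gamma> V (val (s (pt UNIV)))"
proof -
  have "germ X V (preim X (pt, sec_map) W) (snd (pt, sec_map) W r) = \<gamma> V (val (s (pt UNIV)))"
    if "(W, r) \<in> germ Y (pt V) U s" for W r
  proof -
    from that obtain N where W: "openin (space_top Y) W" "pt V \<in> W" "r \<in> proj_sections (binary_forms D) W"
      and N: "openin (space_top Y) N" "pt V \<in> N" "N \<subseteq> U \<inter> W" "\<forall>Q\<in>N. s Q = r Q"
      unfolding germ_Y by blast
    have "pt UNIV \<in> N" by (rule generic_in[OF N(1) V N(2)])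
    then have "sec_map W r = val (s (pt UNIV))" using sec_map_eq[OF V W(2)] N(4) by simp
    moreover have "openin (space_top X) (preim X (pt, sec_map) W)"
      using openin_continuous_map_preimage[OF continuous_pt W(1)] by (simp add: preim_def)
    moreover have "V \<in> preim X (pt, sec_map) W" using V W(2) by (simp add: preim_eq)
    ultimately show ?thesis by (simp add: germ_X)
  qed
  then show ?thesis unfolding stalk_map_def using self_germ[OF U] by fast
qed

lemma lrs_morphism_pt: "lrs_morphism X Y (pt, sec_map)"
  unfolding lrs_morphism_def fst_conv snd_conv
proof (intro conjI allI impI ballI)
  show "continuous_map (space_top X) (space_top Y) pt" by (rule continuous_pt)
  show "sec_map U \<in> ring_hom (sec Y U) (sec X (preim X (pt, sec_map) U))" if "openin (space_top Y) U" for U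
    by (rule sec_map_hom[OF that])
next
  fix U W s assume "openin (space_top Y) U \<and> openin (space_top Y) W \<and> W \<subseteq> U \<and> s \<in> carrier (sec Y U)"
  then have UW: "openin (space_top Y) W" "W \<subseteq> U" by auto
  show "sec_map W (res Y U W s) = res X (preim X (pt, sec_map) U) (preim X (pt, sec_map) W) (sec_map U s)"
  proof (cases "{V \<in> Z. pt V \<in> W} = {}")
    case True
    then show ?thesis by (simp add: sec_map_def preim_eq X_simps)
  next
    case False
    then obtain V where V: "V \<in> Z" "pt V \<in> W" by blast
    have "sec_map W (restrict s W) = val (s (pt UNIV))"
      using sec_map_eq[OF V] generic_in[OF UW(1) V] by simp
    moreover have "sec_map U s = val (s (pt UNIV))" using sec_map_eq[OF V(1)] V(2) UW(2) by blast
    ultimately show ?thesis using V by (auto simp: preim_eq X_simps Y_simps)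
  qed
next
  fix V M N assume "V \<in> topspace (space_top X)" and MN: "maximalideal M (stalk Y (pt V)) \<and> maximalideal N (stalk X V)"
  then have V: "V \<in> Z" by (simp only: topspace_X)
  show "stalk_map X (pt, sec_map) V ` M \<subseteq> N"
  proof
    fix y assume "y \<in> stalk_map X (pt, sec_map) V ` M"
    then obtain a where a: "a \<in> M" "y = stalk_map X (pt, sec_map) V a" by blast
    show "y \<in> N"
    proof (rule maximal_stalk_Y[OF V conjunct1[OF MN] a(1)])
      fix U s assume U: "openin (space_top Y) U" "pt V \<in> U" "s \<in> proj_sections (binary_forms D) U"
        and "a = germ Y (pt V) U s" "val (s (pt UNIV)) \<in> nonunits V"
      then show "y \<in> N"
        unfolding a(2) using stalk_map_pt[OF V U] stalk_X_maximal[OF V conjunct2[OF MN]] by simp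
    qed
  qed
qed

lemma D_morphism_pt: "D_morphism_to_proj_line D Z (pt, sec_map)"
  unfolding D_morphism_to_proj_line_def lrs_morphism_over_def fst_conv snd_conv
proof (intro conjI allI impI ballI)
  show "lrs_morphism X Y (pt, sec_map)" by (rule lrs_morphism_pt)
  show "fst (proj_line_structure D) (pt V) = fst (zr_structure D) V" if "V \<in> topspace (space_top X)" for V
  proof -
    have V: "V \<in> Z" using that by (simp only: topspace_X)
    show ?thesis
      using pt_cst[OF V] by (auto simp: proj_line_structure_def zr_structure_def max_ideal_valuation[OF ZV[OF V]])
  qed
  fix U s assume Us: "openin (space_top (Spec D)) U \<and> s \<in> carrier (sec (Spec D) U)"
  define \<pi> where "\<pi> = (\<lambda>P. {a \<in> D. cst a \<in> P})"
  have pre: "preim Y (proj_line_structure D) U = {P \<in> points. \<pi> P \<in> U}"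
    by (simp add: preim_def topspace_Y proj_line_structure_def \<pi>_def)
  have snd_q: "snd (proj_line_structure D) U s = (\<lambda>P\<in>{P \<in> points. \<pi> P \<in> U}. Fract (cst (s (\<pi> P))) 1)"
    by (simp add: proj_line_structure_def \<pi>_def)
  \<comment> \<open>The center of the field itself is \<open>{0}\<close>, the point at which
    \<open>zr_structure\<close> evaluates sections.\<close>
  have piF: "\<pi> (pt UNIV) = {0}"
    using pt_cst[OF F] is_subringD(2)[OF D] by (auto simp: \<pi>_def)
  show "sec_map (preim Y (proj_line_structure D) U) (snd (proj_line_structure D) U s) = snd (zr_structure D) U s"
  proof (cases "U = {}")
    case True
    then show ?thesis unfolding pre by (simp add: sec_map_def zr_structure_def)
  next
    case False
    then obtain P where P: "P \<in> U" by blast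
    have op: "openin (spec_topology D) U" using Us by (simp add: Spec_def)
    have Pp: "P \<in> primes D" using openin_subset[OF op] P topspace_spec[OF D] by blast
    have "{0} \<in> primes D"
      using is_subringD(2)[OF D] by (simp add: primes_iff[OF D])
    moreover have "{0} \<subseteq> P" using Pp by (simp add: primes_iff[OF D])
    ultimately have 0: "{0} \<in> U" by (rule spec_open_generalize[OF op P])
    then have F': "pt UNIV \<in> {P \<in> points. \<pi> P \<in> U}" using piF pt_point[OF F] by simp
    have "sec_map {P \<in> points. \<pi> P \<in> U} (\<lambda>P\<in>{P \<in> points. \<pi> P \<in> U}. Fract (cst (s (\<pi> P))) 1)
        = val (Fract (cst (s {0})) 1)"
      unfolding sec_map_eq[OF F F'] using F' piF by simp
    also have "\<dots> = s {0}" by (subst val_Fract) (simp_all del: One_fract_def)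
    finally show ?thesis unfolding pre snd_q using False by (simp add: zr_structure_def)
  qed
qed

end

text \<open>With A the intersection of Z and u = \<open>ev h\<close>, the second claim says that the
  k-th power of (1, t) is contained in u A, and the third one gives the reverse inclusion, the
  coefficients of h being in D.\<close>

lemma (in zr_element) unit_form:
  assumes h: "h \<in> binary_forms D k" "\<And>V. V \<in> Z \<Longrightarrow> h \<notin> pt V"
  shows "ev h \<noteq> 0" "i \<le> k \<Longrightarrow> t ^ i / ev h \<in> \<Inter>Z"
    "\<exists>c. (\<forall>i. c i \<in> \<Inter>Z) \<and> ev h = (\<Sum>i\<le>k. c i * t ^ i)"
proof -
  show "ev h \<noteq> 0" using h(2)[OF F] pt_UNIV_form[OF h(1)] by simp
  show "t ^ i / ev h \<in> \<Inter>Z" if i: "i \<le> k"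
  proof
    fix V assume V: "V \<in> Z"
    \<comment> \<open>The value of this monomial is t^i, so t^i divided by \<open>w V ^ k\<close>
      lies in V, where \<open>ev h / w V ^ k\<close> is a unit.\<close>
    have "T0 ^ (k - i) * T1 ^ i \<in> binary_forms D k"
      using bf_mult[OF D bf_power[OF D bf_T0[OF D], of "k - i"] bf_power[OF D bf_T1[OF D], of i]] i by simp
    from form_value[OF V this] have "t ^ i / w V ^ k \<in> V" by simp
    moreover have "inverse (ev h / w V ^ k) \<in> V"
      using h(2)[OF V] form_value[OF V h(1)] unfolding pt_form[OF V h(1)] nonunits_def by blast
    ultimately have "(t ^ i / w V ^ k) * inverse (ev h / w V ^ k) \<in> V" by (rule is_subringD(6)[OF ZS[OF V]])
    then show "t ^ i / ev h \<in> V" using w_nz[OF V] by (simp add: field_simps)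
  qed
  define c where "c i = coeff2 h (k - i) i" for i
  have "ev h = (\<Sum>i\<le>k. c i * t ^ i)"
    unfolding c_def by (subst bf_expand[OF h(1)]) (simp add: ev_sum del: mult_pCons_left)
  moreover have "c i \<in> \<Inter>Z" for i using h(1) ZD by (auto simp: bf_iff c_def)
  ultimately show "\<exists>c. (\<forall>i. c i \<in> \<Inter>Z) \<and> ev h = (\<Sum>i\<le>k. c i * t ^ i)" by blast
qed

section \<open>Products of fractional ideals\<close>

text \<open>Fractional ideals without the common denominator, which suffices for handling powers of
  ideals.\<close>

definition submod :: "'a::field set \<Rightarrow> 'a set \<Rightarrow> bool" where
  "submod A I \<longleftrightarrow> 0 \<in> I \<and> (\<forall>x\<in>I. \<forall>y\<in>I. x + y \<in> I) \<and> (\<forall>a\<in>A. \<forall>x\<in>I. a * x \<in> I)"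

lemma submodD:
  assumes "submod A I"
  shows "0 \<in> I" "x \<in> I \<Longrightarrow> y \<in> I \<Longrightarrow> x + y \<in> I" "a \<in> A \<Longrightarrow> x \<in> I \<Longrightarrow> a * x \<in> I"
  using assms by (simp_all add: submod_def)

lemma submod_sum:
  assumes "submod A I" "\<And>k. k \<in> B \<Longrightarrow> f k \<in> I"
  shows "sum f B \<in> I"
  using assms(2) by (induction B rule: infinite_finite_induct) (simp_all add: submodD(1,2)[OF assms(1)])

lemma submod_subring: "is_subring A \<Longrightarrow> submod A A"
  by (simp add: submod_def is_subringD)

lemma fractional_submod: "fractional_ideal A I \<Longrightarrow> submod A I"
  unfolding fractional_ideal_def submod_def by blast

lemma ideal_mult_mem: "x \<in> I \<Longrightarrow> y \<in> J \<Longrightarrow> x * y \<in> ideal_mult I J"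
  unfolding ideal_mult_def
  by (intro CollectI exI[of _ "1::nat"] exI[of _ "\<lambda>_. x"] exI[of _ "\<lambda>_. y"]) auto

lemma ideal_mult_0: "0 \<in> ideal_mult I J"
  unfolding ideal_mult_def by (intro CollectI exI[of _ "0::nat"]) auto

lemma ideal_mult_add:
  assumes "u \<in> ideal_mult I J" "v \<in> ideal_mult I J"
  shows "u + v \<in> ideal_mult I J"
proof -
  obtain n :: nat and x y where u: "u = (\<Sum>k<n. x k * y k)" "\<forall>k<n. x k \<in> I \<and> y k \<in> J"
    using assms(1) unfolding ideal_mult_def by blast
  obtain m :: nat and x' y' where v: "v = (\<Sum>k<m. x' k * y' k)" "\<forall>k<m. x' k \<in> I \<and> y' k \<in> J"
    using assms(2) unfolding ideal_mult_def by blast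
  define p where "p k = (if k < n then x k else x' (k - n))" for k
  define q where "q k = (if k < n then y k else y' (k - n))" for k
  have "(\<Sum>k<n+r. p k * q k) = (\<Sum>k<n. x k * y k) + (\<Sum>k<r. x' k * y' k)" for r
    by (induction r) (simp_all add: p_def q_def)
  then have "u + v = (\<Sum>k<n+m. p k * q k)" using u v by simp
  moreover have "\<forall>k<n+m. p k \<in> I \<and> q k \<in> J" using u v by (auto simp: p_def q_def)
  ultimately show ?thesis unfolding ideal_mult_def by blast
qed

text \<open>The product is the least additively closed set that contains 0 and all x y. As an
  elimination rule this avoids work with the defining sums.\<close>

lemma ideal_mult_least:
  assumes "u \<in> ideal_mult I J" "0 \<in> K" "\<And>x y. x \<in> K \<Longrightarrow> y \<in> K \<Longrightarrow> x + y \<in> K"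
    "\<And>x y. x \<in> I \<Longrightarrow> y \<in> J \<Longrightarrow> x * y \<in> K"
  shows "u \<in> K"
proof -
  obtain n :: nat and x y where u: "u = (\<Sum>k<n. x k * y k)" "\<forall>k<n. x k \<in> I \<and> y k \<in> J"
    using assms(1) unfolding ideal_mult_def by blast
  have "(\<Sum>k<m. x k * y k) \<in> K" if "m \<le> n" for m
    using that by (induction m) (use u assms(2-4) in auto)
  then show ?thesis using u by blast
qed

lemma ideal_mult_comm: "ideal_mult I J = ideal_mult J I"
proof -
  have "ideal_mult I J \<subseteq> ideal_mult J I" for I J :: "'a set"
  proof
    fix u assume "u \<in> ideal_mult I J"
    then show "u \<in> ideal_mult J I"
    proof (rule ideal_mult_least)
      fix x y assume "x \<in> I" "y \<in> J"
      then show "x * y \<in> ideal_mult J I" using ideal_mult_mem[of y J x I] by (simp add: mult.commute)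
    qed (auto intro: ideal_mult_0 ideal_mult_add)
  qed
  then show ?thesis by blast
qed

lemma ideal_mult_scale:
  assumes "v \<in> ideal_mult J K" "\<And>y z. y \<in> J \<Longrightarrow> z \<in> K \<Longrightarrow> x * (y * z) \<in> ideal_mult I L"
  shows "x * v \<in> ideal_mult I L"
proof -
  have "v \<in> {v. x * v \<in> ideal_mult I L}"
    by (rule ideal_mult_least[OF assms(1)]) (auto simp: ideal_mult_0 ideal_mult_add distrib_left assms(2))
  then show ?thesis by simp
qed

lemma ideal_mult_assoc: "ideal_mult (ideal_mult I J) K = ideal_mult I (ideal_mult J K)"
proof -
  have *: "ideal_mult I (ideal_mult J K) \<subseteq> ideal_mult (ideal_mult I J) K" for I J K :: "'a set"
  proof
    fix u assume "u \<in> ideal_mult I (ideal_mult J K)"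
    then show "u \<in> ideal_mult (ideal_mult I J) K"
    proof (rule ideal_mult_least)
      fix x v assume x: "x \<in> I" and v: "v \<in> ideal_mult J K"
      show "x * v \<in> ideal_mult (ideal_mult I J) K"
      proof (rule ideal_mult_scale[OF v])
        fix y z assume "y \<in> J" "z \<in> K"
        then have "(x * y) * z \<in> ideal_mult (ideal_mult I J) K" using x by (intro ideal_mult_mem)
        then show "x * (y * z) \<in> ideal_mult (ideal_mult I J) K" by (simp only: mult.assoc)
      qed
    qed (auto intro: ideal_mult_0 ideal_mult_add)
  qed
  \<comment> \<open>By commutativity the other inclusion is the first one with I and K
    exchanged.\<close>
  have "ideal_mult (ideal_mult I J) K = ideal_mult K (ideal_mult J I)"
    unfolding ideal_mult_comm[of J I] by (rule ideal_mult_comm)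
  also have "\<dots> \<subseteq> ideal_mult (ideal_mult K J) I" by (rule *)
  also have "\<dots> = ideal_mult I (ideal_mult J K)"
    unfolding ideal_mult_comm[of J K] by (rule ideal_mult_comm)
  finally show ?thesis using * by blast
qed

lemma submod_ideal_mult:
  assumes "submod A I"
  shows "submod A (ideal_mult I J)"
  unfolding submod_def
proof (intro conjI ballI)
  fix a u assume a: "a \<in> A" and u: "u \<in> ideal_mult I J"
  show "a * u \<in> ideal_mult I J"
  proof (rule ideal_mult_scale[OF u])
    fix y z assume "y \<in> I" "z \<in> J"
    then have "(a * y) * z \<in> ideal_mult I J" using submodD(3)[OF assms a] by (intro ideal_mult_mem)
    then show "a * (y * z) \<in> ideal_mult I J" by (simp only: mult.assoc)
  qed
qed (auto intro: ideal_mult_0 ideal_mult_add)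

lemma ideal_mult_one:
  assumes "is_subring A" "submod A I"
  shows "ideal_mult A I = I"
proof
  show "ideal_mult A I \<subseteq> I"
  proof
    fix u assume "u \<in> ideal_mult A I"
    then show "u \<in> I" by (rule ideal_mult_least) (auto intro: submodD[OF assms(2)])
  qed
  show "I \<subseteq> ideal_mult A I"
    using ideal_mult_mem[OF is_subringD(1)[OF assms(1)]] by force
qed

lemma fractional_ideal_mult:
  assumes A: "is_subring A" and I: "fractional_ideal A I" and J: "fractional_ideal A J"
  shows "fractional_ideal A (ideal_mult I J)"
proof -
  obtain d e where d: "d \<in> A" "d \<noteq> 0" "\<And>x. x \<in> I \<Longrightarrow> d * x \<in> A"
    and e: "e \<in> A" "e \<noteq> 0" "\<And>x. x \<in> J \<Longrightarrow> e * x \<in> A"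
    using I J unfolding fractional_ideal_def by metis
  have "(d * e) * u \<in> A" if "u \<in> ideal_mult I J" for u
  proof -
    have "u \<in> {u. (d * e) * u \<in> A}"
    proof (rule ideal_mult_least[OF that])
      fix x y assume "x \<in> I" "y \<in> J"
      then have "(d * x) * (e * y) \<in> A" by (intro is_subringD(6)[OF A] d e)
      then show "x * y \<in> {u. (d * e) * u \<in> A}" by (simp add: mult_ac)
    qed (auto simp: distrib_left is_subringD(2,4)[OF A])
    then show ?thesis by simp
  qed
  moreover have "d * e \<in> A" "d * e \<noteq> 0" using d e is_subringD(6)[OF A] by auto
  ultimately have "\<exists>d\<in>A. d \<noteq> 0 \<and> (\<forall>x\<in>ideal_mult I J. d * x \<in> A)" by blast
  then show ?thesis
    using submod_ideal_mult[OF fractional_submod[OF I]] unfolding fractional_ideal_def submod_def by blast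
qed

lemma fractional_ideal_self: "is_subring A \<Longrightarrow> fractional_ideal A A"
  using is_subringD(1)[of A] unfolding fractional_ideal_def by (auto simp: is_subringD intro!: bexI[of _ 1])

section \<open>The group of invertible ideals and its quotient by the principal ones\<close>

lemma invertible_simps [simp]:
  "I \<otimes>\<^bsub>invertible_ideals A\<^esub> J = ideal_mult I J" "\<one>\<^bsub>invertible_ideals A\<^esub> = A"
  by (simp_all add: invertible_ideals_def)

lemma invertible_iff: "I \<in> carrier (invertible_ideals A) \<longleftrightarrow>
    fractional_ideal A I \<and> (\<exists>J. fractional_ideal A J \<and> ideal_mult I J = A)"
  by (simp add: invertible_ideals_def)

lemma comm_group_invertible:
  assumes A: "is_subring A"
  shows "comm_group (invertible_ideals A)"
proof (rule comm_groupI)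
  show "\<one>\<^bsub>invertible_ideals A\<^esub> \<in> carrier (invertible_ideals A)"
    using fractional_ideal_self[OF A] ideal_mult_one[OF A submod_subring[OF A]] by (auto simp: invertible_iff)
next
  fix I J assume "I \<in> carrier (invertible_ideals A)" "J \<in> carrier (invertible_ideals A)"
  then obtain I' J' where I: "fractional_ideal A I" "fractional_ideal A I'" "ideal_mult I I' = A"
    and J: "fractional_ideal A J" "fractional_ideal A J'" "ideal_mult J J' = A"
    by (auto simp: invertible_iff)
  have "ideal_mult (ideal_mult I J) (ideal_mult I' J') = ideal_mult I (ideal_mult (ideal_mult J J') I')"
    by (metis ideal_mult_assoc ideal_mult_comm)
  also have "\<dots> = A" by (simp add: J I ideal_mult_one[OF A fractional_submod])
  finally have "\<exists>K. fractional_ideal A K \<and> ideal_mult (ideal_mult I J) K = A"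
    using fractional_ideal_mult[OF A I(2) J(2)] by blast
  then show "I \<otimes>\<^bsub>invertible_ideals A\<^esub> J \<in> carrier (invertible_ideals A)"
    using fractional_ideal_mult[OF A I(1) J(1)] by (simp add: invertible_iff)
next
  fix I assume "I \<in> carrier (invertible_ideals A)"
  then obtain I' where I: "fractional_ideal A I" "fractional_ideal A I'" "ideal_mult I I' = A"
    by (auto simp: invertible_iff)
  then have "I' \<in> carrier (invertible_ideals A)" by (auto simp: invertible_iff ideal_mult_comm[of I'])
  then show "\<exists>J\<in>carrier (invertible_ideals A). J \<otimes>\<^bsub>invertible_ideals A\<^esub> I = \<one>\<^bsub>invertible_ideals A\<^esub>"
    using I(3) ideal_mult_comm[of I' I] by (intro bexI[of _ I']) auto
next
  fix I J K
  show "I \<otimes>\<^bsub>invertible_ideals A\<^esub> J \<otimes>\<^bsub>invertible_ideals A\<^esub> K =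
      I \<otimes>\<^bsub>invertible_ideals A\<^esub> (J \<otimes>\<^bsub>invertible_ideals A\<^esub> K)"
    by (simp add: ideal_mult_assoc)
  show "I \<otimes>\<^bsub>invertible_ideals A\<^esub> J = J \<otimes>\<^bsub>invertible_ideals A\<^esub> I"
    by (simp add: ideal_mult_comm[of I J])
  assume "I \<in> carrier (invertible_ideals A)"
  then show "\<one>\<^bsub>invertible_ideals A\<^esub> \<otimes>\<^bsub>invertible_ideals A\<^esub> I = I"
    by (auto simp: invertible_iff ideal_mult_one[OF A fractional_submod])
qed

lemma principal_mult:
  assumes A: "is_subring A"
  shows "ideal_mult ((*) x ` A) ((*) y ` A) = (*) (x * y) ` A"
proof
  show "ideal_mult ((*) x ` A) ((*) y ` A) \<subseteq> (*) (x * y) ` A"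
  proof
    fix u assume "u \<in> ideal_mult ((*) x ` A) ((*) y ` A)"
    then show "u \<in> (*) (x * y) ` A"
    proof (rule ideal_mult_least)
      show "0 \<in> (*) (x * y) ` A" using is_subringD(2)[OF A] by (auto intro: rev_image_eqI)
      show "a + b \<in> (*) (x * y) ` A" if "a \<in> (*) (x * y) ` A" "b \<in> (*) (x * y) ` A" for a b
        using that is_subringD(4)[OF A] by (auto simp flip: distrib_left)
      show "a * b \<in> (*) (x * y) ` A" if ab: "a \<in> (*) x ` A" "b \<in> (*) y ` A" for a b
      proof -
        obtain p q where pq: "p \<in> A" "q \<in> A" "a = x * p" "b = y * q" using ab by blast
        then have "a * b = (x * y) * (p * q)" by (simp add: mult_ac)
        then show ?thesis using is_subringD(6)[OF A pq(1,2)] by blast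
      qed
    qed
  qed
  show "(*) (x * y) ` A \<subseteq> ideal_mult ((*) x ` A) ((*) y ` A)"
  proof
    fix u assume "u \<in> (*) (x * y) ` A"
    then obtain a where a: "a \<in> A" "u = (x * a) * (y * 1)" by (auto simp: mult_ac)
    then show "u \<in> ideal_mult ((*) x ` A) ((*) y ` A)"
      using is_subringD(1)[OF A] by (auto intro!: ideal_mult_mem simp del: mult_1_right)
  qed
qed

lemma principal_subgroup:
  assumes A: "is_subring A" and q: "quotient_field_UNIV A"
  shows "subgroup (principal_ideals A) (invertible_ideals A)"
proof -
  interpret comm_group "invertible_ideals A" by (rule comm_group_invertible[OF A])
  have frac: "fractional_ideal A ((*) x ` A)" for x
  proof -
    \<comment> \<open>A denominator of x serves as a common denominator for x A; this is where the
      quotient field enters.\<close>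
    obtain a b where ab: "a \<in> A" "b \<in> A" "b \<noteq> 0" "x = a / b" using q unfolding quotient_field_UNIV_def by blast
    have "b * y \<in> A" if y: "y \<in> (*) x ` A" for y
    proof -
      obtain c where "c \<in> A" "y = x * c" using y by blast
      then have "b * y = a * c" using ab by simp
      then show ?thesis using is_subringD(6)[OF A ab(1) \<open>c \<in> A\<close>] by simp
    qed
    moreover have "0 \<in> (*) x ` A" using is_subringD(2)[OF A] by (auto intro: rev_image_eqI)
    moreover have "u + v \<in> (*) x ` A" if "u \<in> (*) x ` A" "v \<in> (*) x ` A" for u v
      using that is_subringD(4)[OF A] by (auto simp flip: distrib_left)
    moreover have "r * u \<in> (*) x ` A" if "r \<in> A" "u \<in> (*) x ` A" for r u
      using that is_subringD(6)[OF A] by (auto simp: mult.left_commute)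
    ultimately show ?thesis unfolding fractional_ideal_def using ab by blast
  qed
  have inv: "ideal_mult ((*) (inverse x) ` A) ((*) x ` A) = A" if "x \<noteq> 0" for x
    unfolding principal_mult[OF A] using that by (simp add: image_def)
  have carr: "(*) x ` A \<in> carrier (invertible_ideals A)" if "x \<noteq> 0" for x
    using inv[OF that] frac[of x] frac[of "inverse x"] by (auto simp: invertible_iff ideal_mult_comm[of "(*) x ` A"])
  show ?thesis
  proof (rule subgroupI)
    show "principal_ideals A \<subseteq> carrier (invertible_ideals A)" using carr by (auto simp: principal_ideals_def)
    show "principal_ideals A \<noteq> {}" by (auto simp: principal_ideals_def intro: exI[of _ 1])
    fix I assume "I \<in> principal_ideals A"
    then obtain x where x: "x \<noteq> 0" "I = (*) x ` A" by (auto simp: principal_ideals_def)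
    have "inv\<^bsub>invertible_ideals A\<^esub> I = (*) (inverse x) ` A"
      unfolding x(2) using inv x(1) by (intro inv_equality carr) auto
    then show "inv\<^bsub>invertible_ideals A\<^esub> I \<in> principal_ideals A"
      using x by (auto simp: principal_ideals_def intro!: exI[of _ "inverse x"])
  next
    fix I J assume "I \<in> principal_ideals A" "J \<in> principal_ideals A"
    then obtain x y where "x \<noteq> 0" "I = (*) x ` A" "y \<noteq> 0" "J = (*) y ` A" by (auto simp: principal_ideals_def)
    then show "I \<otimes>\<^bsub>invertible_ideals A\<^esub> J \<in> principal_ideals A"
      by (auto simp: principal_mult[OF A] principal_ideals_def intro!: exI[of _ "x * y"])
  qed
qed

lemma picard_torsionI:
  assumes A: "is_subring A" and q: "quotient_field_UNIV A"
    and pow: "\<And>I. I \<in> carrier (invertible_ideals A) \<Longrightarrow>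
      \<exists>n::nat. n > 0 \<and> I [^]\<^bsub>invertible_ideals A\<^esub> n \<in> principal_ideals A"
  shows "torsion_group (picard_group A)"
  unfolding torsion_group_def
proof
  interpret comm_group "invertible_ideals A" by (rule comm_group_invertible[OF A])
  note sub = principal_subgroup[OF A q]
  interpret normal "principal_ideals A" "invertible_ideals A" using sub normal_iff_subgroup by blast
  fix g assume "g \<in> carrier (picard_group A)"
  then obtain I where I: "I \<in> carrier (invertible_ideals A)" "g = principal_ideals A #>\<^bsub>invertible_ideals A\<^esub> I"
    by (auto simp: picard_group_def FactGroup_def RCOSETS_def)
  have p: "g [^]\<^bsub>picard_group A\<^esub> n = principal_ideals A #>\<^bsub>invertible_ideals A\<^esub> (I [^]\<^bsub>invertible_ideals A\<^esub> n)"
    for n :: nat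
  proof (induction n)
    case 0
    then show ?case using coset_mult_one[OF subset] by (simp add: picard_group_def)
  next
    case (Suc n)
    have "g [^]\<^bsub>picard_group A\<^esub> Suc n = (g [^]\<^bsub>picard_group A\<^esub> n) <#>\<^bsub>invertible_ideals A\<^esub> g"
      by (simp add: picard_group_def FactGroup_def)
    also have "\<dots> = (principal_ideals A #>\<^bsub>invertible_ideals A\<^esub> (I [^]\<^bsub>invertible_ideals A\<^esub> n))
        <#>\<^bsub>invertible_ideals A\<^esub> (principal_ideals A #>\<^bsub>invertible_ideals A\<^esub> I)"
      unfolding Suc by (simp only: I(2))
    also have "\<dots> = principal_ideals A #>\<^bsub>invertible_ideals A\<^esub>
        (I [^]\<^bsub>invertible_ideals A\<^esub> n \<otimes>\<^bsub>invertible_ideals A\<^esub> I)"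
      using I(1) by (intro rcos_sum) auto
    finally show ?case by simp
  qed
  obtain n :: nat where n: "n > 0" "I [^]\<^bsub>invertible_ideals A\<^esub> n \<in> principal_ideals A" using pow[OF I(1)] by blast
  have "g [^]\<^bsub>picard_group A\<^esub> n = principal_ideals A"
    unfolding p using n(2) I(1) sub by (intro coset_join2) auto
  then show "\<exists>n::nat. n > 0 \<and> g [^]\<^bsub>picard_group A\<^esub> n = \<one>\<^bsub>picard_group A\<^esub>"
    using n(1) by (auto simp: picard_group_def FactGroup_def)
qed

section \<open>Powers of finitely generated ideals\<close>

lemma prime_power_mem:
  assumes A: "is_subring A" and P: "P \<in> primes A" and x: "x \<in> A" "x ^ n \<in> P"
  shows "x \<in> P"
  using x(2)
proof (induction n)
  case (Suc n)
  have "x ^ n \<in> A" by (rule is_subringD(7)[OF A x(1)])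
  moreover have "x * x ^ n \<in> P" using Suc.prems by simp
  ultimately have "x \<in> P \<or> x ^ n \<in> P" using P x(1) unfolding primes_iff[OF A] by blast
  then show ?case using Suc.IH by blast
qed (use P in \<open>simp add: primes_iff[OF A]\<close>)

lemma subring_localization:
  assumes A: "is_subring A" and P: "P \<in> primes A"
  shows "is_subring (localization A P)"
proof -
  note AA = is_subringD[OF A] and PP = P[unfolded primes_iff[OF A]]
  have locI: "a / b \<in> localization A P" if "a \<in> A" "b \<in> A" "b \<notin> P" for a b
    using that by (auto simp: localization_def)
  have locE: "\<exists>a b. x = a / b \<and> a \<in> A \<and> b \<in> A \<and> b \<notin> P \<and> b \<noteq> 0" if "x \<in> localization A P" for x
    using that PP by (auto simp: localization_def)
  have bd: "b * d \<notin> P" if "b \<in> A" "d \<in> A" "b \<notin> P" "d \<notin> P" for b d using that PP by blast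
  show ?thesis unfolding is_subring_iff
  proof (intro conjI ballI)
    show "1 \<in> localization A P" using locI[OF AA(1) AA(1)] PP by simp
  next
    fix x assume "x \<in> localization A P"
    then obtain a b where x: "x = a / b" "a \<in> A" "b \<in> A" "b \<notin> P" using locE by blast
    show "- x \<in> localization A P" using locI[OF AA(3)[OF x(2)] x(3,4)] x(1) by simp
  next
    fix x y assume xy: "x \<in> localization A P" "y \<in> localization A P"
    obtain a b where x: "x = a / b" "a \<in> A" "b \<in> A" "b \<notin> P" "b \<noteq> 0" using locE[OF xy(1)] by blast
    obtain c d where y: "y = c / d" "c \<in> A" "d \<in> A" "d \<notin> P" "d \<noteq> 0" using locE[OF xy(2)] by blast
    have "(a * d + c * b) / (b * d) \<in> localization A P"
      by (intro locI AA(4) AA(6) bd x y)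
    then show "x + y \<in> localization A P" using x y by (simp add: add_frac_eq)
    have "(a * c) / (b * d) \<in> localization A P"
      by (intro locI AA(6) bd x y)
    then show "x * y \<in> localization A P" using x y by simp
  qed
qed

text \<open>The outcome of the geometric part: with A the intersection of Z, for every t some power
  (1, t)^k equals u A. The coefficients c show that u lies in this power, the quotients t^i / u give
  the other inclusion.\<close>

locale principal_powers =
  fixes Z :: "'a::field set set"
  assumes val: "V \<in> Z \<Longrightarrow> valuation_ring V"
    and key: "\<exists>k\<ge>1. \<exists>u c. u \<noteq> 0 \<and> (\<forall>i\<le>k. t ^ i / u \<in> \<Inter>Z) \<and> (\<forall>i. c i \<in> \<Inter>Z) \<and> u = (\<Sum>i\<le>k. c i * t ^ i)"
begin

lemma VS: "V \<in> Z \<Longrightarrow> is_subring V"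
  using val valuation_ringD(1) by blast

lemma subring: "is_subring (\<Inter>Z)"
  using VS unfolding is_subring_iff by blast

lemma quotient_field: "quotient_field_UNIV (\<Inter>Z)"
  unfolding quotient_field_UNIV_def
proof
  fix x
  obtain k :: nat and u where k: "k \<ge> 1" "u \<noteq> 0" "\<forall>i\<le>k. x ^ i / u \<in> \<Inter>Z"
    using key[of x] by (elim exE conjE)
  have "x ^ 1 / u \<in> \<Inter>Z" "x ^ 0 / u \<in> \<Inter>Z" using k by blast+
  then show "\<exists>a\<in>\<Inter>Z. \<exists>b\<in>\<Inter>Z. b \<noteq> 0 \<and> x = a / b"
    using k(2) by (intro bexI[of _ "x ^ 1 / u"] bexI[of _ "x ^ 0 / u"]) auto
qed

text \<open>The elements t^i / u generate the unit ideal of the intersection, and the k-th power of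
  each is a product of powers of 1 / u and t^k / u. So a prime P misses one of these two, and using
  that one as denominator puts t or its inverse into the localization.\<close>

lemma prufer: "prufer_domain (\<Inter>Z)"
  unfolding prufer_domain_def
proof (intro conjI ballI subring)
  fix P assume P: "P \<in> primes (\<Inter>Z)"
  note PP = P[unfolded primes_iff[OF subring]]
  show "valuation_ring (localization (\<Inter>Z) P)"
    unfolding valuation_ring_def
  proof (intro conjI allI impI subring_localization[OF subring P])
    fix t :: 'a assume t0: "t \<noteq> 0"
    obtain k :: nat and u c where *: "k \<ge> 1" "u \<noteq> 0" "\<forall>i\<le>k. t ^ i / u \<in> \<Inter>Z" "\<forall>i. c i \<in> \<Inter>Z"
      "u = (\<Sum>i\<le>k. c i * t ^ i)" using key[of t] by (elim exE conjE)
    note k = *(1,2) *(3)[rule_format] *(4)[rule_format] *(5)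
    have not_both: "\<not> (t ^ 0 / u \<in> P \<and> t ^ k / u \<in> P)"
    proof
      assume both: "t ^ 0 / u \<in> P \<and> t ^ k / u \<in> P"
      have "t ^ i / u \<in> P" if i: "i \<le> k" for i
      proof (cases "i = k")
        case False
        \<comment> \<open>Here j + 1 = k - i, so that one factor 1 / u, which lies in P, can be
          split off.\<close>
        define j where "j = k - i - 1"
        have kj: "k = Suc j + i" using False i by (simp add: j_def)
        have "(t ^ i / u) ^ k = ((t ^ 0 / u) ^ j * (t ^ k / u) ^ i) * (t ^ 0 / u)"
        proof -
          have "u ^ k = u ^ j * u ^ i * u" by (simp add: kj power_add mult_ac)
          then show ?thesis by (simp add: power_divide mult.commute flip: power_mult)
        qed
        moreover have "((t ^ 0 / u) ^ j * (t ^ k / u) ^ i) \<in> \<Inter>Z"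
          by (intro is_subringD(6)[OF subring] is_subringD(7)[OF subring] k(3)) simp_all
        ultimately have "(t ^ i / u) ^ k \<in> P" using both PP by metis
        then show ?thesis by (rule prime_power_mem[OF subring P k(3)[OF i]])
      qed (use both in simp)
      then have "c i * (t ^ i / u) \<in> P" if "i \<le> k" for i using that k(4) PP by blast
      moreover have "submod (\<Inter>Z) P" using PP unfolding submod_def by blast
      ultimately have "(\<Sum>i\<le>k. c i * (t ^ i / u)) \<in> P" by (intro submod_sum) auto
      also have "(\<Sum>i\<le>k. c i * (t ^ i / u)) = (\<Sum>i\<le>k. c i * t ^ i) / u"
        by (simp add: sum_divide_distrib)
      also have "\<dots> = 1" unfolding k(5)[symmetric] using k(2) by simp
      finally show False using PP by blast
    qed
    consider "t ^ 0 / u \<notin> P" | "t ^ k / u \<notin> P" using not_both by blast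
    then show "t \<in> localization (\<Inter>Z) P \<or> inverse t \<in> localization (\<Inter>Z) P"
    proof cases
      case 1
      have "t = (t ^ 1 / u) / (t ^ 0 / u)" using k(2) by simp
      moreover have "t ^ 1 / u \<in> \<Inter>Z" "t ^ 0 / u \<in> \<Inter>Z" using k(1) by (intro k(3); simp)+
      ultimately have "t \<in> localization (\<Inter>Z) P" using 1 unfolding localization_def by blast
      then show ?thesis ..
    next
      case 2
      have "inverse t = (t ^ (k - 1) / u) / (t ^ k / u)"
        using k(1,2) t0 by (cases k) (simp_all add: field_simps)
      moreover have "t ^ (k - 1) / u \<in> \<Inter>Z" "t ^ k / u \<in> \<Inter>Z" by (intro k(3); simp)+
      ultimately have "inverse t \<in> localization (\<Inter>Z) P" using 2 unfolding localization_def by blast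
      then show ?thesis ..
    qed
  qed
qed

text \<open>The recursion for powers gives a meaning to this for every subset I; the power 0 is the
  ring itself.\<close>

abbreviation pw :: "'a set \<Rightarrow> nat \<Rightarrow> 'a set" where
  "pw I n \<equiv> I [^]\<^bsub>invertible_ideals (\<Inter>Z)\<^esub> n"

lemma pw_simps: "pw I 0 = \<Inter>Z" "pw I (Suc n) = ideal_mult (pw I n) I"
  by simp_all

lemma submod_pw: "submod (\<Inter>Z) (pw I n)"
proof (induction n)
  case 0
  then show ?case unfolding pw_simps by (rule submod_subring[OF subring])
next
  case (Suc n)
  then show ?case unfolding pw_simps by (rule submod_ideal_mult)
qed

lemma pw_mult:
  assumes "x \<in> pw I n" "y \<in> pw I m"
  shows "x * y \<in> pw I (n + m)"
  using assms(2)
proof (induction m arbitrary: y)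
  case 0
  then have "y * x \<in> pw I n" using assms(1) unfolding pw_simps by (intro submodD(3)[OF submod_pw])
  then show ?case by (simp add: mult.commute)
next
  case (Suc m)
  have "x * y \<in> ideal_mult (pw I (n + m)) I"
  proof (rule ideal_mult_scale[OF Suc.prems[unfolded pw_simps]])
    fix y z assume "y \<in> pw I m" "z \<in> I"
    then have "(x * y) * z \<in> ideal_mult (pw I (n + m)) I" using Suc.IH by (intro ideal_mult_mem)
    then show "x * (y * z) \<in> ideal_mult (pw I (n + m)) I" by (simp only: mult.assoc)
  qed
  then show ?case by simp
qed

lemma pw_power: "x \<in> pw I n \<Longrightarrow> x ^ i \<in> pw I (n * i)"
proof (induction i)
  case 0
  then show ?case using is_subringD(1)[OF subring] by simp
next
  case (Suc i)
  then show ?case using pw_mult[of x I n "x ^ i" "n * i"] by simp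
qed

lemma pw_one:
  assumes "x \<in> I"
  shows "x \<in> pw I 1"
proof -
  have "1 * x \<in> ideal_mult (pw I 0) I"
    using assms is_subringD(1)[OF subring] by (intro ideal_mult_mem) (simp_all only: pw_simps)
  then show ?thesis by simp
qed

text \<open>With \<open>w\<close> generating the power \<open>N\<close> of the ideal generated by the first \<open>n\<close> elements and
  \<open>t = x\<^sub>n\<^sup>N / w\<close>, the power of \<open>(w, x\<^sub>n\<^sup>N)\<close> generated by \<open>w\<^sup>k u\<close> has the same extension to each \<open>V\<close> as
  a power of the ideal generated by the first \<open>n + 1\<close> elements.\<close>

lemma common_generator:
  fixes n :: nat and x :: "nat \<Rightarrow> 'a"
  assumes "\<And>k. k < n \<Longrightarrow> x k \<in> I" "\<exists>k<n. x k \<noteq> 0"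
  shows "\<exists>N\<ge>1. \<exists>w\<in>pw I N. w \<noteq> 0 \<and> (\<forall>k<n. x k ^ N / w \<in> \<Inter>Z)"
  using assms
proof (induction n)
  case (Suc n)
  note A = is_subringD[OF subring]
  show ?case
  proof (cases "\<exists>k<n. x k \<noteq> 0")
    \<comment> \<open>Only the last element is nonzero, and it serves as w with N = 1.\<close>
    case False
    then have 0: "x k = 0" if "k < n" for k using that by blast
    have "x n \<noteq> 0" using Suc.prems(2) 0 less_Suc_eq by metis
    moreover have "x k ^ 1 / x n \<in> \<Inter>Z" if "k < Suc n" for k
      using that 0[of k] A(1,2) \<open>x n \<noteq> 0\<close> by (cases "k = n") auto
    ultimately show ?thesis using pw_one[OF Suc.prems(1)[of n]] by (intro exI[of _ 1] conjI bexI[of _ "x n"]) auto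
  next
    case True
    then obtain N w where N: "N \<ge> 1" "w \<in> pw I N" "w \<noteq> 0" "\<And>k. k < n \<Longrightarrow> x k ^ N / w \<in> \<Inter>Z"
      using Suc.IH[OF Suc.prems(1)] by (metis less_SucI)
    define t where "t = x n ^ N / w"
    obtain k :: nat and u c where *: "k \<ge> 1" "u \<noteq> 0" "\<forall>i\<le>k. t ^ i / u \<in> \<Inter>Z" "\<forall>i. c i \<in> \<Inter>Z"
      "u = (\<Sum>i\<le>k. c i * t ^ i)" using key[of t] by (elim exE conjE)
    note k = *(1,2) *(3)[rule_format] *(4)[rule_format] *(5)
    have xN: "x n ^ N \<in> pw I N" using pw_power[OF pw_one[OF Suc.prems(1)[of n]], of N] by simp
    \<comment> \<open>Since w t is the N-th power of the last element, each w^k t^i is a product of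
      powers of w and of this N-th power, and lies in the power N k of I.\<close>
    have "w ^ k * u = (\<Sum>i\<le>k. c i * (w ^ (k - i) * (x n ^ N) ^ i))"
      unfolding k(5) sum_distrib_left
    proof (intro sum.cong refl)
      fix i assume "i \<in> {..k}"
      then have "w ^ k = w ^ (k - i) * w ^ i" by (simp flip: power_add)
      then show "w ^ k * (c i * t ^ i) = c i * (w ^ (k - i) * (x n ^ N) ^ i)"
        using N(3) by (simp add: t_def power_divide)
    qed
    also have "\<dots> \<in> pw I (N * k)"
    proof (rule submod_sum[OF submod_pw])
      fix i assume "i \<in> {..k}"
      then have "N * (k - i) + N * i = N * k" by (simp flip: distrib_left)
      then have "w ^ (k - i) * (x n ^ N) ^ i \<in> pw I (N * k)"
        using pw_mult[OF pw_power[OF N(2), of "k - i"] pw_power[OF xN, of i]] by (simp only:)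
      then show "c i * (w ^ (k - i) * (x n ^ N) ^ i) \<in> pw I (N * k)" by (rule submodD(3)[OF submod_pw k(4)])
    qed
    finally have mem: "w ^ k * u \<in> pw I (N * k)" .
    \<comment> \<open>For the last element the quotient is t^k / u; for an earlier one it is the
      k-th power of an element of the ring times 1 / u.\<close>
    have "x j ^ (N * k) / (w ^ k * u) \<in> \<Inter>Z" if j: "j < Suc n" for j
    proof (cases "j = n")
      case True
      then have "x j ^ (N * k) / (w ^ k * u) = t ^ k / u" by (simp add: t_def power_divide power_mult)
      then show ?thesis using k(3)[of k] by simp
    next
      case False
      then have "x j ^ N / w \<in> \<Inter>Z" using N(4) j by simp
      then have "(x j ^ N / w) ^ k * (t ^ 0 / u) \<in> \<Inter>Z" by (intro A(6) A(7) k(3)) simp_all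
      moreover have "(x j ^ N / w) ^ k * (t ^ 0 / u) = x j ^ (N * k) / (w ^ k * u)"
        by (simp add: power_divide power_mult)
      ultimately show ?thesis by (simp only:)
    qed
    moreover have "N * k \<ge> 1" using N(1) k(1) by simp
    moreover have "w ^ k * u \<noteq> 0" using N(3) k(2) by simp
    ultimately show ?thesis using mem by blast
  qed
qed simp

text \<open>Divisibility in a valuation ring is total, so among finitely many elements, not all 0,
  some nonzero one divides all of them in V.\<close>

lemma dominant_element:
  fixes n :: nat and x :: "nat \<Rightarrow> 'a"
  assumes V: "V \<in> Z" and "\<exists>k<n. x k \<noteq> 0"
  shows "\<exists>m<n. x m \<noteq> 0 \<and> (\<forall>k<n. x k / x m \<in> V)"
  using assms(2)
proof (induction n)
  case (Suc n)
  note VV = is_subringD[OF VS[OF V]]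
  show ?case
  proof (cases "\<exists>k<n. x k \<noteq> 0")
    case False
    then have 0: "x k = 0" if "k < n" for k using that by blast
    have "x n \<noteq> 0" using Suc.prems 0 less_Suc_eq by metis
    then show ?thesis using 0 VV(1,2) by (intro exI[of _ n]) (auto simp: less_Suc_eq)
  next
    case True
    then obtain m where m: "m < n" "x m \<noteq> 0" "\<And>k. k < n \<Longrightarrow> x k / x m \<in> V" using Suc.IH by blast
    show ?thesis
    proof (cases "x n / x m \<in> V")
      case True
      then show ?thesis using m by (intro exI[of _ m]) (auto simp: less_Suc_eq)
    next
      case False
      then have n0: "x n \<noteq> 0" using VV(2) by auto
      have inv: "x m / x n \<in> V" using valuation_ringD(2)[OF val[OF V] False] by simp
      have "x k / x n \<in> V" if "k < Suc n" for k
      proof (cases "k = n")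
        case False
        then have "(x k / x m) * (x m / x n) \<in> V" using that m(3) inv by (intro VV(6)) auto
        then show ?thesis using m(2) by simp
      qed (use n0 VV(1) in simp)
      then show ?thesis using n0 by blast
    qed
  qed
qed simp

text \<open>Write 1 as the sum of x_k y_k with x_k in I and y_k in its inverse J. At each V the
  dominant x_m generates the extension of I, so an element of I^N is a V-multiple of x_m^N and
  therefore of w. As w lies in I^N and does not depend on V, it generates I^N over the ring.\<close>

lemma torsion: "torsion_group (picard_group (\<Inter>Z))"
proof (rule picard_torsionI[OF subring quotient_field])
  fix I assume "I \<in> carrier (invertible_ideals (\<Inter>Z))"
  then obtain J where I: "fractional_ideal (\<Inter>Z) I" and IJ: "ideal_mult I J = \<Inter>Z"
    by (auto simp: invertible_iff)
  have "1 \<in> ideal_mult I J" using is_subringD(1)[OF subring] IJ by simp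
  then obtain n :: nat and x y where xy: "1 = (\<Sum>k<n. x k * y k)" "\<And>k. k < n \<Longrightarrow> x k \<in> I \<and> y k \<in> J"
    unfolding ideal_mult_def by blast
  have "\<exists>k<n. x k \<noteq> 0"
  proof (rule ccontr)
    assume "\<not> ?thesis"
    then have "(\<Sum>k<n. x k * y k) = 0" by (intro sum.neutral) auto
    then show False using xy(1) by simp
  qed
  moreover from this obtain N w where N: "N \<ge> 1" "w \<in> pw I N" "w \<noteq> 0" "\<And>k. k < n \<Longrightarrow> x k ^ N / w \<in> \<Inter>Z"
    using common_generator[of n x I] xy(2) by metis
  have "pw I N = (*) w ` \<Inter>Z"
  proof
    show "(*) w ` \<Inter>Z \<subseteq> pw I N"
      using submodD(3)[OF submod_pw _ N(2)] by (auto simp: mult.commute[of w])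
    show "pw I N \<subseteq> (*) w ` \<Inter>Z"
    proof
      fix a assume a: "a \<in> pw I N"
      have "a / w \<in> V" if V: "V \<in> Z" for V
      proof -
        note VV = is_subringD[OF VS[OF V]]
        obtain m where m: "m < n" "x m \<noteq> 0" "\<And>k. k < n \<Longrightarrow> x k / x m \<in> V"
          using dominant_element[OF V \<open>\<exists>k<n. x k \<noteq> 0\<close>] by blast
        have zI: "z / x m \<in> V" if z: "z \<in> I" for z
        proof -
          \<comment> \<open>Expanding 1 as the sum of the x_k y_k; the factors z y_k lie in I J,
            which is the ring.\<close>
          have "z / x m = z * (\<Sum>k<n. x k * y k) / x m" using xy(1) by simp
          also have "\<dots> = (\<Sum>k<n. (z * y k) * (x k / x m))"
            by (simp add: sum_distrib_left sum_divide_distrib mult_ac)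
          also have "\<dots> \<in> V"
          proof (rule is_subring_sum[OF VS[OF V]])
            fix k assume "k \<in> {..<n}"
            then have k: "k < n" by simp
            have "z * y k \<in> \<Inter>Z" using ideal_mult_mem[OF z, of "y k" J] xy(2)[OF k] IJ by simp
            then show "(z * y k) * (x k / x m) \<in> V" using V by (intro VV(6)[OF _ m(3)[OF k]]) blast
          qed
          finally show ?thesis .
        qed
        have pwV: "b / x m ^ i \<in> V" if "b \<in> pw I i" for b i
          using that
        proof (induction i arbitrary: b)
          case 0
          then show ?case using V by simp
        next
          case (Suc i)
          have "b \<in> {b. b / x m ^ Suc i \<in> V}"
          proof (rule ideal_mult_least[OF Suc.prems[unfolded pw_simps]])
            fix p q assume "p \<in> pw I i" "q \<in> I"
            then have "(p / x m ^ i) * (q / x m) \<in> V" using Suc.IH zI by (intro VV(6))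
            then show "p * q \<in> {b. b / x m ^ Suc i \<in> V}" by (simp add: mult.commute)
          qed (simp_all add: VV(2,4) add_divide_distrib)
          then show ?case by simp
        qed
        have "(a / x m ^ N) * (x m ^ N / w) \<in> V"
          using N(4)[OF m(1)] V by (intro VV(6) pwV[OF a]) auto
        then show ?thesis using m(2) by simp
      qed
      then have "w * (a / w) \<in> (*) w ` \<Inter>Z" by blast
      then show "a \<in> (*) w ` \<Inter>Z" using N(3) by simp
    qed
  qed
  then have "pw I N \<in> principal_ideals (\<Inter>Z)" using N(3) by (auto simp: principal_ideals_def)
  then show "\<exists>n::nat. n > 0 \<and> pw I n \<in> principal_ideals (\<Inter>Z)" using N(1) by (intro exI[of _ N]) auto
qed

end

section \<open>From a missed closed point to principal powers of (1, t)\<close>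

theorem theorem4p2:
  fixes D :: "'a::field set" and Z :: "'a set set"
  assumes "is_subring D"
    and "Z \<subseteq> zariski_riemann D"
    and "UNIV \<in> Z"
    and "local_ring (ring_on D)"
    and "integrally_closed_in_field D"
    and "finite {V \<in> Z. \<not> dominates V D}"
    and "\<not> (\<exists>f. D_morphism_to_proj_line D Z f \<and> closed_points (proj_line D) \<subseteq> fst f ` Z)"
  shows "prufer_domain (\<Inter>Z) \<and> quotient_field_UNIV (\<Inter>Z) \<and> torsion_group (picard_group (\<Inter>Z))"
proof -
  define M where "M = max_ideal (ring_on D)"
  note max = max_ideal_local[OF assms(1,4), folded M_def]
  interpret local_subring D M
    using assms(1) max(2,3) max(1)[unfolded ideal_ring_on_iff[OF assms(1)]] by unfold_locales auto
  have val: "valuation_ring V" if "V \<in> Z" for V using that assms(2) by (auto simp: zariski_riemann_def)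
  have key: "\<exists>k\<ge>1. \<exists>u c. u \<noteq> 0 \<and> (\<forall>i\<le>k. t ^ i / u \<in> \<Inter>Z) \<and> (\<forall>i. c i \<in> \<Inter>Z) \<and> u = (\<Sum>i\<le>k. c i * t ^ i)"
    for t
  proof -
    interpret zr: zr_element D Z t by unfold_locales (fact assms)+
    have "\<not> closed_points (proj_line D) \<subseteq> zr.pt ` Z"
      using assms(7) zr.D_morphism_pt by (metis fst_conv)
    then obtain Q where Q: "Q \<in> closed_points (proj_line D)" "Q \<notin> zr.pt ` Z" by blast
    \<comment> \<open>If V dominates D, the elements of M are nonunits of V, so \<open>pt V\<close>
      contains the constants from M. Only the images of the finitely many other V can miss
      one.\<close>
    have "{P \<in> zr.pt ` Z. \<exists>a\<in>M. cst a \<notin> P} \<subseteq> zr.pt ` {V \<in> Z. \<not> dominates V D}"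
    proof
      fix P assume "P \<in> {P \<in> zr.pt ` Z. \<exists>a\<in>M. cst a \<notin> P}"
      then obtain V a where V: "V \<in> Z" "P = zr.pt V" "a \<in> M" "cst a \<notin> zr.pt V" by blast
      then have "a \<notin> nonunits V" using zr.pt_cst[OF V(1)] M(1) by blast
      then have "\<not> dominates V D"
        using V(3) by (auto simp: dominates_def max_ideal_valuation[OF val[OF V(1)]] simp flip: M_def)
      then show "P \<in> zr.pt ` {V \<in> Z. \<not> dominates V D}" using V by blast
    qed
    then have fin: "finite {P \<in> zr.pt ` Z. \<exists>a\<in>M. cst a \<notin> P}" using assms(6) finite_surj by blast
    have "Q \<in> points" using Q(1) topspace_proj_line[OF assms(1)]
      by (auto simp: closed_points_def proj_line_def Proj_def)
    then have "\<exists>k\<ge>1. \<exists>h\<in>binary_forms D k. \<forall>P\<in>zr.pt ` Z. h \<notin> P"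
      using closed_point_maximal[OF assms(1) Q(1)] zr.pt_point Q(2) fin
      by (intro form_avoiding_points[of Q]) auto
    then obtain k h where k: "k \<ge> 1" and h: "h \<in> binary_forms D k" "\<And>V. V \<in> Z \<Longrightarrow> h \<notin> zr.pt V" by blast
    obtain c where "\<forall>i. c i \<in> \<Inter>Z" "zr.ev h = (\<Sum>i\<le>k. c i * t ^ i)" using zr.unit_form(3)[OF h] by blast
    then show ?thesis using k zr.unit_form(1,2)[OF h] by (intro exI[of _ k] conjI exI[of _ "zr.ev h"] exI[of _ c]) auto
  qed
  interpret principal_powers Z by unfold_locales (fact val, fact key)
  show ?thesis using prufer quotient_field torsion by blast
qed

end
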